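(* Let $(\xi_n)_{n\ge 1}$ be a stationary Gaussian sequence with $\mathbb{E}\xi_1=0$, $\operatorname{Var}\xi_1=1$ and $\gamma(k)=\operatorname{Cov}(\xi_1,\xi_{k+1})\sim k^{-D}L(k)$ as $k\to\infty$, for some $D\in(0,1)$ and slowly varying $L$. Let $G$ be measurable, $X_n=G(\xi_n)$, with marginal distribution function $F(x)=x$ on $[0,1]$. Let $r$ be the Hermite rank of $\{1_{\{G(\xi_1)\le x\}}-x: x\in[0,1]\}$ and assume $Dr<1$. Let $\lambda<1/3$ and $\vartheta>0$ be such that $$\sup_{t,x\in[0,1]} d_{n,r}^{-1}(\min\{x,1-x\})^{-\lambda}\Big|\sum_{j=1}^{\lfloor nt\rfloor}\big(1_{\{X_j\le x\}}-x\big)-\tfrac{1}{r!}J_r(x)\sum_{j=1}^{\lfloor nt\rfloor}H_r(\xi_j)\Big|=\mathcal{O}_P(n^{-\vartheta}),$$ and assume $n^{\lambda}=o(d_{n,r}^{1-\lambda})$, $n^{2\lambda}d_{n,r}=o(n)$ and $d_{n,r}^{\lambda}=o(n^{\vartheta})$. Then $$\sup_{t\in[0,1],x\in[0,1]} d_{n,r}^{-1}(\min\{x,1-x\})^{-\lambda}\Big|\Big(\hat G_{\lfloor nt\rfloor}(x-)-\frac{\lfloor nt\rfloor}{n}\hat G_n(x-)\Big)-\frac{1}{r!}J_r(x)\Big(\sum_{i=1}^{\lfloor nt\rfloor}H_r(\xi_i)-\frac{\lfloor nt\rfloor}{n}\sum_{i=1}^{n}H_r(\xi_i)\Big)\Bi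g|=o_P(1).$$
   Context: $H_q$ is the $q$-th Hermite polynomial $H_q(x)=(-1)^q e^{x^2/2}\frac{d^q}{dx^q}e^{-x^2/2}$; $J_q(y)=\mathbb{E}[1_{\{G(\xi_1)\le y\}}H_q(\xi_1)]$; $r(y)=\min\{q\ge1:J_q(y)\ne0\}$ and $r=\min_y r(y)$. $d_{n,r}^2=\operatorname{Var}(\sum_{i=1}^nH_r(\xi_i))$. $R_i=\sum_{j=1}^n 1_{\{X_j\le X_i\}}$ is the rank of $X_i$ among $X_1,\dots,X_n$, $\hat G_k(x)=\sum_{i=1}^k 1_{\{R_i/(n+1)\le x\}}$, and $\hat G_k(x-)$ denotes the left limit at $x$. *)

theory Defs
  imports "HOL-Probability.Probability" "HOL-Library.Landau_Symbols"
begin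

definition hermite :: "nat \<Rightarrow> real \<Rightarrow> real" where
  "hermite q x = (-1) ^ q * exp (x ^ 2 / 2) * ((deriv ^^ q) (\<lambda>y. exp (- (y ^ 2) / 2))) x"

definition gaussian_rv :: "'a measure \<Rightarrow> ('a \<Rightarrow> real) \<Rightarrow> bool" where
  "gaussian_rv M X \<longleftrightarrow> X \<in> borel_measurable M \<and>
     (\<exists>\<mu> \<sigma>. \<sigma> \<ge> 0 \<and> distr M borel X =
        (if \<sigma> = 0 then return borel \<mu> else density lborel (normal_density \<mu> \<sigma>)))"

definition gaussian_seq :: "'a measure \<Rightarrow> (nat \<Rightarrow> 'a \<Rightarrow> real) \<Rightarrow> bool" where
  "gaussian_seq M \<xi> \<longleftrightarrow> (\<forall>I c. finite I \<longrightarrow> I \<subseteq> {1..} \<longrightarrow>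
      gaussian_rv M (\<lambda>\<omega>. \<Sum>i\<in>I. c i * \<xi> i \<omega>))"

definition stationary_seq :: "'a measure \<Rightarrow> (nat \<Rightarrow> 'a \<Rightarrow> real) \<Rightarrow> bool" where
  "stationary_seq M \<xi> \<longleftrightarrow> (\<forall>I h. finite I \<longrightarrow> I \<subseteq> {1..} \<longrightarrow>
      distr M (PiM I (\<lambda>_. borel)) (\<lambda>\<omega>. \<lambda>i\<in>I. \<xi> (i + h) \<omega>)
    = distr M (PiM I (\<lambda>_. borel)) (\<lambda>\<omega>. \<lambda>i\<in>I. \<xi> i \<omega>))"

definition covar :: "'a measure \<Rightarrow> ('a \<Rightarrow> real) \<Rightarrow> ('a \<Rightarrow> real) \<Rightarrow> real" where
  "covar M X Y = (\<integral>\<omega>. (X \<omega> - (\<integral>\<omega>'. X \<omega>' \<partial>M)) * (Y \<omega> - (\<integral>\<omega>'. Y \<omega>' \<partial>M)) \<partial>M)"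

definition var :: "'a measure \<Rightarrow> ('a \<Rightarrow> real) \<Rightarrow> real" where
  "var M X = covar M X X"

definition slowly_varying :: "(real \<Rightarrow> real) \<Rightarrow> bool" where
  "slowly_varying L \<longleftrightarrow> L \<in> borel_measurable borel \<and> (\<forall>\<^sub>F x in at_top. L x > 0) \<and>
     (\<forall>a>0. ((\<lambda>x. L (a * x) / L x) \<longlongrightarrow> 1) at_top)"

definition Jfun :: "'a measure \<Rightarrow> (real \<Rightarrow> real) \<Rightarrow> ('a \<Rightarrow> real) \<Rightarrow> nat \<Rightarrow> real \<Rightarrow> real" where
  "Jfun M G Z q y = (\<integral>\<omega>. (if G (Z \<omega>) \<le> y then 1 else 0) * hermite q (Z \<omega>) \<partial>M)"

definition hermite_rank :: "'a measure \<Rightarrow> (real \<Rightarrow> real) \<Rightarrow> ('a \<Rightarrow> real) \<Rightarrow> nat" where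
  "hermite_rank M G Z = (LEAST q. q \<ge> 1 \<and> (\<exists>x\<in>{0..1}. Jfun M G Z q x \<noteq> 0))"

definition dnr :: "'a measure \<Rightarrow> (nat \<Rightarrow> 'a \<Rightarrow> real) \<Rightarrow> nat \<Rightarrow> nat \<Rightarrow> real" where
  "dnr M \<xi> r n = sqrt (var M (\<lambda>\<omega>. \<Sum>i=1..n. hermite r (\<xi> i \<omega>)))"

definition rank_of :: "(nat \<Rightarrow> real) \<Rightarrow> nat \<Rightarrow> nat \<Rightarrow> real" where
  "rank_of X n i = (\<Sum>j=1..n. if X j \<le> X i then 1 else 0)"

definition Ghat :: "(nat \<Rightarrow> real) \<Rightarrow> nat \<Rightarrow> nat \<Rightarrow> real \<Rightarrow> real" where
  "Ghat X n k x = (\<Sum>i=1..k. if rank_of X n i / (real n + 1) \<le> x then 1 else 0)"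

definition Ghat_left :: "(nat \<Rightarrow> real) \<Rightarrow> nat \<Rightarrow> nat \<Rightarrow> real \<Rightarrow> real" where
  "Ghat_left X n k x = Lim (at_left x) (Ghat X n k)"

text \<open>Outer probability (events may be non-measurable because of suprema).\<close>
definition outer_prob :: "'a measure \<Rightarrow> 'a set \<Rightarrow> real" where
  "outer_prob M A = Inf (measure M ` {B \<in> sets M. A \<subseteq> B})"

definition bigO_P :: "'a measure \<Rightarrow> (nat \<Rightarrow> 'a \<Rightarrow> ereal) \<Rightarrow> (nat \<Rightarrow> real) \<Rightarrow> bool" where
  "bigO_P M Y a \<longleftrightarrow> (\<forall>\<epsilon>>0. \<exists>K N. \<forall>n\<ge>N.
      outer_prob M {\<omega> \<in> space M. \<bar>Y n \<omega>\<bar> > ereal (K * a n)} < \<epsilon>)"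

definition smallo_P :: "'a measure \<Rightarrow> (nat \<Rightarrow> 'a \<Rightarrow> ereal) \<Rightarrow> bool" where
  "smallo_P M Y \<longleftrightarrow> (\<forall>\<epsilon>>0. ((\<lambda>n. outer_prob M {\<omega> \<in> space M. \<bar>Y n \<omega>\<bar> > ereal \<epsilon>})
      \<longlonglongrightarrow> 0))"

end

theory Submission
  imports Defs "HOL-Computational_Algebra.Polynomial"
begin

text \<open>
  Write \<open>W k x\<close> for the number of \<open>j \<le> k\<close> with \<open>X j \<le> x\<close>, \<open>S k\<close> for the Hermite partial sums and
  \<open>J = J_r / r!\<close>. For \<open>x\<close> away from the endpoints, the indices whose rank is below \<open>(n + 1) x\<close> are
  exactly those with \<open>X i \<le> z\<close>, for a random threshold \<open>z\<close>; so the rank process at \<open>x\<close> is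
  \<open>W k z\<close>, and in \<open>W k z - (k/n) W n z\<close> the drift \<open>k z\<close> cancels. What remains is the
  approximation error at \<open>z\<close> together with \<open>(J z - J x) (S k - (k/n) S n)\<close>. Comparing counts on
  both sides of \<open>z\<close> shows \<open>\<bar>z - x\<bar> = O(d_n / n)\<close>, and by the Cauchy-Schwarz inequality \<open>J\<close> is
  Hoelder continuous of exponent \<open>1/2\<close>.

  The remaining ingredient is \<open>max_{k \<le> n} \<bar>S k\<bar> = O_P(d_n)\<close>, obtained by dyadic chaining. It needs
  \<open>d_m^2 \<le> C (m/n)^\<kappa> d_n^2\<close> with \<open>\<kappa> > 1\<close>, which follows from
  \<open>E H_r(\<xi>_i) H_r(\<xi>_j) = r! \<gamma>(i - j)^r\<close> and Potter bounds for the regularly varying \<open>\<gamma>\<close>.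
\<close>

section \<open>Hermite polynomials and Gaussian pairs\<close>

text \<open>The sign of \<open>lam\<close> decides where the difficulty lies. For
  \<open>lam >= 0\<close> the weight blows up at the endpoints. Within 1/(n+1) of an endpoint the
  rank process counts no index or all of them, and J vanishes there like a square root; elsewhere
  the weight costs a power of n, which \<open>c2\<close> and \<open>c3\<close> absorb. For
  \<open>lam < 0\<close> the weight is bounded, but the hypothesis says little about counts near the
  endpoints, and the threshold z may lie much nearer to an endpoint than x does. Then the counts at
  half the distance of x bound the rank process directly. Probability enters only through three
  exceptional sets of small measure; off them everything is an estimate for one outcome. The Hermite
  covariance is derived from moments, not from a joint density, so perfectly correlated pairs are
  included. Covariances are known to be positive only at large lags; the short lags contribute O(n)
  to the variance, which is negligible because D r < 1.\<close>

fun hermite_poly :: "nat \<Rightarrow> real poly" where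
  "hermite_poly 0 = 1"
| "hermite_poly (Suc q) = [:0, 1:] * hermite_poly q - pderiv (hermite_poly q)"

text \<open>After differentiating the recurrence, the induction hypothesis leaves (q+1)(X H_q -
  H_q'), which is (q+1) H_{q+1} by the recurrence once more.\<close>

lemma pderiv_hermite_poly:
  "pderiv (hermite_poly (Suc q)) = smult (of_nat (Suc q)) (hermite_poly q)"
proof (induction q)
  case 0
  show ?case by (simp add: pderiv_pCons pderiv_1)
next
  case (Suc q)
  let ?X = "[:0, 1:] :: real poly"
  have "pderiv (hermite_poly (Suc (Suc q)))
      = hermite_poly (Suc q) + ?X * pderiv (hermite_poly (Suc q)) - pderiv (pderiv (hermite_poly (Suc q)))"
    by (simp only: hermite_poly.simps(2)[of "Suc q"] pderiv_diff pderiv_mult)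
       (simp add: pderiv_pCons algebra_simps)
  also have "\<dots> = hermite_poly (Suc q) + smult (of_nat (Suc q)) (hermite_poly (Suc q))"
    unfolding Suc.IH pderiv_smult
    by (subst (2) hermite_poly.simps(2)) (simp only: smult_diff_right mult_smult_right add_diff_eq)
  also have "\<dots> = smult (of_nat (Suc (Suc q))) (hermite_poly (Suc q))"
    by (simp only: of_nat_Suc[of "Suc q"] smult_add_left) simp
  finally show ?case .
qed

text \<open>The product rule applied to (-1)^q H_q(y) exp(-y^2/2) reproduces the recurrence, with
  the change of sign absorbed by (-1)^(q+1).\<close>

lemma hermite_eq_poly: "hermite q x = poly (hermite_poly q) x"
proof -
  let ?\<phi> = "\<lambda>y::real. exp (- (y ^ 2) / 2)"
  have *: "(deriv ^^ q) ?\<phi> = (\<lambda>y. (-1) ^ q * poly (hermite_poly q) y * ?\<phi> y)"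
  proof (induction q)
    case (Suc q)
    have "((\<lambda>y. (-1) ^ q * poly (hermite_poly q) y * ?\<phi> y) has_field_derivative
        (-1) ^ Suc q * poly (hermite_poly (Suc q)) y * ?\<phi> y) (at y)" for y
      by (rule derivative_eq_intros poly_DERIV refl | simp)+ (simp add: algebra_simps)
    then have "deriv (\<lambda>y. (-1) ^ q * poly (hermite_poly q) y * ?\<phi> y)
        = (\<lambda>y. (-1) ^ Suc q * poly (hermite_poly (Suc q)) y * ?\<phi> y)"
      by (intro ext DERIV_imp_deriv)
    with Suc show ?case by simp
  qed simp
  have "exp (x ^ 2 / 2) * ?\<phi> x = 1"
    by (simp add: exp_minus field_simps flip: exp_add)
  moreover have "(-1::real) ^ q * (-1) ^ q = 1"
    by (simp flip: power_mult_distrib)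
  ultimately show ?thesis
    unfolding hermite_def * by (metis (no_types, lifting) mult.assoc mult.left_commute mult_1_right)
qed

text \<open>Expressed through the second moment, so that a point mass at 0 is covered; s X + Y
  degenerates to one when Y = -s X.\<close>

lemma gaussian_rv_centered_moments:
  assumes "prob_space M" "gaussian_rv M Z" "(\<integral>\<omega>. Z \<omega> \<partial>M) = 0"
  shows "integrable M (\<lambda>\<omega>. Z \<omega> ^ k)"
    and "(\<integral>\<omega>. Z \<omega> ^ (2 * m) \<partial>M) = fact (2 * m) / (2 ^ m * fact m) * (\<integral>\<omega>. Z \<omega> ^ 2 \<partial>M) ^ m"
    and "(\<integral>\<omega>. Z \<omega> ^ (2 * m + 1) \<partial>M) = 0"
proof -
  interpret prob_space M by fact
  from assms(2) obtain \<mu> \<sigma> where Z[measurable]: "Z \<in> borel_measurable M" and "\<sigma> \<ge> 0" and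
    d: "distr M borel Z = (if \<sigma> = 0 then return borel \<mu> else density lborel (normal_density \<mu> \<sigma>))"
    unfolding gaussian_rv_def by auto
  have int: "integrable M (\<lambda>\<omega>. Z \<omega> ^ k) \<longleftrightarrow> integrable (distr M borel Z) (\<lambda>x. x ^ k)" for k
    by (subst integrable_distr_eq) auto
  have eq: "(\<integral>\<omega>. Z \<omega> ^ k \<partial>M) = (\<integral>x. x ^ k \<partial>distr M borel Z)" for k
    by (subst integral_distr) auto
  consider "\<sigma> = 0" | "\<sigma> > 0" using \<open>\<sigma> \<ge> 0\<close> by linarith
  then have "integrable M (\<lambda>\<omega>. Z \<omega> ^ k)
    \<and> (\<integral>\<omega>. Z \<omega> ^ (2 * m) \<partial>M) = fact (2 * m) / (2 ^ m * fact m) * (\<integral>\<omega>. Z \<omega> ^ 2 \<partial>M) ^ m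
    \<and> (\<integral>\<omega>. Z \<omega> ^ (2 * m + 1) \<partial>M) = 0"
  proof cases
    case 1
    have e: "(\<integral>\<omega>. Z \<omega> ^ k \<partial>M) = \<mu> ^ k" for k
      unfolding eq using d 1 by (simp add: integral_return)
    have i: "integrable M (\<lambda>\<omega>. Z \<omega> ^ k)" for k
      unfolding int using d 1
      by (simp add: integrable_iff_bounded nn_integral_return)
    have "\<mu> = 0" using e[of 1] assms(3) by simp
    \<comment> \<open>For m = 0 the even moment is 0^0 = 1 on both sides.\<close>
    then show ?thesis unfolding e using i by (cases m) auto
  next
    case 2
    then have d: "distr M borel Z = density lborel (normal_density \<mu> \<sigma>)" using d by simp
    have e: "(\<integral>\<omega>. Z \<omega> ^ k \<partial>M) = (\<integral>x. normal_density \<mu> \<sigma> x * x ^ k \<partial>lborel)" for k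
      unfolding eq d by (subst integral_density) (auto simp: normal_density_nonneg)
    have "\<mu> = 0"
      using e[of 1] assms(3) integral_normal_moment_nz_1[OF 2, of \<mu>] by simp
    have i: "integrable M (\<lambda>\<omega>. Z \<omega> ^ k)" for k
      unfolding int d using integrable_normal_moment[OF 2, of \<mu> k] \<open>\<mu> = 0\<close>
      by (subst integrable_density) (auto simp: normal_density_nonneg)
    have v: "(\<integral>\<omega>. Z \<omega> ^ 2 \<partial>M) = \<sigma>\<^sup>2"
      using e[of 2] integral_normal_moment_even[OF 2, of \<mu> 1] \<open>\<mu> = 0\<close> by simp
    show ?thesis
      using i e[of "2*m"] e[of "2*m+1"] integral_normal_moment_even[OF 2, of \<mu> m]
        integral_normal_moment_odd[OF 2, of \<mu> m] \<open>\<mu> = 0\<close> v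
      by (simp add: field_simps)
  qed
  then show "integrable M (\<lambda>\<omega>. Z \<omega> ^ k)"
    "(\<integral>\<omega>. Z \<omega> ^ (2 * m) \<partial>M) = fact (2 * m) / (2 ^ m * fact m) * (\<integral>\<omega>. Z \<omega> ^ 2 \<partial>M) ^ m"
    "(\<integral>\<omega>. Z \<omega> ^ (2 * m + 1) \<partial>M) = 0"
    by auto
qed


text \<open>The combinations s X + Y suffice: E (s X + Y)^n is a polynomial in s whose coefficients
  are binomial multiples of all mixed moments of total degree n. The values rho = 1 and rho = -1 are
  allowed; the pair (\<xi> i, \<xi> i) has rho = 1.\<close>

locale standard_gaussian_pair = prob_space +
  fixes X Y :: "'a \<Rightarrow> real" and \<rho> :: real
  assumes gaussian_X: "gaussian_rv M X" and gaussian_Y: "gaussian_rv M Y"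
    and gaussian_comb: "\<And>s. gaussian_rv M (\<lambda>\<omega>. s * X \<omega> + Y \<omega>)"
    and mean_X: "expectation X = 0" and mean_Y: "expectation Y = 0"
    and second_X: "expectation (\<lambda>\<omega>. X \<omega> ^ 2) = 1" and second_Y: "expectation (\<lambda>\<omega>. Y \<omega> ^ 2) = 1"
    and cov_XY: "expectation (\<lambda>\<omega>. X \<omega> * Y \<omega>) = \<rho>"
begin

lemma measurable_XY [measurable]: "X \<in> borel_measurable M" "Y \<in> borel_measurable M"
  using gaussian_X gaussian_Y by (auto simp: gaussian_rv_def)

section \<open>Mixed moments of a Gaussian pair\<close>

lemma integrable_mixed_moment [intro, simp]: "integrable M (\<lambda>\<omega>. X \<omega> ^ i * Y \<omega> ^ j)"
proof (rule Bochner_Integration.integrable_bound)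
  show "integrable M (\<lambda>\<omega>. X \<omega> ^ (2 * i) + Y \<omega> ^ (2 * j))"
    using gaussian_rv_centered_moments(1)[OF prob_space_axioms gaussian_X mean_X]
      gaussian_rv_centered_moments(1)[OF prob_space_axioms gaussian_Y mean_Y] by simp
  have "\<bar>a * b\<bar> \<le> a ^ 2 + b ^ 2" for a b :: real
  proof -
    have "2 * (\<bar>a\<bar> * \<bar>b\<bar>) \<le> a ^ 2 + b ^ 2"
      using zero_le_power2[of "\<bar>a\<bar> - \<bar>b\<bar>"] by (simp add: power2_diff)
    moreover have "0 \<le> \<bar>a\<bar> * \<bar>b\<bar>" by simp
    ultimately show ?thesis unfolding abs_mult by linarith
  qed
  from this[of "X _ ^ i" "Y _ ^ j"]
  show "AE \<omega> in M. norm (X \<omega> ^ i * Y \<omega> ^ j) \<le> norm (X \<omega> ^ (2 * i) + Y \<omega> ^ (2 * j))"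
    by (intro AE_I2) (smt (verit) power_even_eq real_norm_def)
qed auto

abbreviation mixed_moment :: "nat \<Rightarrow> nat \<Rightarrow> real" where
  "mixed_moment i j \<equiv> expectation (\<lambda>\<omega>. X \<omega> ^ i * Y \<omega> ^ j)"

text \<open>The function s |-> E (s X + Y)^n as a formal polynomial, so that it can be
  differentiated and compared coefficient by coefficient.\<close>

definition comb_moment_poly :: "nat \<Rightarrow> real poly" where
  "comb_moment_poly n = (\<Sum>i\<le>n. monom (of_nat (n choose i) * mixed_moment i (n - i)) i)"

lemma coeff_comb_moment_poly:
  "coeff (comb_moment_poly n) i = of_nat (n choose i) * mixed_moment i (n - i)"
  by (cases "i \<le> n") (auto simp: comb_moment_poly_def coeff_sum if_distrib sum.delta cong: if_cong)

lemma poly_comb_moment_poly: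
  "poly (comb_moment_poly n) s = expectation (\<lambda>\<omega>. (s * X \<omega> + Y \<omega>) ^ n)"
proof -
  have "expectation (\<lambda>\<omega>. (s * X \<omega> + Y \<omega>) ^ n)
      = expectation (\<lambda>\<omega>. \<Sum>i\<le>n. (of_nat (n choose i) * s ^ i) * (X \<omega> ^ i * Y \<omega> ^ (n - i)))"
    by (intro Bochner_Integration.integral_cong refl) (simp add: binomial_ring power_mult_distrib mult_ac)
  also have "\<dots> = (\<Sum>i\<le>n. (of_nat (n choose i) * s ^ i) * mixed_moment i (n - i))"
    by (subst Bochner_Integration.integral_sum) auto
  also have "\<dots> = poly (comb_moment_poly n) s"
    by (simp add: comb_moment_poly_def poly_sum poly_monom ac_simps)
  finally show ?thesis by simp
qed

text \<open>The quadratic s^2 + 2 rho s + 1 is the variance of s X + Y, so the even Gaussian moment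
  formula gives the value at each real s, and polynomials that agree at every real s are
  equal.\<close>

lemma comb_moment_poly_even:
  "comb_moment_poly (2 * m) = smult (fact (2 * m) / (2 ^ m * fact m)) ([:1, 2 * \<rho>, 1:] ^ m)"
proof -
  have int: "integrable M X" "integrable M Y" "integrable M (\<lambda>\<omega>. X \<omega> * Y \<omega>)"
    "integrable M (\<lambda>\<omega>. X \<omega> ^ 2)" "integrable M (\<lambda>\<omega>. Y \<omega> ^ 2)"
    using integrable_mixed_moment[of 1 0] integrable_mixed_moment[of 0 1]
      integrable_mixed_moment[of 1 1] integrable_mixed_moment[of 2 0] integrable_mixed_moment[of 0 2]
    by simp_all
  have "poly (comb_moment_poly (2 * m)) s
      = poly (smult (fact (2 * m) / (2 ^ m * fact m)) ([:1, 2 * \<rho>, 1:] ^ m)) s" for s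
  proof -
    have mean: "expectation (\<lambda>\<omega>. s * X \<omega> + Y \<omega>) = 0"
      using int mean_X mean_Y by simp
    have "expectation (\<lambda>\<omega>. (s * X \<omega> + Y \<omega>) ^ 2)
        = expectation (\<lambda>\<omega>. s\<^sup>2 * X \<omega> ^ 2 + 2 * s * (X \<omega> * Y \<omega>) + Y \<omega> ^ 2)"
      by (intro Bochner_Integration.integral_cong refl) (simp add: power2_eq_square algebra_simps)
    also have "\<dots> = s\<^sup>2 + 2 * s * \<rho> + 1"
      using int second_X second_Y cov_XY by simp
    finally show ?thesis
      unfolding poly_comb_moment_poly gaussian_rv_centered_moments(2)[OF prob_space_axioms gaussian_comb mean]
      by (simp add: poly_power power2_eq_square algebra_simps)
  qed
  then show ?thesis by (simp add: poly_eq_poly_eq_iff[symmetric] fun_eq_iff)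
qed

lemma comb_moment_poly_odd: "comb_moment_poly (2 * m + 1) = 0"
proof -
  have int: "integrable M X" "integrable M Y"
    using integrable_mixed_moment[of 1 0] integrable_mixed_moment[of 0 1] by simp_all
  have "poly (comb_moment_poly (2 * m + 1)) s = 0" for s
  proof -
    have mean: "expectation (\<lambda>\<omega>. s * X \<omega> + Y \<omega>) = 0"
      using int mean_X mean_Y by simp
    show ?thesis
      unfolding poly_comb_moment_poly
      by (rule gaussian_rv_centered_moments(3)[OF prob_space_axioms gaussian_comb mean])
  qed
  then show ?thesis by (simp add: poly_eq_poly_eq_iff[symmetric] fun_eq_iff)
qed

text \<open>With Q = s^2 + 2 rho s + 1 one has Q' = 2 (s + rho), so differentiating a multiple of
  Q^(m+1) returns (s + rho) Q^m, and the factorials combine to (2m+2)(2m+1). For odd n both sides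
  vanish. This encodes the Stein identity for all mixed moments of one total degree at once.\<close>

lemma pderiv_comb_moment_poly:
  "pderiv (comb_moment_poly (n + 2)) = smult (of_nat ((n + 2) * (n + 1))) ([:\<rho>, 1:] * comb_moment_poly n)"
proof (cases "even n")
  case True
  then obtain m where n: "n = 2 * m" by blast
  let ?Q = "[:1, 2 * \<rho>, 1:] :: real poly"
  have Q': "pderiv ?Q = smult 2 [:\<rho>, 1:]"
    by (simp add: pderiv_pCons)
  have "pderiv (comb_moment_poly (2 * Suc m))
      = smult (fact (2 * Suc m) / (2 ^ Suc m * fact (Suc m)) * of_nat (Suc m) * 2) ([:\<rho>, 1:] * ?Q ^ m)"
  proof -
    have "smult c (smult a p * smult b q) = smult (c * a * b) (q * p)" for a b c :: real and p q
      by (simp add: mult_ac)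
    then show ?thesis
      unfolding comb_moment_poly_even pderiv_smult pderiv_power_Suc Q' .
  qed
  also have "fact (2 * Suc m) / (2 ^ Suc m * fact (Suc m)) * of_nat (Suc m) * 2
      = of_nat ((2 * m + 2) * (2 * m + 1)) * (fact (2 * m) / (2 ^ m * fact m) :: real)"
  proof -
    have f: "fact (2 * Suc m) = of_nat ((2 * m + 2) * (2 * m + 1)) * (fact (2 * m) :: real)"
      "2 ^ Suc m * fact (Suc m) = of_nat (Suc m) * 2 * (2 ^ m * fact m :: real)"
      by (simp_all add: algebra_simps)
    have cancel: "a * f / (s * 2 * p) * s * 2 = a * (f / p)" if "s \<noteq> 0" for a f s p :: real
      using that by (cases "p = 0") (simp_all add: field_simps)
    show ?thesis unfolding f by (rule cancel) simp
  qed
  finally show ?thesis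
    unfolding n using comb_moment_poly_even[of m] by simp
next
  case False
  then obtain m where n: "n = 2 * m + 1" by (elim oddE)
  have "n + 2 = 2 * Suc m + 1" using n by simp
  then show ?thesis unfolding n using comb_moment_poly_odd[of m] comb_moment_poly_odd[of "Suc m"] by simp
qed

text \<open>Coefficients of s^i are compared in the differential identity with n = i + j - 1;
  Pascal-type absorption identities remove the binomials. Where \<open>i - 1\<close> or
  \<open>j - 1\<close> truncates at 0, the factor i or j in front is 0.\<close>

lemma mixed_moment_Stein:
  "mixed_moment (Suc i) j = of_nat i * mixed_moment (i - 1) j + \<rho> * of_nat j * mixed_moment i (j - 1)"
proof (cases "i + j")
  case 0
  then show ?thesis using mean_X by simp
next
  case (Suc n)
  let ?N = "Suc n"
  have j: "j = ?N - i" "i \<le> ?N" using Suc by auto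
  have "coeff (pderiv (comb_moment_poly (n + 2))) i
      = of_nat (Suc i) * (of_nat (Suc ?N choose Suc i)) * mixed_moment (Suc i) j"
    unfolding coeff_pderiv coeff_comb_moment_poly using j by simp
  also have "of_nat (Suc i) * (of_nat (Suc ?N choose Suc i)) = of_nat (n + 2) * (of_nat (?N choose i) :: real)"
    by (metis Suc_times_binomial add_2_eq_Suc' of_nat_mult)
  finally have L: "coeff (pderiv (comb_moment_poly (n + 2))) i
      = of_nat (n + 2) * (of_nat (?N choose i) * mixed_moment (Suc i) j)" by simp
  have "coeff ([:\<rho>, 1:] * comb_moment_poly n) i
      = \<rho> * (of_nat (n choose i) * mixed_moment i (n - i))
        + (if i = 0 then 0 else of_nat (n choose (i - 1)) * mixed_moment (i - 1) (n - (i - 1)))"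
    by (cases i) (simp_all add: coeff_comb_moment_poly)
  then have R: "coeff (smult (of_nat ((n + 2) * (n + 1))) ([:\<rho>, 1:] * comb_moment_poly n)) i
      = of_nat (n + 2) * (\<rho> * (of_nat (?N * (n choose i)) * mixed_moment i (n - i))
        + (if i = 0 then 0 else of_nat (?N * (n choose (i - 1))) * mixed_moment (i - 1) (n - (i - 1))))"
    unfolding coeff_smult by (simp add: algebra_simps)
  have b1: "?N * (n choose i) = j * (?N choose i)"
    using binomial_absorb_comp[of ?N i] j by simp
  have b2: "?N * (n choose (i - 1)) = i * (?N choose i)" if "i \<noteq> 0"
    using that by (cases i) (simp_all only: Suc_times_binomial diff_Suc_1)
  have m1: "\<rho> * (of_nat (j * (?N choose i)) * mixed_moment i (n - i))
      = of_nat (?N choose i) * (\<rho> * of_nat j * mixed_moment i (j - 1))"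
    using j by (simp add: Suc_diff_le)
  have m2: "(if i = 0 then 0 else of_nat (?N * (n choose (i - 1))) * mixed_moment (i - 1) (n - (i - 1)))
      = of_nat (?N choose i) * (of_nat i * mixed_moment (i - 1) j)"
  proof (cases "i = 0")
    case False
    then have "n - (i - 1) = j" using j by simp
    then show ?thesis unfolding b2[OF False] using False by simp
  qed simp
  have "of_nat (n + 2) * (of_nat (?N choose i) * mixed_moment (Suc i) j)
      = of_nat (n + 2) * (of_nat (?N choose i) * (\<rho> * of_nat j * mixed_moment i (j - 1))
          + of_nat (?N choose i) * (of_nat i * mixed_moment (i - 1) j))"
    using L[symmetric, unfolded pderiv_comb_moment_poly, THEN trans, OF R[unfolded b1 m1 m2]] .
  have "of_nat (?N choose i) * mixed_moment (Suc i) j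
      = of_nat (?N choose i) * (of_nat i * mixed_moment (i - 1) j + \<rho> * of_nat j * mixed_moment i (j - 1))"
  proof -
    have cancel: "c * u = c * (v + w)" if "k * (c * u) = k * (c * w + c * v)" "k \<noteq> 0" for c k u v w :: real
      using that by (metis add.commute distrib_left mult_cancel_left)
    show ?thesis by (rule cancel, fact) simp
  qed
  moreover have "(?N choose i) > 0" using j by simp
  ultimately show ?thesis by simp
qed


section \<open>Stein's identity for polynomials and Hermite covariances\<close>

lemma integrable_poly_mult [simp, intro]: "integrable M (\<lambda>\<omega>. poly p (X \<omega>) * poly q (Y \<omega>))"
proof -
  have *: "poly p (X \<omega>) * poly q (Y \<omega>)
      = (\<Sum>i\<le>degree p. \<Sum>j\<le>degree q. coeff p i * coeff q j * (X \<omega> ^ i * Y \<omega> ^ j))" for \<omega>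
    by (simp add: poly_altdef sum_product mult_ac)
  show ?thesis unfolding * by auto
qed

lemma Stein_monom:
  "expectation (\<lambda>\<omega>. X \<omega> * poly (monom a i) (X \<omega>) * poly (monom b j) (Y \<omega>))
    = expectation (\<lambda>\<omega>. poly (pderiv (monom a i)) (X \<omega>) * poly (monom b j) (Y \<omega>))
      + \<rho> * expectation (\<lambda>\<omega>. poly (monom a i) (X \<omega>) * poly (pderiv (monom b j)) (Y \<omega>))"
proof -
  have "expectation (\<lambda>\<omega>. X \<omega> * poly (monom a i) (X \<omega>) * poly (monom b j) (Y \<omega>))
      = expectation (\<lambda>\<omega>. a * b * (X \<omega> ^ Suc i * Y \<omega> ^ j))"
    by (intro Bochner_Integration.integral_cong refl) (simp add: poly_monom mult_ac)
  also have "\<dots> = a * b * mixed_moment (Suc i) j" by (rule integral_mult_right_zero)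
  also have "\<dots> = (of_nat i * a) * b * mixed_moment (i - 1) j + \<rho> * (a * (of_nat j * b) * mixed_moment i (j - 1))"
    unfolding mixed_moment_Stein by (simp add: algebra_simps)
  also have "(of_nat i * a) * b * mixed_moment (i - 1) j
      = expectation (\<lambda>\<omega>. (of_nat i * a) * b * (X \<omega> ^ (i - 1) * Y \<omega> ^ j))"
    by (rule integral_mult_right_zero[symmetric])
  also have "a * (of_nat j * b) * mixed_moment i (j - 1)
      = expectation (\<lambda>\<omega>. a * (of_nat j * b) * (X \<omega> ^ i * Y \<omega> ^ (j - 1)))"
    by (rule integral_mult_right_zero[symmetric])
  finally show ?thesis by (simp add: pderiv_monom poly_monom mult_ac)
qed

text \<open>Both sides are additive in p and in q, so the identity for monomials extends to sums of
  monomials.\<close>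

lemma Stein_poly:
  "expectation (\<lambda>\<omega>. X \<omega> * poly p (X \<omega>) * poly q (Y \<omega>))
    = expectation (\<lambda>\<omega>. poly (pderiv p) (X \<omega>) * poly q (Y \<omega>))
      + \<rho> * expectation (\<lambda>\<omega>. poly p (X \<omega>) * poly (pderiv q) (Y \<omega>))"
proof -
  have X: "X \<omega> * poly p (X \<omega>) = poly ([:0, 1:] * p) (X \<omega>)" for \<omega> p by simp
  have int: "integrable M (\<lambda>\<omega>. X \<omega> * poly p (X \<omega>) * poly q (Y \<omega>))" for p q
    using integrable_poly_mult[of "[:0, 1:] * p" q] by simp
  define P where "P p q \<longleftrightarrow> expectation (\<lambda>\<omega>. poly ([:0, 1:] * p) (X \<omega>) * poly q (Y \<omega>))
    = expectation (\<lambda>\<omega>. poly (pderiv p) (X \<omega>) * poly q (Y \<omega>))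
      + \<rho> * expectation (\<lambda>\<omega>. poly p (X \<omega>) * poly (pderiv q) (Y \<omega>))" for p q
  have P0: "P 0 q" "P p 0" for p q by (simp_all add: P_def)
  have Pl: "P (p1 + p2) q" if "P p1 q" "P p2 q" for p1 p2 q
    using that unfolding P_def pderiv_add distrib_left poly_add distrib_right
    by (simp add: distrib_left int)
  have Pr: "P p (q1 + q2)" if "P p q1" "P p q2" for p q1 q2
    using that unfolding P_def pderiv_add poly_add distrib_left
    by (simp add: distrib_left int)
  have Pm: "P (monom a i) (monom b j)" for a b i j
    using Stein_monom[of a i b j] unfolding P_def X .
  have Ps: "P (monom a i) (\<Sum>j\<in>A. monom (c j) j)" if "finite A" for a i A c
    using that by (induction A) (auto simp: P0 Pm Pr)
  have "P (\<Sum>i\<in>B. monom (b i) i) (\<Sum>j\<in>A. monom (c j) j)" if "finite B" "finite A" for B b A c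
    using that by (induction B) (auto simp: P0 Ps Pl)
  from this[of "{..degree p}" "{..degree q}" "coeff p" "coeff q"] have "P p q"
    by (simp add: poly_as_sum_of_monoms)
  then show ?thesis unfolding P_def X .
qed

text \<open>The term -H_n' in the recurrence cancels the term E p' q of Stein's identity, leaving
  only the one with rho.\<close>

lemma expectation_hermite_poly_Suc:
  "expectation (\<lambda>\<omega>. poly (hermite_poly (Suc n)) (X \<omega>) * poly q (Y \<omega>))
    = \<rho> * expectation (\<lambda>\<omega>. poly (hermite_poly n) (X \<omega>) * poly (pderiv q) (Y \<omega>))"
proof -
  have int: "integrable M (\<lambda>\<omega>. X \<omega> * poly p (X \<omega>) * poly q (Y \<omega>))" for p q
    using integrable_poly_mult[of "[:0, 1:] * p" q] by simp
  have "expectation (\<lambda>\<omega>. poly (hermite_poly (Suc n)) (X \<omega>) * poly q (Y \<omega>))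
      = expectation (\<lambda>\<omega>. X \<omega> * poly (hermite_poly n) (X \<omega>) * poly q (Y \<omega>)
          - poly (pderiv (hermite_poly n)) (X \<omega>) * poly q (Y \<omega>))"
    by (intro Bochner_Integration.integral_cong refl) (simp add: algebra_simps)
  also have "\<dots> = \<rho> * expectation (\<lambda>\<omega>. poly (hermite_poly n) (X \<omega>) * poly (pderiv q) (Y \<omega>))"
    by (subst Bochner_Integration.integral_diff) (auto simp: int Stein_poly)
  finally show ?thesis .
qed

text \<open>Each step lowers the degree in X by one and differentiates the factor in Y; since
  H_{n+1}' = (n+1) H_n, the same form returns with the factor (n+1) rho.\<close>

lemma expectation_hermite_hermite:
  "expectation (\<lambda>\<omega>. hermite r (X \<omega>) * hermite r (Y \<omega>)) = fact r * \<rho> ^ r"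
  unfolding hermite_eq_poly
proof (induction r)
  case 0
  show ?case by (simp add: prob_space)
next
  case (Suc n)
  have "expectation (\<lambda>\<omega>. poly (hermite_poly (Suc n)) (X \<omega>) * poly (hermite_poly (Suc n)) (Y \<omega>))
    = \<rho> * expectation (\<lambda>\<omega>. of_nat (Suc n) * (poly (hermite_poly n) (X \<omega>) * poly (hermite_poly n) (Y \<omega>)))"
    unfolding expectation_hermite_poly_Suc pderiv_hermite_poly by (simp add: mult_ac)
  also have "\<dots> = \<rho> * (of_nat (Suc n) * (fact n * \<rho> ^ n))"
    by (simp only: integral_mult_right_zero Suc.IH)
  finally show ?case by (simp add: mult_ac)
qed

text \<open>The second factor is taken to be the constant 1, whose derivative is 0.\<close>

lemma expectation_hermite: "r \<ge> 1 \<Longrightarrow> expectation (\<lambda>\<omega>. hermite r (X \<omega>)) = 0"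
  using expectation_hermite_poly_Suc[of "r - 1" 1] by (simp add: hermite_eq_poly pderiv_1)

lemma integrable_hermite_hermite: "integrable M (\<lambda>\<omega>. hermite r (X \<omega>) * hermite r (Y \<omega>))"
  unfolding hermite_eq_poly by simp

end

section \<open>Slowly varying functions\<close>

text \<open>Dominated convergence of indicators: on a bounded interval, pointwise convergence
  implies convergence in measure.\<close>

lemma measure_abs_ge_tendsto_0:
  fixes f :: "nat \<Rightarrow> real \<Rightarrow> real"
  assumes [measurable]: "\<And>n. f n \<in> borel_measurable borel"
    and lim: "\<And>v. (\<lambda>n. f n v) \<longlonglongrightarrow> 0"
  shows "(\<lambda>n. measure lebesgue {v \<in> {a..b}. 1 \<le> \<bar>f n v\<bar>}) \<longlonglongrightarrow> 0"
proof -
  let ?A = "\<lambda>n. {v \<in> {a..b}. 1 \<le> \<bar>f n v\<bar>}"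
  have [measurable]: "?A n \<in> sets borel" for n by measurable
  have "(\<lambda>n. \<integral>v. indicator (?A n) v \<partial>lborel) \<longlonglongrightarrow> (\<integral>v. (0::real) \<partial>(lborel :: real measure))"
  proof (rule integral_dominated_convergence[of "\<lambda>_. 0::real" lborel "\<lambda>n. indicator (?A n)" "indicator {a..b}"])
    show "AE v in lborel. (\<lambda>n. indicator (?A n) v :: real) \<longlonglongrightarrow> 0"
    proof (intro AE_I2)
      fix v
      have "eventually (\<lambda>n. \<bar>f n v\<bar> < 1) sequentially"
        using tendstoD[OF lim[of v], of 1] by (simp add: dist_real_def)
      then have "eventually (\<lambda>n. (indicator (?A n) v :: real) = 0) sequentially"
        by eventually_elim (auto simp: indicator_def)
      then show "(\<lambda>n. indicator (?A n) v :: real) \<longlonglongrightarrow> 0" by (rule tendsto_eventually)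
    qed
    show "integrable lborel (indicator {a..b} :: real \<Rightarrow> real)"
      using emeasure_lborel_cbox_finite[of a b] by (intro integrable_real_indicator) auto
  qed (auto simp: indicator_def)
  then show ?thesis by simp
qed

lemma lmeasurable_abs_increment_ge:
  fixes h :: "real \<Rightarrow> real"
  assumes [measurable]: "h \<in> borel_measurable borel"
  shows "{v \<in> {a..b}. 1 \<le> \<bar>h (c + v) - d\<bar>} \<in> lmeasurable"
proof (rule fmeasurableI2)
  show "{a..b} \<in> lmeasurable" using lmeasurable_cbox[of a b] by simp
  have "{v \<in> {a..b}. 1 \<le> \<bar>h (c + v) - d\<bar>} \<in> sets borel" by measurable
  then show "{v \<in> {a..b}. 1 \<le> \<bar>h (c + v) - d\<bar>} \<in> sets lebesgue"
    by (intro sets_completionI_sets) simp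
qed blast

text \<open>The measure-theoretic core of the uniform convergence theorem for slowly varying functions.\<close>

lemma slow_increments_locally_bounded:
  fixes h :: "real \<Rightarrow> real"
  assumes h[measurable]: "h \<in> borel_measurable borel"
    and lim: "\<And>u. ((\<lambda>t. h (t + u) - h t) \<longlongrightarrow> 0) at_top"
  shows "\<exists>t0. \<forall>t\<ge>t0. \<forall>u\<in>{0..1}. \<bar>h (t + u) - h t\<bar> < 2"
proof (rule ccontr)
  assume "\<not> ?thesis"
  then have "\<forall>n. \<exists>t u. t \<ge> real n \<and> u \<in> {0..1} \<and> 2 \<le> \<bar>h (t + u) - h t\<bar>"
    by (meson not_le)
  then obtain t u where tu: "\<And>n. t n \<ge> real n" "\<And>n. u n \<in> {0..1}" "\<And>n. 2 \<le> \<bar>h (t n + u n) - h (t n)\<bar>"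
    by metis
  have t: "filterlim t at_top sequentially"
    by (rule filterlim_at_top_mono[OF filterlim_real_sequentially]) (use tu(1) in auto)
  have tu': "filterlim (\<lambda>n. t n + u n) at_top sequentially"
    by (rule filterlim_at_top_mono[OF t]) (use tu(2) in auto)
  let ?A = "\<lambda>n. {v \<in> {0..3}. 1 \<le> \<bar>h (t n + v) - h (t n)\<bar>}"
  let ?B = "\<lambda>n. {v \<in> {0..3}. 1 \<le> \<bar>h (t n + u n + v) - h (t n + u n)\<bar>}"
  have "(\<lambda>n. measure lebesgue (?A n)) \<longlonglongrightarrow> 0" "(\<lambda>n. measure lebesgue (?B n)) \<longlonglongrightarrow> 0"
    using measure_abs_ge_tendsto_0[of "\<lambda>n v. h (t n + v) - h (t n)" 0 3]
      measure_abs_ge_tendsto_0[of "\<lambda>n v. h (t n + u n + v) - h (t n + u n)" 0 3]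
      filterlim_compose[OF lim t] filterlim_compose[OF lim tu'] by simp_all
  then have "eventually (\<lambda>n. measure lebesgue (?A n) < 1 \<and> measure lebesgue (?B n) < 1) sequentially"
    by (intro eventually_conj order_tendstoD(2)) auto
  from eventually_happens'[OF sequentially_bot this]
  obtain n where n: "measure lebesgue (?A n) < 1" "measure lebesgue (?B n) < 1"
    by (elim exE conjE)
  have A: "?A n \<in> lmeasurable" and B: "?B n \<in> lmeasurable"
    by (rule lmeasurable_abs_increment_ge[OF h])+
  have B': "(+) (u n) ` ?B n \<in> lmeasurable" using B by (rule measurable_translation)
  \<comment> \<open>If h(t+v) is within 1 of both h(t) and h(t+u), then h(t+u) - h(t) is below 2 in
    absolute value. Hence every v in [1,3] lies in one of two sets of measure below 1 each, although
    [1,3] has length 2. The base interval [0,3] is long enough to contain v - u for u in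
    [0,1].\<close>
  have "{1..3} \<subseteq> ?A n \<union> (+) (u n) ` ?B n"
  proof
    fix v :: real assume v: "v \<in> {1..3}"
    show "v \<in> ?A n \<union> (+) (u n) ` ?B n"
    proof (cases "1 \<le> \<bar>h (t n + v) - h (t n)\<bar>")
      case False
      then have "1 \<le> \<bar>h (t n + v) - h (t n + u n)\<bar>" using tu(3)[of n] by linarith
      then have "v - u n \<in> ?B n" using v tu(2)[of n] by (auto simp: algebra_simps)
      then show ?thesis by (intro UnI2 image_eqI[of _ _ "v - u n"]) auto
    qed (use v in auto)
  qed
  then have "measure lebesgue {1..3::real} \<le> measure lebesgue (?A n \<union> (+) (u n) ` ?B n)"
    using A B' by (intro measure_mono_fmeasurable fmeasurable.Un) auto
  also have "\<dots> \<le> measure lebesgue (?A n) + measure lebesgue ((+) (u n) ` ?B n)"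
    using A B' by (intro measure_Un_le) auto
  also have "\<dots> < 2" using n by (simp add: measure_translation)
  finally show False by simp
qed

text \<open>In the logarithmic scale h = ln L(exp t), ratios of L become increments of h, and x <= y
  <= 2x becomes a step of length at most ln 2 <= 1. The increment bound 2 turns into the constant
  exp 2.\<close>

lemma slowly_varying_locally_comparable:
  assumes "slowly_varying L"
  obtains C x0 where "C \<ge> 1" "x0 > 0" "\<And>x. x \<ge> x0 \<Longrightarrow> L x > 0"
    "\<And>x y. x \<ge> x0 \<Longrightarrow> x \<le> y \<Longrightarrow> y \<le> 2 * x \<Longrightarrow> L y \<le> C * L x \<and> L x \<le> C * L y"
proof -
  have L[measurable]: "L \<in> borel_measurable borel" and "eventually (\<lambda>x. L x > 0) at_top"
    and lim: "\<And>a. a > 0 \<Longrightarrow> ((\<lambda>x. L (a * x) / L x) \<longlongrightarrow> 1) at_top"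
    using assms by (auto simp: slowly_varying_def)
  then obtain x1 where x1: "\<And>x. x \<ge> x1 \<Longrightarrow> L x > 0" by (auto simp: eventually_at_top_linorder)
  define h where "h = (\<lambda>t. ln (L (exp t)))"
  have "((\<lambda>t. h (t + u) - h t) \<longlongrightarrow> 0) at_top" for u
  proof -
    have "((\<lambda>t. ln (L (exp u * exp t) / L (exp t))) \<longlongrightarrow> ln 1) at_top"
      by (intro tendsto_ln filterlim_compose[OF lim exp_at_top]) auto
    moreover have "eventually (\<lambda>t. L (exp t) > 0 \<and> L (exp (t + u)) > 0) at_top"
    proof -
      have "eventually (\<lambda>t. t \<ge> ln (max x1 1)) at_top" "eventually (\<lambda>t. t \<ge> ln (max x1 1) - u) at_top"
        by (rule eventually_ge_at_top)+
      then have ev: "eventually (\<lambda>t. t \<ge> ln (max x1 1) \<and> t \<ge> ln (max x1 1) - u) at_top"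
        by (rule eventually_conj)
      have pos: "L (exp t) > 0" if "t \<ge> ln (max x1 1)" for t
      proof (rule x1)
        have "max x1 1 = exp (ln (max x1 1))" by (simp add: less_max_iff_disj)
        also have "\<dots> \<le> exp t" using that by (simp only: exp_le_cancel_iff)
        finally show "x1 \<le> exp t" by (simp only: max.bounded_iff)
      qed
      from ev show ?thesis by eventually_elim (auto intro!: pos)
    qed
    then have "eventually (\<lambda>t. ln (L (exp u * exp t) / L (exp t)) = h (t + u) - h t) at_top"
      by eventually_elim (simp add: h_def ln_div exp_add mult.commute)
    ultimately show ?thesis by (simp add: tendsto_cong)
  qed
  then obtain t0 where t0: "\<And>t u. t \<ge> t0 \<Longrightarrow> u \<in> {0..1} \<Longrightarrow> \<bar>h (t + u) - h t\<bar> < 2"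
    using slow_increments_locally_bounded[of h] unfolding h_def by fastforce
  show ?thesis
  proof (rule that[of "exp 2" "max (exp t0) x1"])
    fix x y assume x: "max (exp t0) x1 \<le> x" and xy: "x \<le> y" "y \<le> 2 * x"
    have pos: "x > 0" "y > 0" "L x > 0" "L y > 0"
      using x xy x1[of x] x1[of y] exp_gt_zero[of t0] by (auto simp del: exp_gt_zero)
    have "ln (y / x) \<le> ln 2" using xy pos by (subst ln_le_cancel_iff) (auto simp: field_simps)
    also have "ln 2 \<le> (1::real)" using ln_2_less_1 by simp
    finally have "ln y - ln x \<in> {0..1}" using xy pos by (simp add: ln_div)
    moreover have "ln x \<ge> t0" using x pos by (simp add: ln_ge_iff)
    ultimately have "\<bar>h (ln x + (ln y - ln x)) - h (ln x)\<bar> < 2" by (intro t0)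
    then have "\<bar>ln (L y) - ln (L x)\<bar> < 2" using pos by (simp add: h_def)
    then have "ln (L y) \<le> ln (exp 2 * L x)" "ln (L x) \<le> ln (exp 2 * L y)"
      using pos by (auto simp: ln_mult)
    then show "L y \<le> exp 2 * L x \<and> L x \<le> exp 2 * L y" using pos by (simp add: ln_le_cancel_iff)
  qed (use x1 in \<open>auto simp: less_max_iff_disj\<close>)
qed

text \<open>The argument k is doubled until j < 2k, each doubling costing 2^s, which matches the
  change of (j/k)^s. The last stretch uses the local comparison, and 2^|s| compensates for (j/k)^s
  with j/k in [1,2]. It is used for a covariance and for its reciprocal, giving bounds in both
  directions.\<close>

lemma Potter_bound:
  fixes f :: "nat \<Rightarrow> real"
  assumes pos: "\<And>k. k \<ge> K \<Longrightarrow> f k > 0" and K: "K \<ge> 1"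
    and local: "\<And>k j. k \<ge> K \<Longrightarrow> k \<le> j \<Longrightarrow> j \<le> 2 * k \<Longrightarrow> f k \<le> C * f j"
    and double: "\<And>k. k \<ge> K \<Longrightarrow> f k \<le> 2 powr s * f (2 * k)"
    and "K \<le> k" "k \<le> j"
  shows "f k \<le> C * 2 powr \<bar>s\<bar> * (real j / real k) powr s * f j"
  using assms(5,6)
proof (induction "j - k" arbitrary: k rule: less_induct)
  case less
  have C: "C > 0"
    using local[OF less.prems(1) order_refl] pos[OF less.prems(1)]
    by (metis less.prems(1) less_le_trans linorder_not_le mult_2 le_add1 mult_less_0_iff mult_zero_left order_le_less pos)
  have k: "k > 0" using less.prems K by simp
  show ?case
  proof (cases "j < 2 * k")
    case True
    have q: "1 \<le> real j / real k" "real j / real k \<le> 2" using less.prems True k by (auto simp: field_simps)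
    have "1 \<le> 2 powr \<bar>s\<bar> * (real j / real k) powr s"
    proof (cases "s \<ge> 0")
      case True
      then have "1 * 1 \<le> 2 powr \<bar>s\<bar> * (real j / real k) powr s"
        using q by (intro mult_mono ge_one_powr_ge_zero) auto
      then show ?thesis by simp
    next
      case False
      then have "2 powr s \<le> (real j / real k) powr s" using q by (intro powr_mono2') auto
      then have "2 powr \<bar>s\<bar> * 2 powr s \<le> 2 powr \<bar>s\<bar> * (real j / real k) powr s" by (intro mult_left_mono) auto
      then show ?thesis using False by (simp flip: powr_add)
    qed
    moreover have "f j > 0" using less.prems by (intro pos) auto
    ultimately have "C * f j * 1 \<le> C * f j * (2 powr \<bar>s\<bar> * (real j / real k) powr s)"
      using C by (intro mult_left_mono) auto
    moreover have "f k \<le> C * f j" using True less.prems by (intro local) auto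
    ultimately show ?thesis by (simp add: mult_ac)
  next
    case False
    have "f k \<le> 2 powr s * f (2 * k)" using less.prems by (intro double)
    also have "\<dots> \<le> 2 powr s * (C * 2 powr \<bar>s\<bar> * (real j / real (2 * k)) powr s * f j)"
      using less.prems False k by (intro mult_left_mono less.hyps) auto
    also have "\<dots> = C * 2 powr \<bar>s\<bar> * (2 * (real j / real (2 * k))) powr s * f j"
      by (subst powr_mult) (auto simp: mult_ac)
    also have "2 * (real j / real (2 * k)) = real j / real k" using k by (simp add: field_simps)
    finally show ?thesis .
  qed
qed

section \<open>Growth of double sums over regularly varying covariances\<close>

lemma sum_powr_le:
  assumes "0 < b" "b < 1"
  shows "(\<Sum>k=1..m. real k powr (-b)) \<le> real m powr (1 - b) / (1 - b)"
proof (induction m)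
  case (Suc m)
  have "(1 - b) * real (Suc m) powr (-b) \<le> real (Suc m) powr (1 - b) - real m powr (1 - b)"
  proof (cases "m = 0")
    case True
    then show ?thesis using assms by simp
  next
    case False
    \<comment> \<open>Integral comparison in telescoping form: the mean value z is below m+1 and
      z^(-b) is decreasing in z.\<close>
    have "\<exists>z. real m < z \<and> z < real (Suc m) \<and> real (Suc m) powr (1 - b) - real m powr (1 - b)
       = (real (Suc m) - real m) * ((1 - b) * z powr (1 - b - 1))"
      using False by (intro MVT2) (auto intro!: derivative_eq_intros)
    then obtain z where z: "real m < z" "z < real (Suc m)"
      "real (Suc m) powr (1 - b) - real m powr (1 - b) = (1 - b) * z powr (-b)" by auto
    have "real (Suc m) powr (-b) \<le> z powr (-b)" using z assms False by (intro powr_mono2') auto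
    then show ?thesis unfolding z(3) using assms by (intro mult_left_mono) auto
  qed
  then have "real (Suc m) powr (-b) \<le> (real (Suc m) powr (1 - b) - real m powr (1 - b)) / (1 - b)"
    using assms by (simp add: pos_le_divide_eq mult.commute)
  with Suc show ?case by (simp add: diff_divide_distrib)
qed simp

text \<open>On naturals \<open>(i - j) + (j - i)\<close> is |i - j|; for fixed i every distance is
  attained at most once on each side, which gives the factor 2.\<close>

lemma sum_dist_le:
  fixes f :: "nat \<Rightarrow> real"
  assumes nonneg: "\<And>k. f k \<ge> 0" and i: "i \<in> {1..m}"
  shows "(\<Sum>j=1..m. f ((i - j) + (j - i))) \<le> 2 * (\<Sum>k<m. f k)"
proof -
  have split: "{1..m} = {1..i} \<union> {i<..m}" "{1..i} \<inter> {i<..m} = {}" using i by auto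
  have "(\<Sum>j\<in>{1..i}. f ((i - j) + (j - i))) = (\<Sum>j\<in>{1..i}. f (i - j))" by (intro sum.cong) auto
  also have "\<dots> = sum f ((\<lambda>j. i - j) ` {1..i})"
    by (subst sum.reindex) (auto simp: inj_on_def)
  also have "\<dots> \<le> (\<Sum>k<m. f k)" using i nonneg by (intro sum_mono2) auto
  finally have 1: "(\<Sum>j\<in>{1..i}. f ((i - j) + (j - i))) \<le> (\<Sum>k<m. f k)" .
  have "(\<Sum>j\<in>{i<..m}. f ((i - j) + (j - i))) = (\<Sum>j\<in>{i<..m}. f (j - i))" by (intro sum.cong) auto
  also have "\<dots> = sum f ((\<lambda>j. j - i) ` {i<..m})"
    by (subst sum.reindex) (auto simp: inj_on_def)
  also have "\<dots> \<le> (\<Sum>k<m. f k)" using i nonneg by (intro sum_mono2) auto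
  finally have 2: "(\<Sum>j\<in>{i<..m}. f ((i - j) + (j - i))) \<le> (\<Sum>k<m. f k)" .
  show ?thesis unfolding split(1) using 1 2 split(2) by (subst sum.union_disjoint) auto
qed

text \<open>V(n) is of exact order n^2 rho(n). From above, the sum of |rho(k)| for k < m is O(m
  rho(m)) because the Potter exponent b is below 1. From below, pairs from the first and last thirds
  of the index range have lags comparable to n. Thus V(m)/V(n) is at most a constant times (m/n)^2
  rho(m)/rho(n), and the Potter bound turns this into (m/n)^(2-b). The exponent a > 0 serves only to
  make rho tend to 0, which yields the second claim.\<close>

lemma stationary_double_sum_growth:
  fixes \<rho> :: "nat \<Rightarrow> real" and a b C :: real and V :: "nat \<Rightarrow> real"
  assumes K: "K \<ge> 1" and pos: "\<And>k. k \<ge> K \<Longrightarrow> \<rho> k > 0"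
    and comp: "\<And>k j. k \<ge> K \<Longrightarrow> k \<le> j \<Longrightarrow> j \<le> 2 * k \<Longrightarrow> \<rho> k \<le> C * \<rho> j \<and> \<rho> j \<le> C * \<rho> k"
    and double: "\<And>k. k \<ge> K \<Longrightarrow> \<rho> k \<le> 2 powr b * \<rho> (2 * k)"
    and halve: "\<And>k. k \<ge> K \<Longrightarrow> 2 powr a * \<rho> (2 * k) \<le> \<rho> k"
    and C: "C \<ge> 1" and a: "a > 0" and b: "0 < b" "b < 1"
    and V: "\<And>n. V n = (\<Sum>i=1..n. \<Sum>j=1..n. \<rho> ((i - j) + (j - i)))"
  shows "\<exists>B N. \<forall>n\<ge>N. V n > 0 \<and> (\<forall>m. 1 \<le> m \<longrightarrow> m \<le> n \<longrightarrow> V m \<le> B * (real m / real n) powr (2 - b) * V n)"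
    and "(\<lambda>n. V n / real n ^ 2) \<longlonglongrightarrow> 0"
proof -
  define A where "A = C * 2 powr b"
  have A: "A > 0" using C by (simp add: A_def)
  have potter: "\<rho> k \<le> A * (real j / real k) powr b * \<rho> j" if "K \<le> k" "k \<le> j" for k j
    using Potter_bound[of K \<rho> C b k j] pos K comp double that b by (auto simp: A_def)
  have potter': "\<rho> j \<le> (C * 2 powr a) * (real j / real k) powr (-a) * \<rho> k" if "K \<le> k" "k \<le> j" for k j
  proof -
    have "inverse (\<rho> k) \<le> C * inverse (\<rho> j)" if "k \<ge> K" "k \<le> j" "j \<le> 2 * k" for k j
      using comp[OF that] pos[of k] pos[of j] that by (simp add: field_simps)
    moreover have "inverse (\<rho> k) \<le> 2 powr (-a) * inverse (\<rho> (2 * k))" if "k \<ge> K" for k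
      using halve[OF that] pos[of k] pos[of "2 * k"] that by (simp add: field_simps powr_minus)
    ultimately have "inverse (\<rho> k) \<le> C * 2 powr \<bar>-a\<bar> * (real j / real k) powr (-a) * inverse (\<rho> j)"
      using that K pos by (intro Potter_bound[of K]) auto
    then show ?thesis using a that pos[of k] pos[of j] by (simp add: field_simps)
  qed
  define c0 where "c0 = real K powr b * \<rho> K / A"
  have c0: "c0 > 0" using A K pos[of K] by (simp add: c0_def)
  have low: "c0 \<le> real n powr b * \<rho> n" if "n \<ge> K" for n
    using potter[OF order_refl that] A K that
    by (simp add: c0_def powr_divide field_simps)
  define T where "T m = (\<Sum>k<m. \<bar>\<rho> k\<bar>)" for m
  have T0: "T m \<ge> 0" for m by (simp add: T_def sum_nonneg)
  \<comment> \<open>The first summand pays for the lags below K, since m rho(m) >= m^b rho(m) >= c0;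
    the second is the Potter bound summed over the remaining lags.\<close>
  define C2 where "C2 = T K / c0 + A / (1 - b)"
  have C2: "C2 \<ge> 0" using T0 c0 A b by (simp add: C2_def)
  have T: "T m \<le> C2 * (real m * \<rho> m)" if "m \<ge> K" for m
  proof -
    have m: "m \<ge> 1" "\<rho> m > 0" using that K pos by auto
    have "T m = T K + (\<Sum>k=K..<m. \<bar>\<rho> k\<bar>)"
      unfolding T_def using that by (metis lessThan_atLeast0 sum.atLeastLessThan_concat zero_le)
    also have "(\<Sum>k=K..<m. \<bar>\<rho> k\<bar>) \<le> (\<Sum>k=K..<m. (A * real m powr b * \<rho> m) * real k powr (-b))"
    proof (intro sum_mono)
      fix k assume k: "k \<in> {K..<m}"
      then have "\<bar>\<rho> k\<bar> \<le> A * (real m / real k) powr b * \<rho> m" using potter[of k m] pos[of k] by auto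
      then show "\<bar>\<rho> k\<bar> \<le> (A * real m powr b * \<rho> m) * real k powr (-b)"
        by (simp add: powr_divide powr_minus field_simps)
    qed
    also have "\<dots> = (A * real m powr b * \<rho> m) * (\<Sum>k=K..<m. real k powr (-b))"
      by (simp add: sum_distrib_left)
    also have "\<dots> \<le> (A * real m powr b * \<rho> m) * (\<Sum>k=1..m. real k powr (-b))"
      using A m K by (intro mult_left_mono sum_mono2) auto
    also have "\<dots> \<le> (A * real m powr b * \<rho> m) * (real m powr (1 - b) / (1 - b))"
      using A m sum_powr_le[OF b] by (intro mult_left_mono) auto
    also have "\<dots> = A / (1 - b) * (real m powr b * real m powr (1 - b)) * \<rho> m"
      by (simp add: field_simps)
    also have "real m powr b * real m powr (1 - b) = real m" using m by (simp flip: powr_add)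
    also have "T K \<le> T K / c0 * (real m * \<rho> m)"
    proof -
      have "T K * c0 \<le> T K * (real m powr b * \<rho> m)" using low[OF that] T0 by (intro mult_left_mono) auto
      also have "\<dots> \<le> T K * (real m powr 1 * \<rho> m)"
        using m b T0 by (intro mult_left_mono mult_right_mono powr_mono) auto
      finally show ?thesis using c0 m by (simp add: field_simps)
    qed
    finally show ?thesis by (simp add: C2_def algebra_simps)
  qed
  have V_T: "V m \<le> 2 * real m * T m" for m
  proof -
    have "V m \<le> (\<Sum>i=1..m. 2 * T m)" unfolding V
    proof (intro sum_mono)
      fix i assume i: "i \<in> {1..m}"
      have "(\<Sum>j=1..m. \<rho> ((i - j) + (j - i))) \<le> (\<Sum>j=1..m. \<bar>\<rho> ((i - j) + (j - i))\<bar>)"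
        by (intro sum_mono) auto
      also have "\<dots> \<le> 2 * T m" unfolding T_def by (rule sum_dist_le) (use i in auto)
      finally show "(\<Sum>j=1..m. \<rho> ((i - j) + (j - i))) \<le> 2 * T m" .
    qed
    then show ?thesis by simp
  qed
  have upper: "V m \<le> 2 * C2 * (real m ^ 2 * \<rho> m)" if "m \<ge> K" for m
  proof -
    have "V m \<le> 2 * real m * (C2 * (real m * \<rho> m))"
      using V_T[of m] mult_left_mono[OF T[OF that], of "2 * real m"] by simp
    then show ?thesis by (simp add: power2_eq_square mult_ac)
  qed
  have lower: "real n ^ 2 * \<rho> n / (16 * C\<^sup>2) - 2 * real K * T K * real n \<le> V n" if n: "n \<ge> 12 * K" for n
  proof -
    \<comment> \<open>Indices i <= q and j > n - q are more than n - 2q >= q apart. With n >= 12 K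
      this exceeds K, so such pairs avoid the short lags, and n <= 4q gives the constant 16
      below.\<close>
    define q where "q = n div 3"
    have q: "real n \<le> 4 * real q" "3 * q \<le> n" "n < 3 * q + 3" using n K by (auto simp: q_def)
    have nK: "n \<ge> K" and rn: "\<rho> n > 0" using n pos by auto
    \<comment> \<open>A pointwise minorant: corner pairs receive rho(n)/C^2, short lags are charged
      -T(K), and all other covariances are bounded below by 0. The square of C comes from reaching n
      from the lag k by at most two steps of ratio at most 2.\<close>
    have pw: "\<rho> n / C\<^sup>2 * of_bool (i \<le> q \<and> n - q < j) - T K * of_bool ((i - j) + (j - i) < K)
        \<le> \<rho> ((i - j) + (j - i))" if "i \<in> {1..n}" "j \<in> {1..n}" for i j
    proof (cases "(i - j) + (j - i) < K")
      case True
      then have "\<bar>\<rho> ((i - j) + (j - i))\<bar> \<le> T K"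
        unfolding T_def by (intro member_le_sum[of "(i - j) + (j - i)" "{..<K}" "\<lambda>k. \<bar>\<rho> k\<bar>"]) auto
      moreover have "\<not> (i \<le> q \<and> n - q < j)" using True q n that by auto
      ultimately show ?thesis using True by auto
    next
      case False
      define k where "k = (i - j) + (j - i)"
      have k: "k \<ge> K" "\<rho> k > 0" using False pos by (auto simp: k_def)
      have "\<rho> n \<le> C\<^sup>2 * \<rho> k" if "i \<le> q" "n - q < j"
      proof -
        have kn: "n \<le> 4 * k" "k \<le> n" using that q \<open>i \<in> {1..n}\<close> \<open>j \<in> {1..n}\<close> by (auto simp: k_def)
        have C2: "C * \<rho> k \<le> C\<^sup>2 * \<rho> k"
          using C k by (intro mult_right_mono) (auto simp: power2_eq_square)
        show ?thesis
        proof (cases "n \<le> 2 * k")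
          case True
          then show ?thesis using comp[OF k(1) kn(2)] C2 by auto
        next
          case False
          then have "\<rho> n \<le> C * \<rho> (2 * k)" using comp[of "2 * k" n] k kn by auto
          also have "\<dots> \<le> C * (C * \<rho> k)" using comp[of k "2 * k"] k C by (intro mult_left_mono) auto
          finally show ?thesis by (simp add: power2_eq_square)
        qed
      qed
      then have "\<rho> n / C\<^sup>2 * of_bool (i \<le> q \<and> n - q < j) \<le> \<rho> k"
        using C k by (auto simp: field_simps)
      then show ?thesis using False by (simp add: k_def)
    qed
    have "(\<Sum>i=1..n. \<Sum>j=1..n. \<rho> n / C\<^sup>2 * of_bool (i \<le> q \<and> n - q < j)
        - T K * of_bool ((i - j) + (j - i) < K)) \<le> V n"
      unfolding V by (intro sum_mono pw)
    moreover have "(\<Sum>i=1..n. \<Sum>j=1..n. T K * of_bool ((i - j) + (j - i) < K)) \<le> (\<Sum>i=1..n. 2 * real K * T K)"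
    proof (intro sum_mono)
      fix i assume i: "i \<in> {1..n}"
      have "(\<Sum>j=1..n. T K * of_bool ((i - j) + (j - i) < K)) \<le> 2 * (\<Sum>k<n. T K * of_bool (k < K))"
        by (rule sum_dist_le) (use i T0 in auto)
      also have "(\<Sum>k<n. T K * of_bool (k < K)) = (\<Sum>k<K. T K)"
        by (rule sum.mono_neutral_cong_right) (use nK in auto)
      finally show "(\<Sum>j=1..n. T K * of_bool ((i - j) + (j - i) < K)) \<le> 2 * real K * T K" by simp
    qed
    moreover have "(\<Sum>i=1..n. \<Sum>j=1..n. \<rho> n / C\<^sup>2 * of_bool (i \<le> q \<and> n - q < j)) = \<rho> n / C\<^sup>2 * real q ^ 2"
    proof -
      have "(\<Sum>i=1..n. \<Sum>j=1..n. \<rho> n / C\<^sup>2 * of_bool (i \<le> q \<and> n - q < j))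
          = \<rho> n / C\<^sup>2 * ((\<Sum>i=1..n. of_bool (i \<le> q)) * (\<Sum>j=1..n. of_bool (n - q < j)))"
        unfolding sum_product by (simp only: of_bool_conj sum_distrib_left)
      also have "(\<Sum>i=1..n. of_bool (i \<le> q)) = (\<Sum>i=1..q. 1::real)"
        by (rule sum.mono_neutral_cong_right) (use q in auto)
      also have "(\<Sum>j=1..n. of_bool (n - q < j)) = (\<Sum>j\<in>{n - q<..n}. 1::real)"
        by (rule sum.mono_neutral_cong_right) auto
      finally show ?thesis using q by (simp add: power2_eq_square)
    qed
    moreover have "real n ^ 2 * \<rho> n / (16 * C\<^sup>2) \<le> \<rho> n / C\<^sup>2 * real q ^ 2"
    proof -
      have "real n ^ 2 \<le> (4 * real q) ^ 2" using q by (intro power_mono) auto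
      then have "\<rho> n / C\<^sup>2 * (real n ^ 2 / 16) \<le> \<rho> n / C\<^sup>2 * real q ^ 2"
        using rn by (intro mult_left_mono) (auto simp: power_mult_distrib)
      then show ?thesis by (simp add: mult_ac)
    qed
    ultimately show ?thesis by (simp add: sum_subtractf mult_ac)
  qed
  \<comment> \<open>Chosen so that n^(1-b) >= Z implies n rho(n) >= 64 C^2 K T(K); the linear loss 2
    K T(K) n is then at most half of the main term, which accounts for 32 in place of 16.\<close>
  define Z where "Z = 64 * C\<^sup>2 * (real K * T K) / c0"
  have Z: "Z \<ge> 0" using T0 c0 C by (simp add: Z_def)
  define N1 where "N1 = nat \<lceil>Z powr (1 / (1 - b))\<rceil>"
  have N1: "c0 * real n powr (1 - b) \<ge> 64 * C\<^sup>2 * (real K * T K)" if "n \<ge> N1" for n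
  proof -
    have "Z = (Z powr (1 / (1 - b))) powr (1 - b)" using Z b by (simp add: powr_powr)
    also have "\<dots> \<le> real n powr (1 - b)"
      using that b by (intro powr_mono2) (auto simp: N1_def)
    finally show ?thesis using c0 by (simp add: Z_def field_simps)
  qed
  define N where "N = max N1 (12 * K)"
  have low2: "real n ^ 2 * \<rho> n / (32 * C\<^sup>2) \<le> V n" if n: "n \<ge> N" for n
  proof -
    have n': "n \<ge> N1" "n \<ge> 12 * K" "n \<ge> K" "n > 0" using n K by (auto simp: N_def)
    have "64 * C\<^sup>2 * (real K * T K) \<le> c0 * real n powr (1 - b)" using N1 n' by auto
    also have "\<dots> \<le> (real n powr b * \<rho> n) * real n powr (1 - b)" using low n' by (intro mult_right_mono) auto
    also have "\<dots> = real n powr (b + (1 - b)) * \<rho> n" by (simp only: powr_add mult_ac)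
    also have "\<dots> = real n * \<rho> n" using n' by simp
    finally have "2 * real K * T K * real n \<le> real n * (real n * \<rho> n) / (32 * C\<^sup>2)"
      using C n' by (simp add: field_simps)
    then show ?thesis using lower[OF n'(2)] by (simp add: power2_eq_square field_simps)
  qed
  \<comment> \<open>\<open>B1\<close> serves block lengths m >= K, \<open>B2\<close> the finitely
    many shorter ones.\<close>
  define B1 where "B1 = 64 * C2 * A * C\<^sup>2"
  define B2 where "B2 = 64 * C\<^sup>2 * real K * T K / c0"
  have B: "B1 \<ge> 0" "B2 \<ge> 0" using C2 A C T0 c0 by (auto simp: B1_def B2_def)
  have "V n > 0 \<and> (\<forall>m. 1 \<le> m \<longrightarrow> m \<le> n \<longrightarrow> V m \<le> (B1 + B2) * (real m / real n) powr (2 - b) * V n)"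
    if n: "n \<ge> N" for n
  proof (intro conjI allI impI)
    have n': "n \<ge> K" "n > 0" using n K by (auto simp: N_def)
    have rn: "\<rho> n > 0" using pos n' by auto
    have "real n ^ 2 * \<rho> n / (32 * C\<^sup>2) > 0" using n' C rn by simp
    then show Vn: "V n > 0" using low2[OF n] by linarith
    fix m assume m: "1 \<le> m" "m \<le> n"
    let ?q = "(real m / real n) powr (2 - b)"
    have split: "?q * real n ^ 2 = real m powr (2 - b) * real n powr b"
    proof -
      have "real n ^ 2 = real n powr (2 - b) * real n powr b" using n' by (simp flip: powr_add)
      then show ?thesis using n' m by (simp add: powr_divide)
    qed
    have "V m \<le> (if m \<ge> K then B1 else B2) * ?q * (real n ^ 2 * \<rho> n / (32 * C\<^sup>2))"
    proof (cases "m \<ge> K")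
      case True
      have "V m \<le> 2 * C2 * (real m ^ 2 * \<rho> m)" by (rule upper[OF True])
      also have "\<dots> \<le> 2 * C2 * (real m ^ 2 * (A * (real n / real m) powr b * \<rho> n))"
        using C2 potter[OF True m(2)] by (intro mult_left_mono) auto
      also have "\<dots> = 2 * C2 * A * (real m powr 2 * (real n / real m) powr b) * \<rho> n"
        using m by simp
      also have "real m powr 2 * (real n / real m) powr b = real m powr (2 - b) * real n powr b"
        using m by (simp only: powr_divide powr_diff) simp
      also have "2 * C2 * A * (real m powr (2 - b) * real n powr b) * \<rho> n
          = B1 * ?q * (real n ^ 2 * \<rho> n / (32 * C\<^sup>2))"
        unfolding split[symmetric] B1_def using C by simp
      finally show ?thesis using True by simp
    next
      case False
      \<comment> \<open>For m < K a constant bounds V(m). It is enough that (m/n)^(2-b) n^2 rho(n) =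
        m^(2-b) n^b rho(n) >= c0, which uses m >= 1.\<close>
      have "V m \<le> 2 * real m * T m" by (rule V_T)
      also have "\<dots> \<le> 2 * real K * T K"
      proof -
        have "T m \<le> T K" unfolding T_def using False by (intro sum_mono2) auto
        then show ?thesis using False T0[of m] by (intro mult_mono) auto
      qed
      also have "\<dots> = B2 * c0 / (32 * C\<^sup>2)" using c0 C by (simp add: B2_def)
      also have "\<dots> \<le> B2 * (real n powr b * \<rho> n) / (32 * C\<^sup>2)"
        using B low[OF n'(1)] by (intro divide_right_mono mult_left_mono) auto
      also have "\<dots> = B2 * (1 * real n powr b) * \<rho> n / (32 * C\<^sup>2)" by simp
      also have "\<dots> \<le> B2 * (real m powr (2 - b) * real n powr b) * \<rho> n / (32 * C\<^sup>2)"
        using B rn m b by (intro divide_right_mono mult_left_mono mult_right_mono ge_one_powr_ge_zero) auto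
      also have "\<dots> = B2 * ?q * (real n ^ 2 * \<rho> n / (32 * C\<^sup>2))"
        unfolding split[symmetric] by simp
      finally show ?thesis using False by simp
    qed
    also have "\<dots> \<le> (B1 + B2) * ?q * V n"
      using B low2[OF n] rn by (intro mult_mono) auto
    finally show "V m \<le> (B1 + B2) * ?q * V n" .
  qed
  then show "\<exists>B N. \<forall>n\<ge>N. V n > 0 \<and> (\<forall>m. 1 \<le> m \<longrightarrow> m \<le> n \<longrightarrow> V m \<le> B * (real m / real n) powr (2 - b) * V n)"
    by blast
  have \<rho>0: "\<rho> \<longlonglongrightarrow> 0"
  proof (rule tendsto_sandwich)
    show "eventually (\<lambda>n. 0 \<le> \<rho> n) sequentially"
      using pos by (auto simp: eventually_sequentially intro!: exI[of _ K] less_imp_le)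
    show "eventually (\<lambda>n. \<rho> n \<le> (C * 2 powr a) * (real n / real K) powr (-a) * \<rho> K) sequentially"
      using potter'[OF order_refl] by (auto simp: eventually_sequentially)
    have "filterlim (\<lambda>n. real n / real K) at_top sequentially"
      using K filterlim_tendsto_pos_mult_at_top[OF tendsto_const _ filterlim_real_sequentially, of "inverse (real K)"]
      by (simp add: field_simps)
    then have "((\<lambda>n. (real n / real K) powr (-a)) \<longlongrightarrow> 0) sequentially"
      using a by (intro tendsto_neg_powr) auto
    from tendsto_mult_right[OF tendsto_mult_left[OF this]]
    show "(\<lambda>n. (C * 2 powr a) * (real n / real K) powr (-a) * \<rho> K) \<longlonglongrightarrow> 0" by fastforce
  qed auto
  show "(\<lambda>n. V n / real n ^ 2) \<longlonglongrightarrow> 0"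
  proof (rule tendsto_sandwich)
    show "eventually (\<lambda>n. 0 \<le> V n / real n ^ 2) sequentially"
    proof (unfold eventually_sequentially, intro exI allI impI)
      fix n assume n: "N \<le> n"
      have "0 \<le> real n ^ 2 * \<rho> n / (32 * C\<^sup>2)"
        using n pos[of n] by (auto simp: N_def intro!: divide_nonneg_nonneg mult_nonneg_nonneg)
      then show "0 \<le> V n / real n ^ 2" using low2[OF n] by simp
    qed
    show "eventually (\<lambda>n. V n / real n ^ 2 \<le> 2 * C2 * \<rho> n) sequentially"
    proof (unfold eventually_sequentially, intro exI allI impI)
      fix n assume n: "K \<le> n"
      then show "V n / real n ^ 2 \<le> 2 * C2 * \<rho> n"
        using upper[OF n] K by (simp add: field_simps)
    qed
    show "(\<lambda>n. 2 * C2 * \<rho> n) \<longlonglongrightarrow> 0" using tendsto_mult_left[OF \<rho>0, of "2 * C2"] by simp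
  qed auto
qed

section \<open>A maximal inequality by dyadic chaining\<close>

text \<open>An l^2 substitute for the largest increment at scale 2^j; unlike the maximum, its
  expectation is computed term by term.\<close>

definition dyadic_sq :: "(nat \<Rightarrow> real) \<Rightarrow> nat \<Rightarrow> nat \<Rightarrow> real" where
  "dyadic_sq f N j = (\<Sum>i<2 ^ (N - j). (f ((i + 1) * 2 ^ j) - f (i * 2 ^ j))\<^sup>2)"

lemma dyadic_sq_nonneg: "dyadic_sq f N j \<ge> 0"
  by (simp add: dyadic_sq_def sum_nonneg)

text \<open>Induction by halving: f is restricted to even arguments, and k differs from 2 (k div 2)
  by at most one increment at the finest scale.\<close>

lemma dyadic_chaining:
  "k \<le> 2 ^ N \<Longrightarrow> \<bar>f k - f 0\<bar> \<le> (\<Sum>j\<le>N. sqrt (dyadic_sq f N j))"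
proof (induction N arbitrary: f k)
  case 0
  then have "k = 0 \<or> k = 1" by auto
  then show ?case by (auto simp: dyadic_sq_def)
next
  case (Suc N)
  define g where "g i = f (2 * i)" for i
  have D: "dyadic_sq g N j = dyadic_sq f (Suc N) (Suc j)" for j
    by (simp add: dyadic_sq_def g_def mult_ac distrib_left)
  have "\<bar>g (k div 2) - g 0\<bar> \<le> (\<Sum>j\<le>N. sqrt (dyadic_sq g N j))"
    by (rule Suc.IH) (use Suc.prems in auto)
  moreover have "\<bar>f k - g (k div 2)\<bar> \<le> sqrt (dyadic_sq f (Suc N) 0)"
  proof (cases "even k")
    case True
    then show ?thesis by (simp add: g_def dyadic_sq_nonneg)
  next
    case False
    then have k: "k = 2 * (k div 2) + 1" by simp
    have "even (2 ^ Suc N :: nat)" by simp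
    \<comment> \<open>An odd k is not the right end of the range, so k - 1 is the left end of one of
      the unit blocks.\<close>
    then have "k \<noteq> 2 ^ Suc N" using False by metis
    then have lt: "2 * (k div 2) < 2 ^ Suc N" using Suc.prems k by linarith
    have "(f k - g (k div 2))\<^sup>2 = (f (2 * (k div 2) + 1) - f (2 * (k div 2)))\<^sup>2"
      using k by (simp add: g_def)
    also have "\<dots> \<le> (\<Sum>i<2 ^ Suc N. (f (i + 1) - f i)\<^sup>2)"
      using lt by (intro member_le_sum[of _ _ "\<lambda>i. (f (i + 1) - f i)\<^sup>2"]) auto
    also have "\<dots> = dyadic_sq f (Suc N) 0" by (simp add: dyadic_sq_def)
    finally have "sqrt ((f k - g (k div 2))\<^sup>2) \<le> sqrt (dyadic_sq f (Suc N) 0)" by (rule real_sqrt_le_mono)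
    then show ?thesis by simp
  qed
  moreover have "(\<Sum>j\<le>Suc N. sqrt (dyadic_sq f (Suc N) j))
      = sqrt (dyadic_sq f (Suc N) 0) + (\<Sum>j\<le>N. sqrt (dyadic_sq g N j))"
    unfolding sum.atMost_Suc_shift D ..
  ultimately show ?case by (simp add: g_def)
qed

text \<open>Geometric weights in Cauchy-Schwarz avoid the factor N that equal weights would cost,
  hence a logarithm of n in the maximal inequality.\<close>

lemma dyadic_chaining_weighted:
  assumes "k \<le> 2 ^ N" and w: "\<And>j. w j > 0"
  shows "(f k - f 0)\<^sup>2 \<le> (\<Sum>j\<le>N. w j) * (\<Sum>j\<le>N. dyadic_sq f N j / w j)"
proof -
  have "(f k - f 0)\<^sup>2 = \<bar>f k - f 0\<bar>\<^sup>2" by simp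
  also have "\<dots> \<le> (\<Sum>j\<le>N. sqrt (dyadic_sq f N j))\<^sup>2"
    using dyadic_chaining[OF assms(1)] by (intro power_mono) auto
  also have "\<dots> = (\<Sum>j\<le>N. sqrt (w j) * sqrt (dyadic_sq f N j / w j))\<^sup>2"
    using w by (intro arg_cong[where f = "\<lambda>x. x\<^sup>2"] sum.cong refl) (simp flip: real_sqrt_mult add: less_imp_neq[symmetric])
  also have "\<dots> \<le> (\<Sum>j\<le>N. (sqrt (w j))\<^sup>2) * (\<Sum>j\<le>N. (sqrt (dyadic_sq f N j / w j))\<^sup>2)"
    by (rule Cauchy_Schwarz_ineq_sum)
  also have "\<dots> = (\<Sum>j\<le>N. w j) * (\<Sum>j\<le>N. dyadic_sq f N j / w j)"
    using w by (simp add: dyadic_sq_nonneg less_imp_le)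
  finally show ?thesis .
qed

lemma ex_power2_sandwich: "n \<ge> 1 \<Longrightarrow> \<exists>N. n \<le> 2 ^ N \<and> 2 ^ N \<le> 2 * (n::nat)"
proof (induction n rule: less_induct)
  case (less n)
  show ?case
  proof (cases "n = 1")
    case True
    then show ?thesis by (intro exI[of _ 0]) auto
  next
    case False
    then have "(n + 1) div 2 < n" "(n + 1) div 2 \<ge> 1" using less.prems by auto
    then obtain N where N: "(n + 1) div 2 \<le> 2 ^ N" "2 ^ N \<le> 2 * ((n + 1) div 2)" using less.IH by blast
    show ?thesis
    proof (cases "n \<le> 2 ^ N")
      case True
      then show ?thesis using N less.prems False by (intro exI[of _ N]) auto
    next
      case False
      then show ?thesis using N by (intro exI[of _ "Suc N"]) auto
    qed
  qed
qed

text \<open>Scale j contributes B 2^(N-j) 2^(j kappa), which grows geometrically in j because kappa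
  > 1, so the coarsest scale dominates. The conclusion supplies an integrable majorant of all
  squares, ready for Markov's inequality. The factor 2^kappa comes from 2^N <= 2n.\<close>

lemma (in prob_space) maximal_second_moment:
  fixes S :: "nat \<Rightarrow> 'a \<Rightarrow> real" and \<kappa> B :: real
  assumes \<kappa>: "\<kappa> > 1" and B: "B \<ge> 0" and n: "n \<ge> 1" and S0: "\<And>\<omega>. S 0 \<omega> = 0"
    and int: "\<And>k m. k + m \<le> n \<Longrightarrow> integrable M (\<lambda>\<omega>. (S (k + m) \<omega> - S k \<omega>)\<^sup>2)"
    and bound: "\<And>k m. m \<ge> 1 \<Longrightarrow> k + m \<le> n \<Longrightarrow> expectation (\<lambda>\<omega>. (S (k + m) \<omega> - S k \<omega>)\<^sup>2) \<le> B * real m powr \<kappa>"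
  shows "\<exists>R. integrable M R \<and> (\<forall>\<omega>. \<forall>k\<le>n. (S k \<omega>)\<^sup>2 \<le> R \<omega>) \<and>
    expectation R \<le> (2 powr ((\<kappa> - 1) / 2) / (2 powr ((\<kappa> - 1) / 2) - 1))\<^sup>2 * 2 powr \<kappa> * B * real n powr \<kappa>"
proof -
  obtain N where N: "n \<le> 2 ^ N" "2 ^ N \<le> 2 * n" using ex_power2_sandwich[OF n] by blast
  \<comment> \<open>Half of the available exponent: 2 x^2 = 2^kappa, so scale j contributes at most
    B 2^N x^(2j); after division by the weight x^j a geometric sum in x remains, balancing the sum
    of the weights.\<close>
  define x :: real where "x = 2 powr ((\<kappa> - 1) / 2)"
  have x: "x > 1" unfolding x_def using \<kappa> by (intro gr_one_powr) auto
  \<comment> \<open>The path is frozen after n, because the dyadic range reaches 2^N >= n while the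
    increment bounds stop at n.\<close>
  define f where "f \<omega> k = S (min k n) \<omega>" for \<omega> k
  define R where "R \<omega> = (\<Sum>j\<le>N. x ^ j) * (\<Sum>j\<le>N. dyadic_sq (f \<omega>) N j / x ^ j)" for \<omega>
  define G where "G = (\<Sum>j\<le>N. x ^ j)"
  have incr: "integrable M (\<lambda>\<omega>. (f \<omega> ((i + 1) * 2 ^ j) - f \<omega> (i * 2 ^ j))\<^sup>2)
      \<and> expectation (\<lambda>\<omega>. (f \<omega> ((i + 1) * 2 ^ j) - f \<omega> (i * 2 ^ j))\<^sup>2) \<le> B * (2 * x ^ 2) ^ j" for i j
  proof -
    define k where "k = min (i * 2 ^ j) n"
    define m where "m = min ((i + 1) * 2 ^ j) n - k"
    have km: "min ((i + 1) * 2 ^ j) n = k + m" "m \<le> 2 ^ j" "k + m \<le> n"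
      by (auto simp: k_def m_def)
    have e: "(\<lambda>\<omega>. (f \<omega> ((i + 1) * 2 ^ j) - f \<omega> (i * 2 ^ j))\<^sup>2) = (\<lambda>\<omega>. (S (k + m) \<omega> - S k \<omega>)\<^sup>2)"
      unfolding f_def km(1) by (simp add: k_def)
    have "2 * x ^ 2 = 2 powr \<kappa>"
    proof -
      have "2 * x ^ 2 = 2 powr 1 * (2 powr ((\<kappa> - 1) / 2) * 2 powr ((\<kappa> - 1) / 2))"
        by (simp add: x_def power2_eq_square)
      also have "\<dots> = 2 powr (1 + ((\<kappa> - 1) / 2 + (\<kappa> - 1) / 2))" by (simp only: powr_add)
      finally show ?thesis by (simp add: field_simps)
    qed
    then have pw: "(2 * x ^ 2) ^ j = (2 ^ j) powr \<kappa>"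
      by (simp add: powr_powr mult.commute flip: powr_realpow)
    have "expectation (\<lambda>\<omega>. (S (k + m) \<omega> - S k \<omega>)\<^sup>2) \<le> B * (2 * x ^ 2) ^ j"
    proof (cases "m = 0")
      case True
      then show ?thesis using B by simp
    next
      case False
      have "real m \<le> 2 ^ j" using km(2) by (metis of_nat_le_iff of_nat_numeral of_nat_power)
      then have "B * real m powr \<kappa> \<le> B * (2 ^ j) powr \<kappa>"
        using B \<kappa> by (intro mult_left_mono powr_mono2) auto
      moreover have "expectation (\<lambda>\<omega>. (S (k + m) \<omega> - S k \<omega>)\<^sup>2) \<le> B * real m powr \<kappa>"
        using False km by (intro bound) auto
      ultimately show ?thesis unfolding pw by linarith
    qed
    then show ?thesis unfolding e using int[OF km(3)] by blast
  qed
  have dint: "integrable M (\<lambda>\<omega>. dyadic_sq (f \<omega>) N j)" for j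
    unfolding dyadic_sq_def using incr by (intro Bochner_Integration.integrable_sum) blast
  have dexp: "expectation (\<lambda>\<omega>. dyadic_sq (f \<omega>) N j) \<le> B * 2 ^ N * x ^ (2 * j)" if "j \<le> N" for j
  proof -
    have "expectation (\<lambda>\<omega>. dyadic_sq (f \<omega>) N j) \<le> (\<Sum>i<(2::nat) ^ (N - j). B * (2 * x ^ 2) ^ j)"
      unfolding dyadic_sq_def
      by (subst Bochner_Integration.integral_sum) (use incr in \<open>blast intro: sum_mono\<close>)+
    also have "\<dots> = B * (2 ^ (N - j) * 2 ^ j) * x ^ (2 * j)"
      by (simp add: power_mult_distrib power_mult)
    also have "2 ^ (N - j) * 2 ^ j = (2::real) ^ N" using that by (simp flip: power_add)
    finally show ?thesis .
  qed
  have "integrable M R" unfolding R_def using dint by simp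
  moreover have "(S k \<omega>)\<^sup>2 \<le> R \<omega>" if "k \<le> n" for k \<omega>
    using dyadic_chaining_weighted[of k N "\<lambda>j. x ^ j" "f \<omega>"] that N x S0[of \<omega>]
    by (simp add: R_def f_def min_def)
  moreover have "expectation R \<le> (x / (x - 1))\<^sup>2 * 2 powr \<kappa> * B * real n powr \<kappa>"
  proof -
    have G: "0 \<le> G" "G \<le> x / (x - 1) * x ^ N"
      using x one_le_power[of x "Suc N"] by (auto simp: G_def sum_nonneg geometric_sum lessThan_Suc_atMost[symmetric] field_simps)
    have "expectation R = G * (\<Sum>j\<le>N. expectation (\<lambda>\<omega>. dyadic_sq (f \<omega>) N j) / x ^ j)"
      unfolding R_def G_def using dint by simp
    also have "\<dots> \<le> G * (\<Sum>j\<le>N. B * 2 ^ N * x ^ (2 * j) / x ^ j)"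
      using x dexp G by (intro mult_left_mono sum_mono divide_right_mono) auto
    also have "\<dots> = B * 2 ^ N * G\<^sup>2"
    proof -
      have "x ^ (2 * j) / x ^ j = x ^ j" for j
        using x by (simp add: mult_2 power_add)
      then have "(\<Sum>j\<le>N. B * 2 ^ N * x ^ (2 * j) / x ^ j) = B * 2 ^ N * G"
        unfolding G_def sum_distrib_left by (intro sum.cong refl) (metis times_divide_eq_right)
      then show ?thesis by (simp add: power2_eq_square)
    qed
    also have "\<dots> \<le> B * 2 ^ N * (x / (x - 1) * x ^ N)\<^sup>2"
      using B G by (intro mult_left_mono power_mono) auto
    also have "\<dots> = B * (x / (x - 1))\<^sup>2 * (2 ^ N * (x ^ N)\<^sup>2)"
      by (simp only: power_mult_distrib mult_ac)
    also have "2 ^ N * (x ^ N)\<^sup>2 = (2 ^ N) powr \<kappa>"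
    proof -
      have "(x ^ N)\<^sup>2 = x powr (2 * real N)" using x by (simp add: powr_realpow[symmetric] power2_eq_square flip: powr_add)
      also have "\<dots> = 2 powr ((\<kappa> - 1) * real N)" by (simp add: x_def powr_powr)
      finally have "2 ^ N * (x ^ N)\<^sup>2 = 2 powr (real N) * 2 powr ((\<kappa> - 1) * real N)" by (simp add: powr_realpow)
      also have "\<dots> = 2 powr (real N * \<kappa>)" by (simp add: algebra_simps flip: powr_add)
      finally show ?thesis by (simp add: powr_powr flip: powr_realpow)
    qed
    also have "B * (x / (x - 1))\<^sup>2 * (2 ^ N) powr \<kappa> \<le> B * (x / (x - 1))\<^sup>2 * (2 * real n) powr \<kappa>"
    proof -
      have "(2::real) ^ N \<le> 2 * real n" using N(2) by (metis of_nat_le_iff of_nat_mult of_nat_numeral of_nat_power)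
      then show ?thesis using B \<kappa> by (intro mult_left_mono powr_mono2) auto
    qed
    also have "\<dots> = (x / (x - 1))\<^sup>2 * 2 powr \<kappa> * B * real n powr \<kappa>" by (simp add: powr_mult)
    finally show ?thesis .
  qed
  ultimately show ?thesis unfolding x_def by blast
qed

section \<open>Rank counts and the deterministic comparison\<close>

text \<open>Just to the left of x, a <= y is equivalent to a < x, and finitely many ranks can be
  treated simultaneously. The left limit therefore only makes the inequality strict.\<close>

lemma Ghat_left_eq:
  "Ghat_left X n k x = (\<Sum>i=1..k. if rank_of X n i / (real n + 1) < x then 1 else 0)"
proof -
  have "eventually (\<lambda>y. (a \<le> y) = (a < x)) (at_left x)" for a :: real
  proof (cases "a < x")
    case True
    have "eventually (\<lambda>y. y \<in> {a<..<x}) (at_left x)"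
      using True by (rule eventually_at_left_real)
    then show ?thesis by eventually_elim (use True in auto)
  next
    case False
    have "eventually (\<lambda>y. y < x) (at_left x)" by (simp add: eventually_at_filter)
    then show ?thesis by eventually_elim (use False in auto)
  qed
  then have "eventually (\<lambda>y. \<forall>i\<in>{1..k}. (rank_of X n i / (real n + 1) \<le> y) = (rank_of X n i / (real n + 1) < x)) (at_left x)"
    by (intro eventually_ball_finite) auto
  then have "eventually (\<lambda>y. Ghat X n k y = (\<Sum>i=1..k. if rank_of X n i / (real n + 1) < x then 1 else 0)) (at_left x)"
    by eventually_elim (auto simp: Ghat_def intro!: sum.cong)
  then show ?thesis
    unfolding Ghat_left_def by (intro tendsto_Lim tendsto_eventually) auto
qed

definition ecount :: "(nat \<Rightarrow> real) \<Rightarrow> nat \<Rightarrow> real \<Rightarrow> real" where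
  "ecount X k x = (\<Sum>j=1..k. if X j \<le> x then 1 else 0)"

lemma rank_of_eq_ecount: "rank_of X n i = ecount X n (X i)"
  by (simp add: rank_of_def ecount_def)

lemma ecount_mono: "x \<le> y \<Longrightarrow> ecount X k x \<le> ecount X k y"
  unfolding ecount_def by (intro sum_mono) auto

lemma ecount_bounds: "0 \<le> ecount X k x" "ecount X k x \<le> real k"
proof -
  show "0 \<le> ecount X k x" unfolding ecount_def by (intro sum_nonneg) auto
  have "ecount X k x \<le> (\<Sum>j=1..k. 1)" unfolding ecount_def by (intro sum_mono) auto
  then show "ecount X k x \<le> real k" by simp
qed

lemma ecount_split:
  assumes "k \<le> n"
  shows "ecount X n x = ecount X k x + (\<Sum>j\<in>{k<..n}. if X j \<le> x then 1 else 0)"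
proof -
  have "{1..n} = {1..k} \<union> {k<..n}" using assms by auto
  then show ?thesis unfolding ecount_def by (simp only:) (subst sum.union_disjoint, auto)
qed

lemma ecount_mono_length:
  assumes "k \<le> n"
  shows "ecount X k x \<le> ecount X n x" "real k - ecount X k x \<le> real n - ecount X n x"
proof -
  have "0 \<le> (\<Sum>j\<in>{k<..n}. if X j \<le> x then 1 else 0 :: real)" by (intro sum_nonneg) auto
  moreover have "(\<Sum>j\<in>{k<..n}. if X j \<le> x then 1 else 0 :: real) \<le> (\<Sum>j\<in>{k<..n}. 1)"
    by (intro sum_mono) auto
  moreover have "(\<Sum>j\<in>{k<..n}. 1::real) = real n - real k" using assms by simp
  ultimately show "ecount X k x \<le> ecount X n x" "real k - ecount X k x \<le> real n - ecount X n x"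
    using ecount_split[OF assms, of X x] by auto
qed

lemma rank_of_bounds: "i \<in> {1..n} \<Longrightarrow> 1 \<le> rank_of X n i" "rank_of X n i \<le> real n"
proof -
  assume "i \<in> {1..n}"
  then have "(if X i \<le> X i then 1 else 0) \<le> rank_of X n i"
    unfolding rank_of_def by (intro member_le_sum) auto
  then show "1 \<le> rank_of X n i" by simp
next
  show "rank_of X n i \<le> real n" unfolding rank_of_eq_ecount by (rule ecount_bounds)
qed

text \<open>Ranks lie between 1 and n, so either no index is counted or all are, and centring
  removes both.\<close>

lemma Ghat_left_extreme:
  assumes "0 < x" "x < 1" "min x (1 - x) < 1 / (real n + 1)" "k \<le> n" "n \<ge> 1"
  shows "Ghat_left X n k x - real k / real n * Ghat_left X n n x = 0"
proof (cases "x < 1 / (real n + 1)")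
  case True
  have "\<not> rank_of X n i / (real n + 1) < x" if "i \<in> {1..n}" for i
  proof -
    have "1 / (real n + 1) \<le> rank_of X n i / (real n + 1)"
      using rank_of_bounds(1)[OF that, of X] by (intro divide_right_mono) auto
    then show ?thesis using True by linarith
  qed
  then have "Ghat_left X n l x = 0" if "l \<le> n" for l
    unfolding Ghat_left_eq using that by (intro sum.neutral) auto
  then show ?thesis using assms by simp
next
  case False
  then have "1 - x < 1 / (real n + 1)" using assms by auto
  then have x: "real n / (real n + 1) < x" by (simp add: field_simps)
  have "rank_of X n i / (real n + 1) < x" for i
  proof -
    have "rank_of X n i / (real n + 1) \<le> real n / (real n + 1)"
      using rank_of_bounds(2)[of X n i] by (intro divide_right_mono) auto
    then show ?thesis using x by linarith
  qed
  then have "Ghat_left X n l x = real l" for l unfolding Ghat_left_eq by simp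
  then show ?thesis using assms by simp
qed

text \<open>Here v is the smallest observation whose rank reaches (n+1) x; one exists because the
  largest observation has rank n >= (n+1) x. The point z lies slightly to the left of v and above
  every observation smaller than v, so X i <= z selects exactly the ranks below (n+1) x, even with
  ties. Counts at z and v bracket (n+1) x. The remaining closeness conditions hold for all z near v;
  the one with 3/2 is for the case where z is close to 0.\<close>

lemma Ghat_left_eq_ecount_below:
  fixes lam :: real
  assumes n: "n \<ge> 1" and X01: "\<forall>j\<in>{1..n}. 0 < X j \<and> X j < 1"
    and x: "0 < x" "x < 1" "1 / (real n + 1) \<le> min x (1 - x)"
  shows "\<exists>z v. 0 < z \<and> z < v \<and> v < 1 \<and> v - z \<le> 1 / real n \<and> v \<le> 3 / 2 * z \<and>
    min v (1 - v) powr lam \<le> 2 * min z (1 - z) powr lam \<and>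
    ecount X n z < (real n + 1) * x \<and> (real n + 1) * x \<le> ecount X n v \<and>
    (\<forall>k\<le>n. Ghat_left X n k x = ecount X k z)"
proof -
  let ?I = "{i \<in> {1..n}. (real n + 1) * x \<le> rank_of X n i}"
  have "(real n + 1) * x \<le> real n"
  proof -
    have "1 / (real n + 1) \<le> 1 - x" using x by simp
    then show ?thesis by (simp add: field_simps)
  qed
  moreover have "\<exists>i\<in>{1..n}. rank_of X n i = real n"
  proof -
    have "Max (X ` {1..n}) \<in> X ` {1..n}" using n by (intro Max_in) auto
    then obtain i where i: "i \<in> {1..n}" "X i = Max (X ` {1..n})" by force
    then have "X j \<le> X i" if "j \<in> {1..n}" for j using that by simp
    then have "rank_of X n i = (\<Sum>j=1..n. 1)" unfolding rank_of_def by (intro sum.cong) auto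
    then show ?thesis using i by auto
  qed
  ultimately have ne: "?I \<noteq> {}" by force
  define v where "v = Min (X ` ?I)"
  have "v \<in> X ` ?I" unfolding v_def using ne by (intro Min_in) auto
  then obtain i0 where i0: "i0 \<in> {1..n}" "(real n + 1) * x \<le> rank_of X n i0" "v = X i0" by auto
  have v: "0 < v" "v < 1" using X01 i0 by auto
  have below: "rank_of X n i < (real n + 1) * x \<longleftrightarrow> X i < v" if "i \<in> {1..n}" for i
  proof
    assume lt: "rank_of X n i < (real n + 1) * x"
    show "X i < v"
    proof (rule ccontr)
      assume "\<not> X i < v"
      then have "ecount X n v \<le> ecount X n (X i)" by (intro ecount_mono) auto
      then show False using lt i0 by (simp add: rank_of_eq_ecount)
    qed
  next
    assume lt: "X i < v"
    show "rank_of X n i < (real n + 1) * x"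
    proof (rule ccontr)
      assume "\<not> ?thesis"
      then have "v \<le> X i" unfolding v_def using that by (intro Min_le) auto
      then show False using lt by simp
    qed
  qed
  have "((\<lambda>z. min z (1 - z) powr lam) \<longlongrightarrow> min v (1 - v) powr lam) (at_left v)"
    using v by (intro tendsto_intros) (auto simp: min_def)
  moreover have "min v (1 - v) powr lam / 2 < min v (1 - v) powr lam" using v by simp
  ultimately have ev1: "eventually (\<lambda>z. min v (1 - v) powr lam / 2 < min z (1 - z) powr lam) (at_left v)"
    by (rule order_tendstoD(1))
  have evgt: "eventually (\<lambda>z. z \<in> {a<..<v}) (at_left v)" if "a < v" for a
    using that by (rule eventually_at_left_real)
  have ev2: "eventually (\<lambda>z. \<forall>i\<in>{i\<in>{1..n}. X i < v}. X i < z) (at_left v)"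
  proof (intro eventually_ball_finite ballI)
    fix i assume "i \<in> {i\<in>{1..n}. X i < v}"
    then show "eventually (\<lambda>z. X i < z) (at_left v)"
      using eventually_mono[OF evgt[of "X i"]] by auto
  qed auto
  have ev3: "eventually (\<lambda>z. z \<in> {max (v - 1 / real n) (2 / 3 * v)<..<v}) (at_left v)"
    by (rule evgt) (use v n in auto)
  have "eventually (\<lambda>z. min v (1 - v) powr lam / 2 < min z (1 - z) powr lam \<and>
     (\<forall>i\<in>{i\<in>{1..n}. X i < v}. X i < z) \<and> z \<in> {max (v - 1 / real n) (2 / 3 * v)<..<v}) (at_left v)"
    by (intro eventually_conj ev1 ev2 ev3)
  from eventually_happens'[OF trivial_limit_at_left_real this] obtain z where
    z: "min v (1 - v) powr lam / 2 < min z (1 - z) powr lam" "\<And>i. i \<in> {1..n} \<Longrightarrow> X i < v \<Longrightarrow> X i < z"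
      "v - 1 / real n < z" "2 / 3 * v < z" "z < v" by auto
  have G: "Ghat_left X n k x = ecount X k z" if "k \<le> n" for k
    unfolding Ghat_left_eq ecount_def
  proof (intro sum.cong refl)
    fix i assume "i \<in> {1..k}"
    then have i: "i \<in> {1..n}" using that by auto
    have "rank_of X n i / (real n + 1) < x \<longleftrightarrow> rank_of X n i < (real n + 1) * x"
      by (simp add: pos_divide_less_eq mult.commute)
    also have "\<dots> \<longleftrightarrow> X i \<le> z" using below[OF i] z(2)[OF i] z(5) by auto
    finally show "(if rank_of X n i / (real n + 1) < x then 1 else 0::real) = (if X i \<le> z then 1 else 0)" by simp
  qed
  have "ecount X n z < (real n + 1) * x"
  proof (cases "\<exists>i\<in>{1..n}. X i < v")
    case True
    \<comment> \<open>The count at z is the rank of the largest observation below v, to which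
      \<open>below\<close> applies.\<close>
    let ?L = "X ` {i\<in>{1..n}. X i < v}"
    have "Max ?L \<in> ?L" using True by (intro Max_in) auto
    then obtain i where i: "i \<in> {1..n}" "X i < v" "X i = Max ?L" by auto
    have "ecount X n z = ecount X n (X i)" unfolding ecount_def
    proof (intro sum.cong refl)
      fix j assume j: "j \<in> {1..n}"
      have "X j \<le> z \<longleftrightarrow> X j \<le> X i"
      proof
        assume "X j \<le> z"
        then have "X j \<in> ?L" using j z by auto
        then show "X j \<le> X i" unfolding i(3) by (intro Max_ge) auto
      next
        assume "X j \<le> X i"
        then show "X j \<le> z" using z(2)[OF i(1,2)] by auto
      qed
      then show "(if X j \<le> z then 1 else 0::real) = (if X j \<le> X i then 1 else 0)" by simp
    qed
    then show ?thesis using below[OF i(1)] i(2) by (simp add: rank_of_eq_ecount)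
  next
    case False
    then have "ecount X n z = 0" unfolding ecount_def using z(5) by (intro sum.neutral) force
    then show ?thesis using x by simp
  qed
  moreover have "(real n + 1) * x \<le> ecount X n v" using i0 by (simp add: rank_of_eq_ecount)
  ultimately show ?thesis using z v G by (intro exI[of _ z] exI[of _ v]) auto
qed

text \<open>The data of one good outcome: \<open>E\<close> will be K n^(-theta) d_n,
  \<open>B\<close> will be K' d_n and \<open>J\<close> will be J_r / r!. The counting approximation
  is assumed only inside (0,1), where the weight can be moved to the other side.\<close>

locale rank_approximation =
  fixes X S :: "nat \<Rightarrow> real" and J :: "real \<Rightarrow> real" and n :: nat and lam E B :: real
  assumes n: "n \<ge> 1" and X01: "\<forall>j\<in>{1..n}. 0 < X j \<and> X j < 1"
    and J_Hoelder: "\<And>x y. x \<in> {0..1} \<Longrightarrow> y \<in> {0..1} \<Longrightarrow> \<bar>J x - J y\<bar> \<le> sqrt \<bar>x - y\<bar>"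
    and J0: "J 0 = 0" and J1: "J 1 = 0"
    and approx: "\<And>k x. k \<le> n \<Longrightarrow> 0 < x \<Longrightarrow> x < 1 \<Longrightarrow>
      \<bar>ecount X k x - real k * x - J x * S k\<bar> \<le> E * min x (1 - x) powr lam"
    and S_le: "\<And>k. k \<le> n \<Longrightarrow> \<bar>S k\<bar> \<le> B" and E: "E \<ge> 0"
begin

section \<open>Error bounds for a single outcome\<close>

lemma B_nonneg: "B \<ge> 0" using S_le[of 0] by auto

lemma J_le:
  assumes "0 \<le> x" "x \<le> 1"
  shows "\<bar>J x\<bar> \<le> sqrt (min x (1 - x))"
  using J_Hoelder[of x 0] J_Hoelder[of x 1] assms J0 J1 by (auto simp: min_def)

lemma J_mult_S_le:
  assumes "0 \<le> x" "x \<le> 1" "k \<le> n"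
  shows "\<bar>J x * S k\<bar> \<le> sqrt (min x (1 - x)) * B"
  unfolding abs_mult using J_le[OF assms(1,2)] S_le[OF assms(3)] assms by (intro mult_mono) auto

lemma centered_S_le:
  assumes "k \<le> n"
  shows "\<bar>S k - real k / real n * S n\<bar> \<le> 2 * B"
proof -
  have "\<bar>real k / real n * S n\<bar> \<le> 1 * B"
    unfolding abs_mult using S_le[of n] assms n by (intro mult_mono) (auto simp: field_simps)
  then show ?thesis
    using S_le[OF assms] abs_triangle_ineq4[of "S k" "real k / real n * S n"] by simp
qed

abbreviation err :: "nat \<Rightarrow> real \<Rightarrow> real" where
  "err k x \<equiv> \<bar>(Ghat_left X n k x - real k / real n * Ghat_left X n n x)
    - J x * (S k - real k / real n * S n)\<bar>"

lemma err_le_centered: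
  assumes "k \<le> n" "0 \<le> x" "x \<le> 1"
  shows "err k x \<le> \<bar>Ghat_left X n k x - real k / real n * Ghat_left X n n x\<bar> + 2 * B * sqrt (min x (1 - x))"
proof -
  have "\<bar>J x * (S k - real k / real n * S n)\<bar> \<le> sqrt (min x (1 - x)) * (2 * B)"
    unfolding abs_mult using J_le[OF assms(2,3)] centered_S_le[OF assms(1)] assms
    by (intro mult_mono) auto
  then show ?thesis by (simp add: mult_ac)
qed

text \<open>The rank part vanishes, and |J x| <= sqrt m leaves m^(1/2 - lam), which is small since m
  < 1/(n+1) and lam < 1/2.\<close>

lemma err_extreme:
  assumes "k \<le> n" "0 < x" "x < 1" "min x (1 - x) < 1 / (real n + 1)" "lam < 1 / 2"
  shows "min x (1 - x) powr (-lam) * err k x \<le> 2 * B * (real n + 1) powr (lam - 1/2)"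
proof -
  let ?m = "min x (1 - x)"
  have m: "?m > 0" using assms by simp
  have "err k x \<le> 2 * B * sqrt ?m"
    using err_le_centered[of k x] Ghat_left_extreme[OF assms(2-4,1) n, of X] assms by simp
  then have "?m powr (-lam) * err k x \<le> ?m powr (-lam) * (2 * B * ?m powr (1/2))"
    using m by (intro mult_left_mono) (auto simp: powr_half_sqrt)
  also have "\<dots> = 2 * B * ?m powr (1/2 - lam)" using m by (simp add: mult_ac flip: powr_add)
  also have "\<dots> \<le> 2 * B * (1 / (real n + 1)) powr (1/2 - lam)"
    using m assms B_nonneg by (intro mult_left_mono powr_mono2) auto
  also have "(1 / (real n + 1)) powr (1/2 - lam) = (real n + 1) powr (lam - 1/2)"
    by (simp add: powr_divide powr_diff)
  finally show ?thesis .
qed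

lemma err_at_threshold:
  assumes "k \<le> n" "0 < z" "z < 1" "0 \<le> x" "x \<le> 1"
    and G: "\<And>k. k \<le> n \<Longrightarrow> Ghat_left X n k x = ecount X k z"
  shows "err k x \<le> 2 * E * min z (1 - z) powr lam + 2 * B * sqrt \<bar>z - x\<bar>"
proof -
  let ?e = "\<lambda>k. ecount X k z - real k * z - J z * S k"
  let ?q = "real k / real n"
  have q: "0 \<le> ?q" "?q \<le> 1" using assms(1) n by (auto simp: field_simps)
  have "(Ghat_left X n k x - ?q * Ghat_left X n n x) - J x * (S k - ?q * S n)
      = ?e k - ?q * ?e n + (J z - J x) * (S k - ?q * S n)"
    using n by (simp add: G[OF assms(1)] G[OF order_refl] field_simps)
  moreover have "\<bar>?e k\<bar> \<le> E * min z (1 - z) powr lam" by (rule approx) (use assms in auto)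
  moreover have "\<bar>?q * ?e n\<bar> \<le> 1 * (E * min z (1 - z) powr lam)"
    unfolding abs_mult using q approx[of n z] assms by (intro mult_mono) auto
  moreover have "\<bar>(J z - J x) * (S k - ?q * S n)\<bar> \<le> sqrt \<bar>z - x\<bar> * (2 * B)"
    unfolding abs_mult using J_Hoelder[of z x] centered_S_le[OF assms(1)] assms by (intro mult_mono) auto
  moreover have "\<bar>a - b + c\<bar> \<le> 2 * d + e" if "\<bar>a\<bar> \<le> d" "\<bar>b\<bar> \<le> 1 * d" "\<bar>c\<bar> \<le> e" for a b c d e :: real
    using that by linarith
  ultimately have "err k x \<le> 2 * (E * min z (1 - z) powr lam) + sqrt \<bar>z - x\<bar> * (2 * B)"
    by presburger
  then show ?thesis by (simp add: mult_ac)
qed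

text \<open>The count at z bounds z from above, the count at v bounds v from below, and v - z <= 1/n
  transfers the latter to z. Since |J| <= 1 the Hermite part contributes at most B; the remaining 2
  covers (n+1) x against n x and the gap between z and v.\<close>

lemma threshold_close:
  assumes z: "0 < z" "z < v" "v < 1" "v - z \<le> 1 / real n"
    and x: "0 < x" "x < 1"
    and m: "min v (1 - v) powr lam \<le> 2 * min z (1 - z) powr lam"
    and cz: "ecount X n z < (real n + 1) * x" and cv: "(real n + 1) * x \<le> ecount X n v"
  shows "\<bar>z - x\<bar> \<le> (2 + B + 2 * E * min z (1 - z) powr lam) / real n"
proof -
  have JB: "\<bar>J y * S n\<bar> \<le> B" if "0 < y" "y < 1" for y
  proof -
    have "sqrt (min y (1 - y)) * B \<le> 1 * B" using that B_nonneg by (intro mult_right_mono) auto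
    then show ?thesis using J_mult_S_le[of y n] that by auto
  qed
  let ?P = "E * min z (1 - z) powr lam"
  have P: "?P \<ge> 0" using E by simp
  have ez: "\<bar>ecount X n z - real n * z - J z * S n\<bar> \<le> ?P" by (rule approx) (use z in auto)
  have "\<bar>ecount X n v - real n * v - J v * S n\<bar> \<le> E * min v (1 - v) powr lam"
    by (rule approx) (use z in auto)
  also have "\<dots> \<le> E * (2 * min z (1 - z) powr lam)" using E m by (intro mult_left_mono) auto
  finally have ev: "\<bar>ecount X n v - real n * v - J v * S n\<bar> \<le> 2 * ?P" by simp
  have "real n * (z - x) \<le> 2 + B + 2 * ?P"
    using ez JB[of z] cz x P z by (simp add: algebra_simps abs_le_iff)
  moreover have "real n * (x - z) \<le> 2 + B + 2 * ?P"
  proof -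
    have "real n * (v - z) \<le> real n * (1 / real n)" using z n by (intro mult_left_mono) auto
    then have "real n * (v - z) \<le> 1" using n by simp
    moreover have "real n * (x - v) \<le> B + 2 * ?P"
      using ev JB[of v] cv x z by (simp add: algebra_simps abs_le_iff)
    ultimately show ?thesis by (simp add: algebra_simps)
  qed
  ultimately have "\<bar>real n * (z - x)\<bar> \<le> 2 + B + 2 * ?P" by (auto simp: abs_le_iff algebra_simps)
  then have "real n * \<bar>z - x\<bar> \<le> 2 + B + 2 * ?P" by (simp add: abs_mult)
  then show ?thesis using n by (simp add: pos_le_divide_eq mult_ac)
qed

text \<open>For lam >= 0 the factor \<open>min z (1 - z) powr lam\<close> is at most 1, so |z - x|
  <= \<Delta>. Outside the extreme range m >= 1/(n+1), hence min z (1 - z) <= m + \<Delta> <= (1 +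
  (n+1) \<Delta>) m and m^(-lam) <= (n+1)^lam; these two estimates give the first two
  summands.\<close>

lemma err_le_nonneg:
  assumes lam: "0 \<le> lam" "lam < 1 / 2" and k: "k \<le> n" and x: "0 < x" "x < 1"
  defines "\<Delta> \<equiv> (2 + B + 2 * E) / real n"
  shows "min x (1 - x) powr (-lam) * err k x \<le> 2 * E * (1 + (real n + 1) * \<Delta>) powr lam
    + 2 * B * (real n + 1) powr lam * sqrt \<Delta> + 2 * B * (real n + 1) powr (lam - 1/2)"
proof (cases "min x (1 - x) < 1 / (real n + 1)")
  case True
  have "0 \<le> 2 * E * (1 + (real n + 1) * \<Delta>) powr lam + 2 * B * (real n + 1) powr lam * sqrt \<Delta>"
    using E B_nonneg n by (auto simp: \<Delta>_def)
  then show ?thesis using err_extreme[OF k x True lam(2)] by linarith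
next
  case False
  let ?m = "min x (1 - x)"
  have m: "?m > 0" "?m \<ge> 1 / (real n + 1)" using x False by auto
  from Ghat_left_eq_ecount_below[where lam = lam, OF n X01 x m(2)]
  obtain z v where z: "0 < z" "z < v" "v < 1" "v - z \<le> 1 / real n"
    "min v (1 - v) powr lam \<le> 2 * min z (1 - z) powr lam"
    "ecount X n z < (real n + 1) * x" "(real n + 1) * x \<le> ecount X n v"
    and G: "\<forall>k\<le>n. Ghat_left X n k x = ecount X k z"
    by (elim exE conjE)
  note G = G[rule_format]
  have mz: "min z (1 - z) powr lam \<le> 1" "min z (1 - z) > 0" using z lam by (auto intro!: powr_le1)
  have "(2 + B + 2 * E * min z (1 - z) powr lam) / real n \<le> \<Delta>"
    unfolding \<Delta>_def using mz E by (intro divide_right_mono add_left_mono mult_left_le) auto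
  then have zx: "\<bar>z - x\<bar> \<le> \<Delta>"
    using threshold_close[OF z(1-4) x z(5-7)] by linarith
  have \<Delta>: "\<Delta> \<ge> 0" using zx by linarith
  have inv: "?m powr (-lam) \<le> (real n + 1) powr lam"
  proof -
    have "?m powr (-lam) \<le> (1 / (real n + 1)) powr (-lam)"
      using m lam by (intro powr_mono2') auto
    then show ?thesis by (simp add: powr_divide powr_minus)
  qed
  have "?m powr (-lam) * min z (1 - z) powr lam = (min z (1 - z) / ?m) powr lam"
    using mz m by (simp add: powr_divide powr_minus field_simps)
  also have "\<dots> \<le> (1 + (real n + 1) * \<Delta>) powr lam"
  proof (intro powr_mono2)
    have "1 = (real n + 1) * (1 / (real n + 1))" by simp
    also have "\<dots> \<le> (real n + 1) * ?m" using m(2) by (intro mult_left_mono) auto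
    finally have "1 \<le> (real n + 1) * ?m" .
    then have "1 * \<Delta> \<le> ((real n + 1) * ?m) * \<Delta>" using \<Delta> by (rule mult_right_mono)
    moreover have "min z (1 - z) \<le> ?m + \<Delta>" using zx by (auto simp: min_def abs_le_iff)
    ultimately have "min z (1 - z) \<le> (1 + (real n + 1) * \<Delta>) * ?m" by (simp add: algebra_simps)
    then show "min z (1 - z) / ?m \<le> 1 + (real n + 1) * \<Delta>" using m by (simp add: pos_divide_le_eq)
  qed (use lam mz m in auto)
  finally have ratio: "?m powr (-lam) * min z (1 - z) powr lam \<le> (1 + (real n + 1) * \<Delta>) powr lam" .
  have "err k x \<le> 2 * E * min z (1 - z) powr lam + 2 * B * sqrt \<bar>z - x\<bar>"
    by (rule err_at_threshold[OF k _ _ _ _ G]) (use z x in auto)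
  then have "?m powr (-lam) * err k x
      \<le> ?m powr (-lam) * (2 * E * min z (1 - z) powr lam + 2 * B * sqrt \<bar>z - x\<bar>)"
    by (intro mult_left_mono) auto
  also have "\<dots> = 2 * E * (?m powr (-lam) * min z (1 - z) powr lam) + 2 * B * (?m powr (-lam) * sqrt \<bar>z - x\<bar>)"
    by (simp add: algebra_simps)
  also have "\<dots> \<le> 2 * E * (1 + (real n + 1) * \<Delta>) powr lam + 2 * B * ((real n + 1) powr lam * sqrt \<Delta>)"
    using ratio inv zx E B_nonneg by (intro add_mono mult_left_mono mult_mono) auto
  finally have "?m powr (-lam) * err k x
      \<le> 2 * E * (1 + (real n + 1) * \<Delta>) powr lam + 2 * B * (real n + 1) powr lam * sqrt \<Delta>" by (simp add: mult_ac)
  moreover have "0 \<le> 2 * B * (real n + 1) powr (lam - 1/2)" using B_nonneg by simp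
  ultimately show ?thesis by linarith
qed

text \<open>For negative exponents the approximation is weak near the endpoints, so if the threshold
  is much closer to an endpoint than \<open>x\<close>, monotonicity of the counting function is used instead.\<close>

lemma Ghat_left_centered_le_of_escape:
  fixes x :: real
  defines "m \<equiv> min x (1 - x)"
  assumes k: "k \<le> n" and x: "0 < x" "x < 1" and lam: "lam < 0"
    and z: "0 < z" "z < v" "v < 1" "v \<le> 3 / 2 * z"
    and cz: "ecount X n z < (real n + 1) * x" and cv: "(real n + 1) * x \<le> ecount X n v"
    and G: "\<And>k. k \<le> n \<Longrightarrow> Ghat_left X n k x = ecount X k z"
    and esc: "min z (1 - z) < m / 3"
  defines "Q \<equiv> 2 + 2 * B * sqrt m + 2 * 2 powr (-lam) * E * m powr lam"
  shows "\<bar>Ghat_left X n k x - real k / real n * Ghat_left X n n x\<bar> \<le> Q + 1" "real n * m \<le> Q"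
proof -
  have m: "m > 0" "m \<le> x" "m \<le> 1 - x" "m \<le> 1 / 2" using x by (auto simp: m_def min_def)
  have q: "0 \<le> real k / real n" "real k / real n \<le> 1" using k n by (auto simp: field_simps)
  have ctr: "\<bar>a - real k / real n * b\<bar> \<le> b" if "0 \<le> a" "a \<le> b" for a b :: real
  proof -
    have "0 \<le> real k / real n * b" "real k / real n * b \<le> 1 * b"
      using mult_right_mono[OF q(1), of b] mult_right_mono[OF q(2), of b] that by simp_all
    then show ?thesis using that by linarith
  qed
  \<comment> \<open>The test points m/2 and 1 - m/2 are at distance m/2 from an endpoint, so the
    approximation error there is of order m^lam, whereas at z it cannot be controlled by m.\<close>
  have at_w: "\<bar>ecount X n w - real n * w\<bar> \<le> Q / 2 - 1" if w: "w = m / 2 \<or> w = 1 - m / 2" for w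
  proof -
    have w': "0 < w" "w < 1" "min w (1 - w) = m / 2" using w m by auto
    have "\<bar>J w * S n\<bar> \<le> sqrt m * B"
    proof -
      have "sqrt (m / 2) * B \<le> sqrt m * B" using m B_nonneg by (intro mult_right_mono) auto
      then show ?thesis using J_mult_S_le[of w n] w' by simp
    qed
    moreover have "\<bar>ecount X n w - real n * w - J w * S n\<bar> \<le> E * (m / 2) powr lam"
      using approx[of n w] w' by simp
    moreover have "(m / 2) powr lam = 2 powr (-lam) * m powr lam"
      using m by (simp add: powr_divide powr_minus field_simps)
    ultimately have "\<bar>ecount X n w - real n * w\<bar> \<le> sqrt m * B + E * (2 powr (-lam) * m powr lam)" by simp
    then show ?thesis by (simp add: Q_def algebra_simps)
  qed
  have "\<bar>Ghat_left X n k x - real k / real n * Ghat_left X n n x\<bar> \<le> Q + 1 \<and> real n * m \<le> Q"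
  proof (cases "z < m / 3")
    case True
    \<comment> \<open>The count at m/2 is already at least (n+1) x, although its centre is only n
      m/2 <= n x/2. The excess must be error, so n x <= Q, and the centred count is at most the full
      count at z, which is below (n+1) x.\<close>
    then have "v \<le> m / 2" using z by simp
    then have "(real n + 1) * x \<le> ecount X n (m / 2)" using cv ecount_mono[of v "m / 2" X n] by linarith
    then have "(real n + 1) * x \<le> real n * (m / 2) + (Q / 2 - 1)" using at_w[of "m / 2"] by auto
    moreover have "real n * (m / 2) \<le> real n * (x / 2)" using m by (intro mult_left_mono) auto
    ultimately have nx: "real n * x \<le> Q" using x by (simp add: algebra_simps)
    moreover have "real n * m \<le> real n * x" using m by (intro mult_left_mono) auto
    moreover have "\<bar>ecount X k z - real k / real n * ecount X n z\<bar> \<le> ecount X n z"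
      by (intro ctr ecount_bounds ecount_mono_length k)
    ultimately show ?thesis using G[OF k] G[OF order_refl] cz x by (simp add: algebra_simps)
  next
    case False
    \<comment> \<open>The mirror image near 1: observations above z are counted instead, since
      centring complements only changes the sign.\<close>
    then have "1 - z < m / 3" using esc unfolding min_less_iff_disj by blast
    then have "1 - m / 2 < z" using m(1) by linarith
    then have mono: "ecount X n (1 - m / 2) \<le> ecount X n z" by (intro ecount_mono) auto
    have w: "real n * (1 - m / 2) - (Q / 2 - 1) \<le> ecount X n (1 - m / 2)" using at_w[of "1 - m / 2"] by auto
    have mx: "real n * (m / 2) \<le> real n * ((1 - x) / 2)" using m by (intro mult_left_mono) auto
    have nx: "real n * (1 - x) \<le> Q" using mono w mx cz x by (simp add: algebra_simps)
    moreover have "real n * m \<le> real n * (1 - x)" using m by (intro mult_left_mono) auto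
    moreover have "\<bar>ecount X k z - real k / real n * ecount X n z\<bar> \<le> real n - ecount X n z"
    proof -
      have "\<bar>(real k - ecount X k z) - real k / real n * (real n - ecount X n z)\<bar> \<le> real n - ecount X n z"
        by (intro ctr ecount_mono_length k) (use ecount_bounds[of X k z] in simp)
      moreover have "(real k - ecount X k z) - real k / real n * (real n - ecount X n z)
          = - (ecount X k z - real k / real n * ecount X n z)" using n by (simp add: field_simps)
      ultimately show ?thesis by (metis abs_minus_cancel)
    qed
    ultimately show ?thesis using G[OF k] G[OF order_refl] mono w mx by (simp add: algebra_simps)
  qed
  then show "\<bar>Ghat_left X n k x - real k / real n * Ghat_left X n n x\<bar> \<le> Q + 1" "real n * m \<le> Q" by auto
qed

text \<open>One summand for each case: x in the extreme range, z at distance at least m/3 from the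
  endpoints, and z closer than that. Throughout, m^(-lam) <= 1 and it cancels m^lam.\<close>

lemma err_le_neg:
  assumes lam: "lam < 0" and k: "k \<le> n" and x: "0 < x" "x < 1"
  shows "min x (1 - x) powr (-lam) * err k x \<le> 2 * B * (real n + 1) powr (lam - 1/2)
    + (2 * 3 powr (-lam) * E + 2 * B * sqrt ((2 + B + 2 * 3 powr (-lam) * E) / real n))
    + (3 + 2 * 2 powr (-lam) * E
        + 4 * B * ((2 + 2 * B + 2 * 2 powr (-lam) * E) / real n) powr (1 / (2 * (1 - lam))))"
    (is "_ \<le> ?b1 + ?b2 + ?b3")
proof -
  let ?m = "min x (1 - x)"
  have nn: "0 \<le> ?b1" "0 \<le> ?b2" "0 \<le> ?b3" using E B_nonneg by auto
  have m: "0 < ?m" "?m \<le> 1" using x by auto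
  have one: "?m powr (-lam) * ?m powr lam = 1"
    using m(1) by (metis add.left_inverse powr_add powr_zero_eq_one less_irrefl)
  have m\<mu>: "?m powr (-lam) \<le> 1" using m lam by (intro powr_le1) auto
  consider "?m < 1 / (real n + 1)" | "1 / (real n + 1) \<le> ?m" by linarith
  then show ?thesis
  proof cases
    case 1
    then show ?thesis using err_extreme[OF k x 1] lam nn by linarith
  next
    case 2
    from Ghat_left_eq_ecount_below[where lam = lam, OF n X01 x 2]
    obtain z v where z: "0 < z" "z < v" "v < 1" "v - z \<le> 1 / real n" "v \<le> 3 / 2 * z"
      "min v (1 - v) powr lam \<le> 2 * min z (1 - z) powr lam"
      "ecount X n z < (real n + 1) * x" "(real n + 1) * x \<le> ecount X n v"
      and G: "\<forall>k\<le>n. Ghat_left X n k x = ecount X k z"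
      by (elim exE conjE)
    note G = G[rule_format]
    let ?mz = "min z (1 - z)"
    have mz: "?mz > 0" using z by simp
    show ?thesis
    proof (cases "?m / 3 \<le> ?mz")
      case True
      have "?mz powr lam \<le> (?m / 3) powr lam" using True m lam by (intro powr_mono2') auto
      also have "\<dots> = 3 powr (-lam) * ?m powr lam" using m by (simp add: powr_divide powr_minus field_simps)
      finally have "?m powr (-lam) * ?mz powr lam \<le> ?m powr (-lam) * (3 powr (-lam) * ?m powr lam)"
        by (intro mult_left_mono) auto
      also have "\<dots> = 3 powr (-lam)" using one by (metis mult.left_commute mult_1_right)
      finally have ratio: "?m powr (-lam) * ?mz powr lam \<le> 3 powr (-lam)" .
      have "?m powr (-lam) * sqrt \<bar>z - x\<bar> \<le> sqrt ((2 + B + 2 * 3 powr (-lam) * E) / real n)"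
      proof -
        have "?m powr (-lam) * sqrt \<bar>z - x\<bar> = sqrt ((?m powr (-lam))\<^sup>2 * \<bar>z - x\<bar>)"
          by (simp add: real_sqrt_mult)
        also have "\<dots> \<le> sqrt ((2 + B + 2 * 3 powr (-lam) * E) / real n)"
        \<comment> \<open>Of the two factors m^(-lam) produced by moving the weight under the root,
          one is bounded by 1 and the other cancels the growth of
          \<open>min z (1 - z) powr lam\<close>.\<close>
        proof (rule real_sqrt_le_mono)
          have "(?m powr (-lam))\<^sup>2 * \<bar>z - x\<bar> \<le> ?m powr (-lam) * \<bar>z - x\<bar>"
            using m\<mu> by (intro mult_right_mono) (auto simp: power2_eq_square mult_left_le)
          also have "\<dots> \<le> ?m powr (-lam) * ((2 + B + 2 * E * ?mz powr lam) / real n)"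
            using threshold_close[OF z(1-4) x z(6-8)] by (intro mult_left_mono) auto
          also have "\<dots> = (?m powr (-lam) * (2 + B) + 2 * E * (?m powr (-lam) * ?mz powr lam)) / real n"
            by (simp add: algebra_simps)
          also have "\<dots> \<le> (1 * (2 + B) + 2 * E * 3 powr (-lam)) / real n"
            using m\<mu> ratio E B_nonneg by (intro divide_right_mono add_mono mult_left_mono mult_right_mono) auto
          finally show "(?m powr (-lam))\<^sup>2 * \<bar>z - x\<bar> \<le> (2 + B + 2 * 3 powr (-lam) * E) / real n"
            by (simp add: mult_ac)
        qed
        finally show ?thesis .
      qed
      moreover have "err k x \<le> 2 * E * ?mz powr lam + 2 * B * sqrt \<bar>z - x\<bar>"
        by (rule err_at_threshold[OF k _ _ _ _ G]) (use z x in auto)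
      then have "?m powr (-lam) * err k x \<le> ?m powr (-lam) * (2 * E * ?mz powr lam + 2 * B * sqrt \<bar>z - x\<bar>)"
        by (intro mult_left_mono) auto
      then have "?m powr (-lam) * err k x
          \<le> 2 * E * (?m powr (-lam) * ?mz powr lam) + 2 * B * (?m powr (-lam) * sqrt \<bar>z - x\<bar>)"
        by (simp add: algebra_simps)
      moreover have "2 * E * (?m powr (-lam) * ?mz powr lam) \<le> 2 * E * 3 powr (-lam)"
        using ratio E by (intro mult_left_mono) auto
      ultimately have "?m powr (-lam) * err k x \<le> 2 * E * 3 powr (-lam) + 2 * B * sqrt ((2 + B + 2 * 3 powr (-lam) * E) / real n)"
        using B_nonneg mult_left_mono[of "?m powr (-lam) * sqrt \<bar>z - x\<bar>" _ "2 * B"] by (smt (verit))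
      then show ?thesis using nn by (simp add: mult_ac)
    next
      case False
      define Q where "Q = 2 + 2 * B * sqrt ?m + 2 * 2 powr (-lam) * E * ?m powr lam"
      define Z where "Z = 2 + 2 * B + 2 * 2 powr (-lam) * E"
      have Q: "\<bar>Ghat_left X n k x - real k / real n * Ghat_left X n n x\<bar> \<le> Q + 1" "real n * ?m \<le> Q"
        unfolding Q_def
        by (rule Ghat_left_centered_le_of_escape[OF k x lam z(1-3,5,7,8) G], assumption, use False in linarith)+
      have mQ: "?m powr (-lam) * Q \<le> 2 + 2 * B * sqrt ?m + 2 * 2 powr (-lam) * E"
      proof -
        have "?m powr (-lam) * Q = ?m powr (-lam) * (2 + 2 * B * sqrt ?m) + 2 * 2 powr (-lam) * E * (?m powr (-lam) * ?m powr lam)"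
          by (simp add: Q_def algebra_simps)
        also note one
        also have "?m powr (-lam) * (2 + 2 * B * sqrt ?m) \<le> 1 * (2 + 2 * B * sqrt ?m)"
          using m\<mu> B_nonneg m by (intro mult_right_mono) auto
        finally show ?thesis by simp
      qed
      \<comment> \<open>Escape is possible only for small m: n m <= Q and m^(-lam) Q <= Z give
        m^(1-lam) <= Z/n, which makes the term B sqrt m of smaller order than d_n.\<close>
      have sqrt_le: "sqrt ?m \<le> (Z / real n) powr (1 / (2 * (1 - lam)))"
      proof -
        have "?m powr (1 - lam) = ?m powr (-lam) * ?m"
          using m(1) powr_add[of ?m "-lam" 1] by (simp add: less_imp_le)
        then have "real n * ?m powr (1 - lam) = ?m powr (-lam) * (real n * ?m)"
          by (metis mult.left_commute)
        also have "\<dots> \<le> ?m powr (-lam) * Q" using Q by (intro mult_left_mono) auto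
        also have "\<dots> \<le> Z"
        proof -
          have "2 * B * sqrt ?m \<le> 2 * B * 1" using m B_nonneg by (intro mult_left_mono) auto
          then show ?thesis using mQ by (simp add: Z_def)
        qed
        finally have "?m powr (1 - lam) \<le> Z / real n" using n by (simp add: pos_le_divide_eq mult_ac)
        then have "(?m powr (1 - lam)) powr (1 / (2 * (1 - lam))) \<le> (Z / real n) powr (1 / (2 * (1 - lam)))"
          using lam by (intro powr_mono2) auto
        moreover have "(?m powr (1 - lam)) powr (1 / (2 * (1 - lam))) = sqrt ?m"
        proof -
          have "(1 - lam) * (1 / (2 * (1 - lam))) = 1 / 2" using lam by (simp add: field_simps)
          then show ?thesis unfolding powr_powr using m(1) by (simp only: powr_half_sqrt less_imp_le)
        qed
        ultimately show ?thesis by simp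
      qed
      have "err k x \<le> Q + 1 + 2 * B * sqrt ?m"
        using err_le_centered[of k x] k x Q by simp
      then have "?m powr (-lam) * err k x \<le> ?m powr (-lam) * (Q + 1 + 2 * B * sqrt ?m)"
        by (intro mult_left_mono) auto
      also have "\<dots> = ?m powr (-lam) * Q + ?m powr (-lam) * (1 + 2 * B * sqrt ?m)" by (simp add: algebra_simps)
      also have "?m powr (-lam) * (1 + 2 * B * sqrt ?m) \<le> 1 * (1 + 2 * B * sqrt ?m)"
        using m\<mu> B_nonneg m by (intro mult_right_mono) auto
      finally have "?m powr (-lam) * err k x \<le> 3 + 2 * 2 powr (-lam) * E + 4 * B * sqrt ?m"
        using mQ by simp
      also have "\<dots> \<le> ?b3" using sqrt_le B_nonneg unfolding Z_def by (intro add_left_mono mult_left_mono) auto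
      finally show ?thesis using nn by linarith
    qed
  qed
qed

end

section \<open>Hermite sums of a stationary Gaussian sequence\<close>

text \<open>The r-th power of \<gamma> is regularly varying of index -D r, and D r < 1 leaves room
  for a doubling exponent b with D r < b < 1; the resulting kappa is 2 - b > 1.\<close>

lemma regularly_varying_power_double_sum_growth:
  fixes \<gamma> :: "nat \<Rightarrow> real" and V :: "nat \<Rightarrow> real" and D c :: real
  assumes L: "slowly_varying L" and \<gamma>: "\<gamma> \<sim>[sequentially] (\<lambda>k. real k powr (- D) * L (real k))"
    and D: "0 < D" "D < 1" and r: "r \<ge> 1" "D * real r < 1" and c: "c > 0"
    and V: "\<And>n. V n = (\<Sum>i=1..n. \<Sum>j=1..n. c * \<gamma> ((i - j) + (j - i)) ^ r)"
  shows "\<exists>\<kappa>>1. \<exists>B N. \<forall>n\<ge>N. V n > 0 \<and> (\<forall>m. 1 \<le> m \<longrightarrow> m \<le> n \<longrightarrow> V m \<le> B * (real m / real n) powr \<kappa> * V n)"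
    and "(\<lambda>n. V n / real n ^ 2) \<longlonglongrightarrow> 0"
proof -
  define g where "g k = real k powr (- D) * L (real k)" for k :: nat
  obtain C0 x0 where C0: "C0 \<ge> 1" "x0 > 0" and Lpos: "\<And>x. x \<ge> x0 \<Longrightarrow> L x > 0"
    and Lcomp: "\<And>x y. x \<ge> x0 \<Longrightarrow> x \<le> y \<Longrightarrow> y \<le> 2 * x \<Longrightarrow> L y \<le> C0 * L x \<and> L x \<le> C0 * L y"
    using slowly_varying_locally_comparable[OF L] by blast
  define K0 where "K0 = nat \<lceil>x0\<rceil> + 1"
  have K0: "real k \<ge> x0" "k \<ge> 1" if "k \<ge> K0" for k
  proof -
    show "real k \<ge> x0" using real_nat_ceiling_ge[of x0] that by (simp add: K0_def)
    show "k \<ge> 1" using that by (simp add: K0_def)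
  qed
  have gpos: "g k > 0" if "k \<ge> K0" for k using Lpos[OF K0(1)[OF that]] K0(2)[OF that] by (simp add: g_def)
  have gcomp: "g j \<le> 2 * C0 * g k \<and> g k \<le> 2 * C0 * g j" if "k \<ge> K0" "k \<le> j" "j \<le> 2 * k" for k j
  proof
    have k: "real k \<ge> x0" "k \<ge> 1" using K0 that by auto
    have Lkj: "L (real j) \<le> C0 * L (real k)" "L (real k) \<le> C0 * L (real j)" "L (real k) > 0" "L (real j) > 0"
      using Lcomp[of "real k" "real j"] Lpos k that by auto
    have p1: "real j powr (-D) \<le> 2 * real k powr (-D)"
    proof -
      have "real j powr (-D) \<le> real k powr (-D)" using that k D by (intro powr_mono2') auto
      then show ?thesis by (smt (verit) powr_ge_zero)
    qed
    have p2: "real k powr (-D) \<le> 2 * real j powr (-D)"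
    proof -
      have "(2 * real k) powr (-D) \<le> real j powr (-D)" using that k D by (intro powr_mono2') auto
      then have "2 powr (-D) * real k powr (-D) \<le> real j powr (-D)" by (simp add: powr_mult)
      moreover have "(1 / 2) * real k powr (-D) \<le> 2 powr (-D) * real k powr (-D)"
        using D powr_mono[of "-1" "-D" 2] by (intro mult_right_mono) (auto simp: powr_minus)
      ultimately show ?thesis by linarith
    qed
    have "g j \<le> (2 * real k powr (-D)) * (C0 * L (real k))"
      unfolding g_def using p1 Lkj by (intro mult_mono) auto
    then show "g j \<le> 2 * C0 * g k" by (simp add: g_def mult_ac)
    have "g k \<le> (2 * real j powr (-D)) * (C0 * L (real j))"
      unfolding g_def using p2 Lkj by (intro mult_mono) auto
    then show "g k \<le> 2 * C0 * g j" by (simp add: g_def mult_ac)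
  qed
  have ratio: "(\<lambda>k. \<gamma> k / g k) \<longlonglongrightarrow> 1"
  proof (rule asymp_equivD_strong)
    show "\<gamma> \<sim>[sequentially] g" using \<gamma> unfolding g_def .
    show "eventually (\<lambda>k. \<gamma> k \<noteq> 0 \<or> g k \<noteq> 0) sequentially"
      unfolding eventually_sequentially using gpos by (metis less_irrefl)
  qed
  then have "eventually (\<lambda>k. 1 / 2 < \<gamma> k / g k \<and> \<gamma> k / g k < 2) sequentially"
    by (intro eventually_conj order_tendstoD[OF ratio]) auto
  then obtain K1 where K1: "\<And>k. k \<ge> K1 \<Longrightarrow> 1 / 2 < \<gamma> k / g k \<and> \<gamma> k / g k < 2"
    by (auto simp: eventually_sequentially)
  have \<gamma>g: "g k / 2 \<le> \<gamma> k" "\<gamma> k \<le> 2 * g k" "\<gamma> k > 0" if "k \<ge> max K0 K1" for k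
    using K1[of k] gpos[of k] that by (auto simp: field_simps)
  have "(\<lambda>k. \<gamma> (2 * k) / \<gamma> k) \<longlonglongrightarrow> 2 powr (-D)"
  proof -
    have sub: "filterlim (\<lambda>k::nat. 2 * k) at_top sequentially"
      by (rule filterlim_subseq) (simp add: strict_mono_def)
    have "(\<lambda>k. \<gamma> (2 * k) / g (2 * k)) \<longlonglongrightarrow> 1" by (rule filterlim_compose[OF ratio sub])
    moreover have "(\<lambda>k. L (2 * real k) / L (real k)) \<longlonglongrightarrow> 1"
      using L filterlim_compose[OF _ filterlim_real_sequentially, of "\<lambda>x. L (2 * x) / L x" "nhds 1"]
      by (auto simp: slowly_varying_def)
    ultimately have "(\<lambda>k. (\<gamma> (2 * k) / g (2 * k)) * (2 powr (-D) * (L (2 * real k) / L (real k))) / (\<gamma> k / g k))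
        \<longlonglongrightarrow> 1 * (2 powr (-D) * 1) / 1"
      using ratio by (intro tendsto_intros) auto
    moreover have "eventually (\<lambda>k. (\<gamma> (2 * k) / g (2 * k)) * (2 powr (-D) * (L (2 * real k) / L (real k))) / (\<gamma> k / g k)
        = \<gamma> (2 * k) / \<gamma> k) sequentially"
      unfolding eventually_sequentially
    proof (intro exI allI impI)
      fix k assume k: "max K0 K1 \<le> k"
      have "g (2 * k) > 0" "g k > 0" "\<gamma> k > 0" using k gpos \<gamma>g(3)[OF k] by auto
      moreover have "2 powr (-D) * (L (2 * real k) / L (real k)) = g (2 * k) / g k"
        using K0(2)[of k] k by (simp add: g_def powr_mult)
      ultimately show "(\<gamma> (2 * k) / g (2 * k)) * (2 powr (-D) * (L (2 * real k) / L (real k))) / (\<gamma> k / g k)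
        = \<gamma> (2 * k) / \<gamma> k" by simp
    qed
    ultimately show ?thesis by (simp add: tendsto_cong)
  qed
  then have "(\<lambda>k. (\<gamma> (2 * k) / \<gamma> k) ^ r) \<longlonglongrightarrow> (2 powr (-D)) ^ r" by (rule tendsto_power)
  also have "(2 powr (-D)) ^ r = 2 powr (- (D * real r))"
    by (simp add: powr_powr flip: powr_realpow)
  finally have lim: "(\<lambda>k. (\<gamma> (2 * k) / \<gamma> k) ^ r) \<longlonglongrightarrow> 2 powr (- (D * real r))" .
  \<comment> \<open>Strict bounds around D r, so that the limit 2^(-D r) of the doubling ratio lies
    strictly between 2^(-b) and 2^(-a).\<close>
  define b where "b = (1 + D * real r) / 2"
  define a where "a = D * real r / 2"
  have Dr: "D * real r > 0" using D r by simp
  have ab: "a > 0" "0 < b" "b < 1" "a < D * real r" "D * real r < b"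
    using Dr r by (auto simp: a_def b_def)
  have "eventually (\<lambda>k. 2 powr (-b) < (\<gamma> (2 * k) / \<gamma> k) ^ r \<and> (\<gamma> (2 * k) / \<gamma> k) ^ r < 2 powr (-a)) sequentially"
    using ab by (intro eventually_conj order_tendstoD[OF lim]) auto
  then obtain K2 where K2: "\<And>k. k \<ge> K2 \<Longrightarrow> 2 powr (-b) < (\<gamma> (2 * k) / \<gamma> k) ^ r \<and> (\<gamma> (2 * k) / \<gamma> k) ^ r < 2 powr (-a)"
    by (auto simp: eventually_sequentially)
  define K where "K = max (max K0 K1) K2 + 1"
  \<comment> \<open>A factor 2 for passing from \<gamma> to g, 2 C0 for comparing g at two lags, and
    2 for returning to \<gamma>.\<close>
  define C where "C = (8 * C0) ^ r"
  define \<rho> where "\<rho> k = c * \<gamma> k ^ r" for k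
  have \<rho>pos: "\<rho> k > 0" if "k \<ge> K" for k
  proof -
    have "k \<ge> max K0 K1" using that by (auto simp: K_def)
    then show ?thesis using \<gamma>g(3)[of k] c by (simp add: \<rho>_def)
  qed
  have \<rho>comp: "\<rho> k \<le> C * \<rho> j \<and> \<rho> j \<le> C * \<rho> k" if kj: "k \<ge> K" "k \<le> j" "j \<le> 2 * k" for k j
  proof -
    have k: "k \<ge> max K0 K1" and j: "j \<ge> max K0 K1" using kj by (auto simp: K_def)
    have "2 * C0 * g j \<le> 2 * C0 * (2 * \<gamma> j)" "2 * C0 * g k \<le> 2 * C0 * (2 * \<gamma> k)"
      using \<gamma>g(1)[OF j] \<gamma>g(1)[OF k] C0 by (auto intro!: mult_left_mono)
    moreover have "g j \<le> 2 * C0 * g k \<and> g k \<le> 2 * C0 * g j" using gcomp kj k by auto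
    ultimately have "\<gamma> k \<le> 8 * C0 * \<gamma> j" "\<gamma> j \<le> 8 * C0 * \<gamma> k"
      using \<gamma>g(2)[OF k] \<gamma>g(2)[OF j] by linarith+
    then have "\<gamma> k ^ r \<le> (8 * C0 * \<gamma> j) ^ r" "\<gamma> j ^ r \<le> (8 * C0 * \<gamma> k) ^ r"
      using \<gamma>g(3)[OF k] \<gamma>g(3)[OF j] by (auto intro!: power_mono)
    then have "c * \<gamma> k ^ r \<le> c * (C * \<gamma> j ^ r)" "c * \<gamma> j ^ r \<le> c * (C * \<gamma> k ^ r)"
      using c by (auto simp: C_def power_mult_distrib)
    then show ?thesis by (simp add: \<rho>_def mult_ac)
  qed
  have double: "\<rho> k \<le> 2 powr b * \<rho> (2 * k)" and halve: "2 powr a * \<rho> (2 * k) \<le> \<rho> k" if "k \<ge> K" for k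
  proof -
    have "\<rho> (2 * k) / \<rho> k = (\<gamma> (2 * k) / \<gamma> k) ^ r" using c by (simp add: \<rho>_def power_divide)
    then have "2 powr (-b) \<le> \<rho> (2 * k) / \<rho> k" "\<rho> (2 * k) / \<rho> k \<le> 2 powr (-a)"
    proof -
      have "k \<ge> K2" using that by (auto simp: K_def)
      from K2[OF this] show "2 powr (-b) \<le> \<rho> (2 * k) / \<rho> k" "\<rho> (2 * k) / \<rho> k \<le> 2 powr (-a)"
        unfolding \<open>\<rho> (2 * k) / \<rho> k = (\<gamma> (2 * k) / \<gamma> k) ^ r\<close> by auto
    qed
    then show "\<rho> k \<le> 2 powr b * \<rho> (2 * k)" "2 powr a * \<rho> (2 * k) \<le> \<rho> k"
      using \<rho>pos[OF that] by (auto simp: powr_minus field_simps)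
  qed
  have K: "K \<ge> 1" by (simp add: K_def)
  have C: "C \<ge> 1" unfolding C_def using C0 by (intro one_le_power) auto
  have V': "\<And>n. V n = (\<Sum>i=1..n. \<Sum>j=1..n. \<rho> ((i - j) + (j - i)))" unfolding V \<rho>_def ..
  note growth = stationary_double_sum_growth[of K \<rho> C b a V, OF K \<rho>pos \<rho>comp double halve C ab(1-3) V']
  show "\<exists>\<kappa>>1. \<exists>B N. \<forall>n\<ge>N. V n > 0 \<and> (\<forall>m. 1 \<le> m \<longrightarrow> m \<le> n \<longrightarrow> V m \<le> B * (real m / real n) powr \<kappa> * V n)"
    using growth(1) ab by (intro exI[of _ "2 - b"]) auto
  show "(\<lambda>n. V n / real n ^ 2) \<longlonglongrightarrow> 0" by (rule growth(2))
qed

locale stationary_gaussian = prob_space +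
  fixes \<xi> :: "nat \<Rightarrow> 'a \<Rightarrow> real"
  assumes meas [measurable]: "\<And>i. \<xi> i \<in> borel_measurable M"
    and gauss: "gaussian_seq M \<xi>" and stat: "stationary_seq M \<xi>"
    and mean0: "expectation (\<xi> 1) = 0" and var1: "var M (\<xi> 1) = 1"
begin

lemma expectation_shift:
  assumes "finite I" "I \<subseteq> {1..}" "g \<in> borel_measurable (PiM I (\<lambda>_. borel))"
  shows "expectation (\<lambda>\<omega>. g (\<lambda>i\<in>I. \<xi> (i + h) \<omega>)) = (expectation (\<lambda>\<omega>. g (\<lambda>i\<in>I. \<xi> i \<omega>)) :: real)"
proof -
  have [measurable]: "(\<lambda>\<omega>. \<lambda>i\<in>I. \<xi> (i + h) \<omega>) \<in> measurable M (PiM I (\<lambda>_. borel))" for h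
    by (intro measurable_restrict) auto
  from this[of 0] have m0: "(\<lambda>\<omega>. \<lambda>i\<in>I. \<xi> i \<omega>) \<in> measurable M (PiM I (\<lambda>_. borel))" by simp
  have "expectation (\<lambda>\<omega>. g (\<lambda>i\<in>I. \<xi> (i + h) \<omega>)) = integral\<^sup>L (distr M (PiM I (\<lambda>_. borel)) (\<lambda>\<omega>. \<lambda>i\<in>I. \<xi> (i + h) \<omega>)) g"
    using assms(3) by (subst integral_distr) auto
  also have "\<dots> = integral\<^sup>L (distr M (PiM I (\<lambda>_. borel)) (\<lambda>\<omega>. \<lambda>i\<in>I. \<xi> i \<omega>)) g"
    using stat assms(1,2) unfolding stationary_seq_def by metis
  also have "\<dots> = expectation (\<lambda>\<omega>. g (\<lambda>i\<in>I. \<xi> i \<omega>))"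
    using assms(3) m0 by (subst integral_distr) auto
  finally show ?thesis .
qed

lemma expectation_marginal:
  assumes "i \<ge> 1" and [measurable]: "f \<in> borel_measurable borel"
  shows "expectation (\<lambda>\<omega>. f (\<xi> i \<omega>)) = (expectation (\<lambda>\<omega>. f (\<xi> 1 \<omega>)) :: real)"
  using expectation_shift[of "{1}" "\<lambda>y. f (y 1)" "i - 1"] assms(1)
  by (simp add: measurable_compose[OF measurable_component_singleton])

lemma mean: "i \<ge> 1 \<Longrightarrow> expectation (\<xi> i) = 0"
  using expectation_marginal[of i "\<lambda>x. x"] mean0 by simp

abbreviation \<gamma> :: "nat \<Rightarrow> real" where "\<gamma> k \<equiv> covar M (\<xi> 1) (\<xi> (k + 1))"

lemma expectation_prod_le:
  assumes "1 \<le> i" "i \<le> j"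
  shows "expectation (\<lambda>\<omega>. \<xi> i \<omega> * \<xi> j \<omega>) = \<gamma> (j - i)"
proof -
  let ?I = "{1, j - i + 1}"
  have "(\<lambda>y. y 1 * y (j - i + 1)) \<in> borel_measurable (PiM ?I (\<lambda>_. borel :: real measure))"
    by (intro borel_measurable_times measurable_component_singleton) auto
  from expectation_shift[OF _ _ this, of "i - 1"]
  have "expectation (\<lambda>\<omega>. \<xi> i \<omega> * \<xi> j \<omega>) = expectation (\<lambda>\<omega>. \<xi> 1 \<omega> * \<xi> (j - i + 1) \<omega>)"
    using assms by simp
  then show ?thesis using mean[of 1] mean[of "j - i + 1"] by (simp add: covar_def)
qed

lemma expectation_prod:
  assumes "i \<ge> 1" "j \<ge> 1"
  shows "expectation (\<lambda>\<omega>. \<xi> i \<omega> * \<xi> j \<omega>) = \<gamma> ((i - j) + (j - i))"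
proof (cases "i \<le> j")
  case True
  then show ?thesis using expectation_prod_le[of i j] assms by simp
next
  case False
  then show ?thesis using expectation_prod_le[of j i] assms by (simp add: mult.commute)
qed

lemma gaussian_pair:
  assumes "i \<ge> 1" "j \<ge> 1"
  shows "standard_gaussian_pair M (\<xi> i) (\<xi> j) (\<gamma> ((i - j) + (j - i)))"
proof
  have G: "gaussian_rv M (\<lambda>\<omega>. \<Sum>i\<in>I. c i * \<xi> i \<omega>)" if "finite I" "I \<subseteq> {1..}" for I c
    using gauss that unfolding gaussian_seq_def by blast
  show "gaussian_rv M (\<xi> i)" "gaussian_rv M (\<xi> j)"
    using G[of "{i}" "\<lambda>_. 1"] G[of "{j}" "\<lambda>_. 1"] assms by simp_all
  show "gaussian_rv M (\<lambda>\<omega>. s * \<xi> i \<omega> + \<xi> j \<omega>)" for s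
  proof (cases "i = j")
    case True
    then show ?thesis using G[of "{i}" "\<lambda>_. s + 1"] assms by (simp add: algebra_simps)
  next
    case False
    then show ?thesis using G[of "{i, j}" "\<lambda>k. if k = i then s else 1"] assms by simp
  qed
  have sq: "expectation (\<lambda>\<omega>. \<xi> i \<omega> ^ 2) = 1" if "i \<ge> 1" for i
    using expectation_prod[of i i] that var1 by (simp add: var_def power2_eq_square)
  show "expectation (\<lambda>\<omega>. \<xi> i \<omega> ^ 2) = 1" "expectation (\<lambda>\<omega>. \<xi> j \<omega> ^ 2) = 1" using sq assms by auto
  show "expectation (\<xi> i) = 0" "expectation (\<xi> j) = 0" using mean assms by auto
  show "expectation (\<lambda>\<omega>. \<xi> i \<omega> * \<xi> j \<omega>) = \<gamma> ((i - j) + (j - i))" by (rule expectation_prod[OF assms])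
qed

section \<open>Second moments and maxima of Hermite sums\<close>

lemma hermite_measurable [measurable]: "hermite r \<in> borel_measurable borel"
proof -
  have "hermite r = poly (hermite_poly r)" by (simp add: fun_eq_iff hermite_eq_poly)
  then show ?thesis by (simp add: borel_measurable_continuous_onI continuous_on_poly)
qed

definition hsum :: "nat \<Rightarrow> nat \<Rightarrow> 'a \<Rightarrow> real" where
  "hsum r k \<omega> = (\<Sum>i=1..k. hermite r (\<xi> i \<omega>))"

text \<open>The second moment of every block of n consecutive Hermite terms; for r >= 1 it is
  d_{n,r}^2.\<close>

definition hvar :: "nat \<Rightarrow> nat \<Rightarrow> real" where
  "hvar r n = (\<Sum>i=1..n. \<Sum>j=1..n. fact r * \<gamma> ((i - j) + (j - i)) ^ r)"

lemma hsum_increment_second_moment: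
  "integrable M (\<lambda>\<omega>. (hsum r (k + m) \<omega> - hsum r k \<omega>)\<^sup>2)"
  "expectation (\<lambda>\<omega>. (hsum r (k + m) \<omega> - hsum r k \<omega>)\<^sup>2) = hvar r m"
proof -
  have "hsum r (k + m) \<omega> - hsum r k \<omega> = (\<Sum>i=1..m. hermite r (\<xi> (i + k) \<omega>))" for \<omega>
  proof -
    have "hsum r (k + m) \<omega> = hsum r k \<omega> + (\<Sum>i=k+1..k+m. hermite r (\<xi> i \<omega>))"
      unfolding hsum_def by (rule sum.ub_add_nat) simp
    also have "(\<Sum>i=k+1..k+m. hermite r (\<xi> i \<omega>)) = (\<Sum>i=1..m. hermite r (\<xi> (i + k) \<omega>))"
      using sum.shift_bounds_cl_nat_ivl[of "\<lambda>i. hermite r (\<xi> i \<omega>)" 1 k m] by (simp add: add.commute)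
    finally show ?thesis by simp
  qed
  then have sq: "(hsum r (k + m) \<omega> - hsum r k \<omega>)\<^sup>2
      = (\<Sum>i=1..m. \<Sum>j=1..m. hermite r (\<xi> (i + k) \<omega>) * hermite r (\<xi> (j + k) \<omega>))" for \<omega>
    by (simp only: power2_eq_square sum_product)
  have int: "integrable M (\<lambda>\<omega>. hermite r (\<xi> (i + k) \<omega>) * hermite r (\<xi> (j + k) \<omega>))" if "i \<in> {1..m}" "j \<in> {1..m}" for i j
    using that by (intro standard_gaussian_pair.integrable_hermite_hermite[OF gaussian_pair]) auto
  show "integrable M (\<lambda>\<omega>. (hsum r (k + m) \<omega> - hsum r k \<omega>)\<^sup>2)"
    unfolding sq by (intro Bochner_Integration.integrable_sum int)
  have "expectation (\<lambda>\<omega>. (hsum r (k + m) \<omega> - hsum r k \<omega>)\<^sup>2)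
      = (\<Sum>i=1..m. \<Sum>j=1..m. expectation (\<lambda>\<omega>. hermite r (\<xi> (i + k) \<omega>) * hermite r (\<xi> (j + k) \<omega>)))"
    unfolding sq
    by (subst Bochner_Integration.integral_sum, (rule Bochner_Integration.integrable_sum int)+, assumption+)
      (intro sum.cong refl Bochner_Integration.integral_sum int)
  also have "\<dots> = hvar r m"
    unfolding hvar_def
  proof (intro sum.cong refl)
    fix i j assume "i \<in> {1..m}" "j \<in> {1..m}"
    then show "expectation (\<lambda>\<omega>. hermite r (\<xi> (i + k) \<omega>) * hermite r (\<xi> (j + k) \<omega>)) = fact r * \<gamma> ((i - j) + (j - i)) ^ r"
      using standard_gaussian_pair.expectation_hermite_hermite[OF gaussian_pair, of "i + k" "j + k" r] by simp
  qed
  finally show "expectation (\<lambda>\<omega>. (hsum r (k + m) \<omega> - hsum r k \<omega>)\<^sup>2) = hvar r m" .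
qed

lemma hermite_moments:
  assumes "i \<ge> 1"
  shows "integrable M (\<lambda>\<omega>. hermite r (\<xi> i \<omega>))" "integrable M (\<lambda>\<omega>. (hermite r (\<xi> i \<omega>))\<^sup>2)"
    "expectation (\<lambda>\<omega>. (hermite r (\<xi> i \<omega>))\<^sup>2) = fact r"
    "r \<ge> 1 \<Longrightarrow> expectation (\<lambda>\<omega>. hermite r (\<xi> i \<omega>)) = 0"
proof -
  interpret P: standard_gaussian_pair M "\<xi> i" "\<xi> i" "\<gamma> ((i - i) + (i - i))" by (rule gaussian_pair[OF assms assms])
  show "integrable M (\<lambda>\<omega>. hermite r (\<xi> i \<omega>))"
    using P.integrable_poly_mult[of "hermite_poly r" 1] by (simp add: hermite_eq_poly)
  show "integrable M (\<lambda>\<omega>. (hermite r (\<xi> i \<omega>))\<^sup>2)"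
    using P.integrable_hermite_hermite by (simp add: power2_eq_square)
  show "expectation (\<lambda>\<omega>. (hermite r (\<xi> i \<omega>))\<^sup>2) = fact r"
    using P.expectation_hermite_hermite[of r] var1 by (simp add: power2_eq_square var_def)
  show "r \<ge> 1 \<Longrightarrow> expectation (\<lambda>\<omega>. hermite r (\<xi> i \<omega>)) = 0" by (rule P.expectation_hermite)
qed

lemma dnr_eq:
  assumes "r \<ge> 1"
  shows "dnr M \<xi> r n = sqrt (hvar r n)" and "hvar r n \<ge> 0"
proof -
  have "expectation (\<lambda>\<omega>. \<Sum>i=1..n. hermite r (\<xi> i \<omega>)) = 0"
    using hermite_moments(1,4)[OF _] assms by (subst Bochner_Integration.integral_sum) auto
  then have "var M (\<lambda>\<omega>. \<Sum>i=1..n. hermite r (\<xi> i \<omega>)) = expectation (\<lambda>\<omega>. (hsum r (0 + n) \<omega> - hsum r 0 \<omega>)\<^sup>2)"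
    by (simp add: var_def covar_def hsum_def power2_eq_square)
  then show "dnr M \<xi> r n = sqrt (hvar r n)"
    unfolding dnr_def hsum_increment_second_moment(2) by simp
  show "hvar r n \<ge> 0"
    unfolding hsum_increment_second_moment(2)[of r 0 n, symmetric] by (intro integral_nonneg_AE) auto
qed

text \<open>Block increments depend only on their length, so the growth of \<open>hvar\<close>
  supplies the increment hypothesis of \<open>maximal_second_moment\<close>. The variable R is a
  majorant valid at every outcome and for all k <= n at once.\<close>

lemma hsum_maximal:
  assumes L: "slowly_varying L" and \<gamma>: "\<gamma> \<sim>[sequentially] (\<lambda>k. real k powr (- D) * L (real k))"
    and D: "0 < D" "D < 1" and r: "r \<ge> 1" "D * real r < 1"
  shows "\<exists>C>0. \<exists>N. \<forall>n\<ge>N. dnr M \<xi> r n > 0 \<and> (\<exists>R. integrable M R \<and>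
      (\<forall>\<omega>. \<forall>k\<le>n. (hsum r k \<omega>)\<^sup>2 \<le> R \<omega>) \<and> expectation R \<le> C * (dnr M \<xi> r n)\<^sup>2)"
    and "(\<lambda>n. dnr M \<xi> r n / real n) \<longlonglongrightarrow> 0"
    and "filterlim (dnr M \<xi> r) at_top sequentially"
proof -
  note growth = regularly_varying_power_double_sum_growth[OF L \<gamma> D r, of "fact r" "hvar r", OF _ hvar_def]
  obtain \<kappa> B N where \<kappa>: "\<kappa> > 1" and
    N: "\<And>n. n \<ge> N \<Longrightarrow> hvar r n > 0"
      "\<And>n m. n \<ge> N \<Longrightarrow> 1 \<le> m \<Longrightarrow> m \<le> n \<Longrightarrow> hvar r m \<le> B * (real m / real n) powr \<kappa> * hvar r n"
    using growth(1) by auto metis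
  have B: "B \<ge> 1"
  proof -
    have "hvar r (Suc N) \<le> B * hvar r (Suc N)" using N(2)[of "Suc N" "Suc N"] by simp
    then show ?thesis using N(1)[of "Suc N"] by simp
  qed
  define C where "C = (2 powr ((\<kappa> - 1) / 2) / (2 powr ((\<kappa> - 1) / 2) - 1))\<^sup>2 * 2 powr \<kappa> * B"
  have "2 powr ((\<kappa> - 1) / 2) > (1::real)" using \<kappa> by (intro gr_one_powr) auto
  then have C: "C > 0"
    unfolding C_def using B by (intro mult_pos_pos zero_less_power divide_pos_pos) auto
  have "dnr M \<xi> r n > 0 \<and> (\<exists>R. integrable M R \<and>
      (\<forall>\<omega>. \<forall>k\<le>n. (hsum r k \<omega>)\<^sup>2 \<le> R \<omega>) \<and> expectation R \<le> C * (dnr M \<xi> r n)\<^sup>2)" if n: "n \<ge> max N 1" for n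
  proof (intro conjI)
    have pos: "hvar r n > 0" using N n by auto
    then show "dnr M \<xi> r n > 0" by (simp add: dnr_eq[OF r(1)])
    \<comment> \<open>Normalised so that the bound B (m/n)^kappa V(n) reads ?B m^kappa; the factor
      n^kappa in the maximal inequality then cancels and leaves a multiple of d_n^2.\<close>
    let ?B = "B * hvar r n / real n powr \<kappa>"
    have "\<exists>R. integrable M R \<and> (\<forall>\<omega>. \<forall>k\<le>n. (hsum r k \<omega>)\<^sup>2 \<le> R \<omega>) \<and>
      expectation R \<le> (2 powr ((\<kappa> - 1) / 2) / (2 powr ((\<kappa> - 1) / 2) - 1))\<^sup>2 * 2 powr \<kappa> * ?B * real n powr \<kappa>"
    proof (rule maximal_second_moment[OF \<kappa>])
      show "0 \<le> ?B" using B pos by simp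
      show "1 \<le> n" using n by simp
      show "hsum r 0 \<omega> = 0" for \<omega> by (simp add: hsum_def)
      show "integrable M (\<lambda>\<omega>. (hsum r (k + m) \<omega> - hsum r k \<omega>)\<^sup>2)" for k m
        by (rule hsum_increment_second_moment)
      show "expectation (\<lambda>\<omega>. (hsum r (k + m) \<omega> - hsum r k \<omega>)\<^sup>2) \<le> ?B * real m powr \<kappa>"
        if "1 \<le> m" "k + m \<le> n" for k m
        unfolding hsum_increment_second_moment using N(2)[of n m] n that by (simp add: powr_divide field_simps)
    qed
    moreover have "(2 powr ((\<kappa> - 1) / 2) / (2 powr ((\<kappa> - 1) / 2) - 1))\<^sup>2 * 2 powr \<kappa> * ?B * real n powr \<kappa>
      = C * (dnr M \<xi> r n)\<^sup>2"
      using n dnr_eq(2)[OF r(1)] unfolding C_def dnr_eq(1)[OF r(1)] by simp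
    ultimately show "\<exists>R. integrable M R \<and> (\<forall>\<omega>. \<forall>k\<le>n. (hsum r k \<omega>)\<^sup>2 \<le> R \<omega>) \<and> expectation R \<le> C * (dnr M \<xi> r n)\<^sup>2"
      by simp
  qed
  then show "\<exists>C>0. \<exists>N. \<forall>n\<ge>N. dnr M \<xi> r n > 0 \<and> (\<exists>R. integrable M R \<and>
      (\<forall>\<omega>. \<forall>k\<le>n. (hsum r k \<omega>)\<^sup>2 \<le> R \<omega>) \<and> expectation R \<le> C * (dnr M \<xi> r n)\<^sup>2)" using C by blast
  have "(\<lambda>n. sqrt (hvar r n / real n ^ 2)) \<longlonglongrightarrow> sqrt 0"
    by (intro tendsto_real_sqrt growth(2)) simp
  then show "(\<lambda>n. dnr M \<xi> r n / real n) \<longlonglongrightarrow> 0" by (simp add: dnr_eq(1)[OF r(1)] real_sqrt_divide)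
  show "filterlim (dnr M \<xi> r) at_top sequentially"
  proof (rule filterlim_at_top_mono)
    have lim: "filterlim (\<lambda>n. sqrt (1 / B) * sqrt (real n)) at_top sequentially"
      using B by (intro filterlim_tendsto_pos_mult_at_top[OF tendsto_const]
          filterlim_compose[OF sqrt_at_top filterlim_real_sequentially]) auto
    show "filterlim (\<lambda>n. sqrt (real n / B)) at_top sequentially"
      using lim by (simp add: real_sqrt_divide)
    show "eventually (\<lambda>n. sqrt (real n / B) \<le> dnr M \<xi> r n) sequentially"
      unfolding eventually_sequentially
    proof (intro exI allI impI)
      fix n assume n: "max N 1 \<le> n"
      \<comment> \<open>The growth bound at m = 1 is read backwards: V(1) >= 1 forces V(n) >=
        n^kappa / B >= n / B.\<close>
      have "hvar r 1 = fact r" using var1 by (simp add: hvar_def var_def)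
      then have "1 \<le> hvar r 1" by simp
      also have "\<dots> \<le> B * (1 / real n) powr \<kappa> * hvar r n" using N(2)[of n 1] n by simp
      also have "\<dots> \<le> B * (1 / real n) powr 1 * hvar r n"
        using n B \<kappa> N(1)[of n] by (intro mult_right_mono mult_left_mono powr_mono') (auto simp: less_imp_le)
      finally have "real n / B \<le> hvar r n" using n B by (simp add: field_simps)
      then show "sqrt (real n / B) \<le> dnr M \<xi> r n" by (simp add: dnr_eq(1)[OF r(1)])
    qed
  qed
qed

end

section \<open>The reduction to the deterministic comparison\<close>

lemma outer_prob_nonneg: "outer_prob M A \<ge> 0" if "A \<subseteq> space M"
  unfolding outer_prob_def by (rule cInf_greatest) (use that in auto)

lemma outer_prob_le:
  assumes "B \<in> sets M" "A \<subseteq> B"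
  shows "outer_prob M A \<le> measure M B"
  unfolding outer_prob_def using assms
  by (intro cInf_lower bdd_belowI[of _ 0]) auto

lemma outer_prob_lessE:
  assumes "outer_prob M A < e" "A \<subseteq> space M"
  obtains B where "B \<in> sets M" "A \<subseteq> B" "measure M B < e"
proof -
  have "measure M ` {B \<in> sets M. A \<subseteq> B} \<noteq> {}" using assms(2) by auto
  from cInf_lessD[OF this] show ?thesis using assms(1) that unfolding outer_prob_def by auto
qed

text \<open>E (t 1_A - f)^2 >= 0 is a quadratic in t, evaluated at its minimum e / P(A). If P(A) = 0
  it is affine, and nonnegativity for all t forces its slope to vanish.\<close>

lemma (in prob_space) indicator_Cauchy_Schwarz:
  fixes f :: "'a \<Rightarrow> real"
  assumes A[measurable]: "A \<in> events" and f: "integrable M f" "integrable M (\<lambda>\<omega>. (f \<omega>)\<^sup>2)"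
  shows "(expectation (\<lambda>\<omega>. indicator A \<omega> * f \<omega>))\<^sup>2 \<le> prob A * expectation (\<lambda>\<omega>. (f \<omega>)\<^sup>2)"
proof -
  let ?e = "expectation (\<lambda>\<omega>. indicator A \<omega> * f \<omega>)" and ?s = "expectation (\<lambda>\<omega>. (f \<omega>)\<^sup>2)"
  have int: "integrable M (\<lambda>\<omega>. indicator A \<omega> * f \<omega>)"
    using integrable_real_mult_indicator[OF A f(1)] by (simp add: mult.commute)
  have q: "0 \<le> t\<^sup>2 * prob A - 2 * t * ?e + ?s" for t
  proof -
    have "0 \<le> expectation (\<lambda>\<omega>. (t * indicator A \<omega> - f \<omega>)\<^sup>2)" by (intro integral_nonneg_AE) auto
    also have "(\<lambda>\<omega>. (t * indicator A \<omega> - f \<omega>)\<^sup>2)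
        = (\<lambda>\<omega>. t\<^sup>2 * indicator A \<omega> - 2 * t * (indicator A \<omega> * f \<omega>) + (f \<omega>)\<^sup>2)"
      by (auto simp: fun_eq_iff power2_eq_square algebra_simps indicator_def)
    also have "expectation \<dots> = t\<^sup>2 * prob A - 2 * t * ?e + ?s"
    proof -
      have "integrable M (\<lambda>\<omega>. t\<^sup>2 * indicator A \<omega> :: real)" "integrable M (\<lambda>\<omega>. 2 * t * (indicator A \<omega> * f \<omega>))"
        using int by (intro integrable_mult_right integrable_real_indicator; simp add: emeasure_eq_measure)+
      then show ?thesis using f(2) by simp
    qed
    finally show ?thesis .
  qed
  show ?thesis
  proof (cases "prob A = 0")
    case True
    have "?e = 0"
    proof (rule ccontr)
      assume "?e \<noteq> 0"
      then have "2 * ((?s + 1) / (2 * ?e)) * ?e = ?s + 1" by simp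
      then show False using q[of "(?s + 1) / (2 * ?e)"] True by simp
    qed
    then show ?thesis using True by simp
  next
    case False
    then have p: "prob A > 0" by (simp add: zero_less_measure_iff)
    have "(?e / prob A)\<^sup>2 * prob A - 2 * (?e / prob A) * ?e + ?s = ?s - ?e\<^sup>2 / prob A"
      using p by (simp add: power2_eq_square field_simps)
    then have "?e\<^sup>2 / prob A \<le> ?s" using q[of "?e / prob A"] by simp
    then show ?thesis using p by (simp add: pos_divide_le_eq mult.commute)
  qed
qed

section \<open>Marginals and Hermite coefficients of the subordinated sequence\<close>

locale uniform_gaussian_subordination = stationary_gaussian +
  fixes G :: "real \<Rightarrow> real"
  assumes G [measurable]: "G \<in> borel_measurable borel"
    and marg: "\<And>x. x \<in> {0..1} \<Longrightarrow> prob {\<omega> \<in> space M. G (\<xi> 1 \<omega>) \<le> x} = x"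
begin

lemma AE_in_unit_interval: "AE \<omega> in M. \<forall>j\<in>{1..}. 0 < G (\<xi> j \<omega>) \<and> G (\<xi> j \<omega>) < 1"
proof -
  have marg_j: "prob {\<omega> \<in> space M. G (\<xi> j \<omega>) \<le> x} = x" if "j \<ge> 1" "x \<in> {0..1}" for j x
  proof -
    let ?f = "indicator {z. G z \<le> x} :: real \<Rightarrow> real"
    have eq: "prob {\<omega> \<in> space M. G (\<xi> i \<omega>) \<le> x} = expectation (\<lambda>\<omega>. ?f (\<xi> i \<omega>))" for i
    proof -
      have "expectation (\<lambda>\<omega>. ?f (\<xi> i \<omega>)) = expectation (indicator {\<omega> \<in> space M. G (\<xi> i \<omega>) \<le> x})"
        by (intro Bochner_Integration.integral_cong) (auto simp: indicator_def)
      then show ?thesis by simp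
    qed
    have "expectation (\<lambda>\<omega>. ?f (\<xi> j \<omega>)) = expectation (\<lambda>\<omega>. ?f (\<xi> 1 \<omega>))"
      using that by (intro expectation_marginal) auto
    then show ?thesis using eq[of j] eq[of 1] marg[OF that(2)] by metis
  qed
  have "AE \<omega> in M. 0 < G (\<xi> j \<omega>) \<and> G (\<xi> j \<omega>) < 1" if j: "j \<ge> 1" for j
  proof (intro AE_conjI)
    have "prob {\<omega> \<in> space M. G (\<xi> j \<omega>) \<le> 0} = 0" using marg_j[OF j, of 0] by simp
    then have "AE \<omega> in M. \<not> G (\<xi> j \<omega>) \<le> 0" by (subst (asm) prob_eq_0) auto
    then show "AE \<omega> in M. 0 < G (\<xi> j \<omega>)" by (simp add: not_le)
    \<comment> \<open>The distribution function at 1 does not exclude the value 1 itself, so the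
      level 1 is approached from below.\<close>
    have "prob {\<omega> \<in> space M. 1 \<le> G (\<xi> j \<omega>)} \<le> 0 + e" if "e > 0" for e
    proof -
      define e' where "e' = min e 1"
      have "prob {\<omega> \<in> space M. 1 \<le> G (\<xi> j \<omega>)} \<le> prob {\<omega> \<in> space M. \<not> G (\<xi> j \<omega>) \<le> 1 - e'}"
        using that by (intro finite_measure_mono) (auto simp: e'_def)
      also have "\<dots> = 1 - prob {\<omega> \<in> space M. G (\<xi> j \<omega>) \<le> 1 - e'}" by (rule prob_neg) measurable
      also have "\<dots> \<le> e" using marg_j[OF j, of "1 - e'"] that by (auto simp: e'_def min_def split: if_splits)
      finally show ?thesis by simp
    qed
    then have "prob {\<omega> \<in> space M. 1 \<le> G (\<xi> j \<omega>)} \<le> 0" by (rule field_le_epsilon)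
    then have "prob {\<omega> \<in> space M. 1 \<le> G (\<xi> j \<omega>)} = 0" by (simp add: measure_le_0_iff)
    then have "AE \<omega> in M. \<not> 1 \<le> G (\<xi> j \<omega>)" by (subst (asm) prob_eq_0) auto
    then show "AE \<omega> in M. G (\<xi> j \<omega>) < 1" by (simp add: not_le)
  qed
  then show ?thesis by (intro AE_ball_countable[THEN iffD2]) auto
qed

text \<open>The increment of J_r is E 1_{x < X <= y} H_r; the event has probability y - x, and E
  H_r^2 = r!.\<close>

lemma Jfun_diff_sq_le:
  assumes "0 \<le> x" "x \<le> y" "y \<le> 1"
  shows "(Jfun M G (\<xi> 1) r y - Jfun M G (\<xi> 1) r x)\<^sup>2 \<le> (y - x) * fact r"
proof -
  let ?H = "\<lambda>\<omega>. hermite r (\<xi> 1 \<omega>)"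
  let ?A = "\<lambda>x. {\<omega> \<in> space M. G (\<xi> 1 \<omega>) \<le> x}"
  have H: "integrable M ?H" "integrable M (\<lambda>\<omega>. (?H \<omega>)\<^sup>2)" "expectation (\<lambda>\<omega>. (?H \<omega>)\<^sup>2) = fact r"
    using hermite_moments[of 1 r] by auto
  have [measurable]: "?A x \<in> events" for x by measurable
  have J: "Jfun M G (\<xi> 1) r x = expectation (\<lambda>\<omega>. indicator (?A x) \<omega> * ?H \<omega>)" for x
    unfolding Jfun_def by (intro Bochner_Integration.integral_cong) (auto simp: indicator_def)
  have int: "integrable M (\<lambda>\<omega>. indicator (?A x) \<omega> * ?H \<omega>)" for x
    using integrable_real_mult_indicator[OF _ H(1), of "?A x"] by (simp add: mult.commute)
  have sub: "?A x \<subseteq> ?A y" using assms by auto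
  have "Jfun M G (\<xi> 1) r y - Jfun M G (\<xi> 1) r x = expectation (\<lambda>\<omega>. indicator (?A y) \<omega> * ?H \<omega> - indicator (?A x) \<omega> * ?H \<omega>)"
    unfolding J using int by simp
  also have "\<dots> = expectation (\<lambda>\<omega>. indicator (?A y - ?A x) \<omega> * ?H \<omega>)"
    using sub by (intro Bochner_Integration.integral_cong) (auto simp: indicator_def)
  also have "(\<dots>)\<^sup>2 \<le> prob (?A y - ?A x) * fact r"
    using indicator_Cauchy_Schwarz[OF _ H(1,2), of "?A y - ?A x"] unfolding H(3) by simp
  also have "prob (?A y - ?A x) = y - x"
    using sub marg[of x] marg[of y] assms by (subst finite_measure_Diff) auto
  finally show ?thesis .
qed

lemma Jfun_0: "Jfun M G (\<xi> 1) r 0 = 0"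
proof -
  have "AE \<omega> in M. \<not> G (\<xi> 1 \<omega>) \<le> 0" using AE_in_unit_interval by eventually_elim force
  then have "Jfun M G (\<xi> 1) r 0 = expectation (\<lambda>_. 0)"
    unfolding Jfun_def by (intro integral_cong_AE) auto
  then show ?thesis by simp
qed

lemma Jfun_1: "r \<ge> 1 \<Longrightarrow> Jfun M G (\<xi> 1) r 1 = 0"
proof -
  assume r: "r \<ge> 1"
  have "AE \<omega> in M. G (\<xi> 1 \<omega>) \<le> 1" using AE_in_unit_interval by eventually_elim (force intro: less_imp_le)
  then have "Jfun M G (\<xi> 1) r 1 = expectation (\<lambda>\<omega>. hermite r (\<xi> 1 \<omega>))"
    unfolding Jfun_def by (intro integral_cong_AE) auto
  then show ?thesis using hermite_moments(4)[of 1 r] r by simp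
qed

lemma Jfun_Hoelder:
  assumes "x \<in> {0..1}" "y \<in> {0..1}"
  shows "\<bar>Jfun M G (\<xi> 1) r x / fact r - Jfun M G (\<xi> 1) r y / fact r\<bar> \<le> sqrt \<bar>x - y\<bar>"
proof -
  have le: "\<bar>Jfun M G (\<xi> 1) r y - Jfun M G (\<xi> 1) r x\<bar> \<le> fact r * sqrt (y - x)"
    if "0 \<le> x" "x \<le> y" "y \<le> 1" for x y
  proof -
    \<comment> \<open>Since r! >= 1, its root is at most r!, so division by r! leaves Hoelder
      constant 1.\<close>
    have "(y - x) * fact r \<le> (y - x) * (fact r * fact r)"
      using that fact_ge_1[of r, where 'a = real] by (intro mult_left_mono) auto
    also have "\<dots> = (fact r * sqrt (y - x))\<^sup>2"
      using that by (simp add: power_mult_distrib power2_eq_square[of "fact r"])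
    finally have "(Jfun M G (\<xi> 1) r y - Jfun M G (\<xi> 1) r x)\<^sup>2 \<le> (fact r * sqrt (y - x))\<^sup>2"
      using Jfun_diff_sq_le[OF that, of r] by linarith
    then show ?thesis using that by (simp add: abs_le_square_iff[symmetric])
  qed
  have "\<bar>Jfun M G (\<xi> 1) r x - Jfun M G (\<xi> 1) r y\<bar> \<le> fact r * sqrt \<bar>x - y\<bar>"
  proof (cases "x \<le> y")
    case True
    then show ?thesis using le[of x y] assms by (simp add: abs_minus_commute)
  next
    case False
    then show ?thesis using le[of y x] assms by simp
  qed
  then have "\<bar>Jfun M G (\<xi> 1) r x - Jfun M G (\<xi> 1) r y\<bar> / fact r \<le> sqrt \<bar>x - y\<bar>"
    by (simp add: pos_divide_le_eq mult.commute)
  then show ?thesis by (simp add: abs_divide flip: diff_divide_distrib)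
qed

end

section \<open>Limits of the deterministic bounds\<close>

lemma tendsto_real_powr_neg: "s < 0 \<Longrightarrow> (\<lambda>n. real n powr s) \<longlonglongrightarrow> 0"
  by (rule tendsto_neg_powr[OF _ filterlim_real_sequentially])

lemma tendsto_Suc_powr_neg: "s < 0 \<Longrightarrow> (\<lambda>n. (real n + 1) powr s) \<longlonglongrightarrow> 0"
  by (rule tendsto_neg_powr)
    (auto intro: filterlim_at_top_mono[OF filterlim_real_sequentially])

text \<open>After division by d_n the three summands are of order d_n^lam n^(-theta), n^lam sqrt(d_n
  / n) and n^(lam - 1/2); they vanish by \<open>c3\<close>, by the square root of \<open>c2\<close>,
  and by lam < 1/2.\<close>

lemma rank_bound_nonneg_tendsto:
  fixes d :: "nat \<Rightarrow> real" and lam theta K K' :: real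
  assumes lam: "0 \<le> lam" "lam < 1 / 2" and theta: "theta > 0" and K: "K \<ge> 0" "K' \<ge> 0"
    and d: "filterlim d at_top sequentially"
    and c2: "(\<lambda>n. real n powr (2 * lam) * d n) \<in> o(\<lambda>n. real n)"
    and c3: "(\<lambda>n. d n powr lam) \<in> o(\<lambda>n. real n powr theta)"
  defines "E \<equiv> \<lambda>n. K * real n powr (- theta) * d n" and "B \<equiv> \<lambda>n. K' * d n"
  defines "\<Delta> \<equiv> \<lambda>n. (2 + B n + 2 * E n) / real n"
  shows "(\<lambda>n. inverse (d n) * (2 * E n * (1 + (real n + 1) * \<Delta> n) powr lam
    + 2 * B n * (real n + 1) powr lam * sqrt (\<Delta> n) + 2 * B n * (real n + 1) powr (lam - 1/2))) \<longlonglongrightarrow> 0"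
proof -
  \<comment> \<open>As soon as d_n >= 1, the numerator of \<Delta> is at most c d_n.\<close>
  define c where "c = 2 + K' + 2 * K"
  have c: "c > 0" using K by (simp add: c_def)
  let ?u = "\<lambda>n. 2 * K * (1 + 2 * c) powr lam * (d n powr lam / real n powr theta)
      + 2 * K' * (2 powr lam * sqrt c) * sqrt (real n powr (2 * lam) * d n / real n)
      + 2 * K' * (real n + 1) powr (lam - 1/2)"
  have "?u \<longlonglongrightarrow> 2 * K * (1 + 2 * c) powr lam * 0 + 2 * K' * (2 powr lam * sqrt c) * sqrt 0 + 2 * K' * 0"
    using lam by (intro tendsto_add tendsto_mult tendsto_const tendsto_real_sqrt smalloD_tendsto[OF c2]
        smalloD_tendsto[OF c3] tendsto_Suc_powr_neg) auto
  then have u: "?u \<longlonglongrightarrow> 0" by simp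
  have "eventually (\<lambda>n. d n \<ge> 1 \<and> n \<ge> 1) sequentially"
    using d by (intro eventually_conj) (auto simp: filterlim_at_top eventually_ge_at_top)
  then have bounds: "eventually (\<lambda>n. 0 \<le> inverse (d n) * (2 * E n * (1 + (real n + 1) * \<Delta> n) powr lam
      + 2 * B n * (real n + 1) powr lam * sqrt (\<Delta> n) + 2 * B n * (real n + 1) powr (lam - 1/2))
    \<and> inverse (d n) * (2 * E n * (1 + (real n + 1) * \<Delta> n) powr lam
      + 2 * B n * (real n + 1) powr lam * sqrt (\<Delta> n) + 2 * B n * (real n + 1) powr (lam - 1/2)) \<le> ?u n) sequentially"
  proof eventually_elim
    case (elim n)
    have n: "real n \<ge> 1" and dn: "d n \<ge> 1" using elim by auto
    have nt: "real n powr (-theta) \<le> 1" "real n powr (-theta) \<ge> 0" using n theta powr_mono[of "-theta" 0 "real n"] by auto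
    have E0: "E n \<ge> 0" and B0: "B n \<ge> 0" using K dn by (auto simp: E_def B_def)
    have \<Delta>0: "\<Delta> n \<ge> 0" using E0 B0 by (simp add: \<Delta>_def)
    have "K * real n powr (-theta) * d n \<le> K * 1 * d n"
      using nt K dn by (intro mult_right_mono mult_left_mono) auto
    then have "2 + B n + 2 * E n \<le> c * d n" using dn by (simp add: E_def B_def c_def algebra_simps)
    then have \<Delta>le: "\<Delta> n \<le> c * (d n / real n)" unfolding \<Delta>_def using n by (simp add: divide_right_mono)
    have "(real n + 1) * \<Delta> n \<le> (2 * real n) * (c * (d n / real n))"
      using n \<Delta>le \<Delta>0 by (intro mult_mono) auto
    also have "\<dots> = 2 * c * d n" using n by simp
    finally have "1 + (real n + 1) * \<Delta> n \<le> (1 + 2 * c) * d n" using dn by (simp add: algebra_simps)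
    then have "(1 + (real n + 1) * \<Delta> n) powr lam \<le> ((1 + 2 * c) * d n) powr lam"
      using lam \<Delta>0 by (intro powr_mono2) auto
    also have "\<dots> = (1 + 2 * c) powr lam * d n powr lam" using c dn by (simp add: powr_mult)
    finally have p: "(1 + (real n + 1) * \<Delta> n) powr lam \<le> (1 + 2 * c) powr lam * d n powr lam" .
    have t1: "inverse (d n) * (2 * E n * (1 + (real n + 1) * \<Delta> n) powr lam)
        \<le> 2 * K * (1 + 2 * c) powr lam * (d n powr lam / real n powr theta)"
    proof -
      have "inverse (d n) * (2 * E n * (1 + (real n + 1) * \<Delta> n) powr lam)
          = 2 * K * real n powr (-theta) * (1 + (real n + 1) * \<Delta> n) powr lam"
        using dn by (simp add: E_def)
      also have "\<dots> \<le> 2 * K * real n powr (-theta) * ((1 + 2 * c) powr lam * d n powr lam)"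
        using p K by (intro mult_left_mono) auto
      finally show ?thesis by (simp add: powr_minus field_simps)
    qed
    have t2: "inverse (d n) * (2 * B n * (real n + 1) powr lam * sqrt (\<Delta> n))
        \<le> 2 * K' * (2 powr lam * sqrt c) * sqrt (real n powr (2 * lam) * d n / real n)"
    proof -
      have "inverse (d n) * (2 * B n * (real n + 1) powr lam * sqrt (\<Delta> n))
          = 2 * K' * ((real n + 1) powr lam * sqrt (\<Delta> n))" using dn by (simp add: B_def)
      also have "\<dots> \<le> 2 * K' * ((2 * real n) powr lam * sqrt (c * (d n / real n)))"
        using n K lam \<Delta>le \<Delta>0 by (intro mult_left_mono mult_mono powr_mono2 real_sqrt_le_mono) auto
      also have "(2 * real n) powr lam = 2 powr lam * sqrt (real n powr (2 * lam))"
        using n by (simp add: powr_mult powr_half_sqrt[symmetric] powr_powr)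
      finally show ?thesis by (simp add: real_sqrt_mult real_sqrt_divide mult_ac)
    qed
    have t3: "inverse (d n) * (2 * B n * (real n + 1) powr (lam - 1/2)) = 2 * K' * (real n + 1) powr (lam - 1/2)"
      using dn by (simp add: B_def)
    have "0 \<le> inverse (d n) * (2 * E n * (1 + (real n + 1) * \<Delta> n) powr lam
      + 2 * B n * (real n + 1) powr lam * sqrt (\<Delta> n) + 2 * B n * (real n + 1) powr (lam - 1/2))"
      using E0 B0 \<Delta>0 dn by simp
    then show ?case using t1 t2 t3 unfolding distrib_left by linarith
  qed
  show ?thesis
    by (rule tendsto_sandwich[OF _ _ tendsto_const u]) (use bounds in \<open>auto elim: eventually_mono\<close>)
qed

text \<open>Dividing by d_n turns \<open>B\<close> into the constant K' and \<open>E\<close> into K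
  n^(-theta), and the additive 3 into 3/d_n. Each remaining K' multiplies a negative power of n + 1
  or a positive power of a quantity of order d_n / n or smaller plus 2/n, all tending to 0.\<close>

lemma rank_bound_neg_tendsto:
  fixes d :: "nat \<Rightarrow> real" and lam theta K K' :: real
  assumes lam: "lam < 0" and theta: "theta > 0" and K: "K \<ge> 0" "K' \<ge> 0"
    and d: "filterlim d at_top sequentially" and dn: "(\<lambda>n. d n / real n) \<longlonglongrightarrow> 0"
  defines "E \<equiv> \<lambda>n. K * real n powr (- theta) * d n" and "B \<equiv> \<lambda>n. K' * d n"
  shows "(\<lambda>n. inverse (d n) * (2 * B n * (real n + 1) powr (lam - 1/2)
    + (2 * 3 powr (-lam) * E n + 2 * B n * sqrt ((2 + B n + 2 * 3 powr (-lam) * E n) / real n))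
    + (3 + 2 * 2 powr (-lam) * E n
        + 4 * B n * ((2 + 2 * B n + 2 * 2 powr (-lam) * E n) / real n) powr (1 / (2 * (1 - lam)))))) \<longlonglongrightarrow> 0"
proof -
  have nt: "(\<lambda>n. real n powr (-theta)) \<longlonglongrightarrow> 0" using theta by (intro tendsto_real_powr_neg) auto
  have inv: "(\<lambda>n. inverse (d n)) \<longlonglongrightarrow> 0" using d by (rule tendsto_inverse_0_at_top)
  have lin: "(\<lambda>n. (2 + b * B n + e * E n) / real n) \<longlonglongrightarrow> 0" for b e
  proof -
    have "(\<lambda>n. 2 / real n + b * K' * (d n / real n) + e * K * (real n powr (-theta) * (d n / real n))) \<longlonglongrightarrow> 0 + b * K' * 0 + e * K * (0 * 0)"
      by (intro tendsto_intros dn nt lim_const_over_n)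
    then show ?thesis by (simp add: E_def B_def add_divide_distrib mult_ac)
  qed
  have d1: "eventually (\<lambda>n. d n \<ge> 1) sequentially" using d by (auto simp: filterlim_at_top)
  let ?p = "1 / (2 * (1 - lam))"
  let ?u = "\<lambda>n. 2 * K' * (real n + 1) powr (lam - 1/2)
    + (2 * 3 powr (-lam) * (K * real n powr (-theta)) + 2 * K' * sqrt ((2 + 1 * B n + (2 * 3 powr (-lam)) * E n) / real n))
    + (3 * inverse (d n) + 2 * 2 powr (-lam) * (K * real n powr (-theta))
        + 4 * K' * ((2 + 2 * B n + (2 * 2 powr (-lam)) * E n) / real n) powr ?p)"
  have "(\<lambda>n. ((2 + 2 * B n + (2 * 2 powr (-lam)) * E n) / real n) powr ?p) \<longlonglongrightarrow> 0"
  proof (rule tendsto_zero_powrI[OF lin tendsto_const])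
    show "eventually (\<lambda>n. 0 \<le> (2 + 2 * B n + (2 * 2 powr (-lam)) * E n) / real n) sequentially"
      using d1 by eventually_elim (use K in \<open>auto simp: B_def E_def\<close>)
  qed (use lam in auto)
  then have "?u \<longlonglongrightarrow> 2 * K' * 0 + (2 * 3 powr (-lam) * (K * 0) + 2 * K' * sqrt 0) + (3 * 0 + 2 * 2 powr (-lam) * (K * 0) + 4 * K' * 0)"
    using lam by (intro tendsto_add tendsto_mult tendsto_const tendsto_real_sqrt nt inv lin tendsto_Suc_powr_neg) auto
  then have u: "?u \<longlonglongrightarrow> 0" by simp
  from d1 have eq: "eventually (\<lambda>n. inverse (d n) * (2 * B n * (real n + 1) powr (lam - 1/2)
    + (2 * 3 powr (-lam) * E n + 2 * B n * sqrt ((2 + B n + 2 * 3 powr (-lam) * E n) / real n))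
    + (3 + 2 * 2 powr (-lam) * E n
        + 4 * B n * ((2 + 2 * B n + 2 * 2 powr (-lam) * E n) / real n) powr ?p)) = ?u n) sequentially"
  proof eventually_elim
    case (elim n)
    have "inverse (d n) * E n = K * real n powr (-theta)" "inverse (d n) * B n = K'"
      using elim by (auto simp: E_def B_def)
    moreover have "i * (2 * b * p + (t3 * e + 2 * b * s) + (3 + t2 * e + 4 * b * q))
        = 2 * (i * b) * p + (t3 * (i * e) + 2 * (i * b) * s) + (3 * i + t2 * (i * e) + 4 * (i * b) * q)"
      for i b e p s q t2 t3 :: real by (simp add: algebra_simps)
    ultimately show ?case by simp
  qed
  show ?thesis by (rule Lim_transform_eventually[OF u]) (use eq in \<open>auto elim: eventually_mono\<close>)
qed

text \<open>H_0 = 1 makes the sum deterministic. This serves to exclude r = 0.\<close>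

lemma dnr_0: "prob_space M \<Longrightarrow> dnr M \<xi> 0 n = 0"
  by (simp add: dnr_def var_def covar_def hermite_eq_poly prob_space.prob_space)

theorem theorem1:
  fixes M :: "'a measure" and \<xi> :: "nat \<Rightarrow> 'a \<Rightarrow> real" and G :: "real \<Rightarrow> real"
    and L :: "real \<Rightarrow> real" and D lam theta :: real and r :: nat
  assumes "prob_space M"
    and meas: "\<And>i. \<xi> i \<in> borel_measurable M"
    and gauss: "gaussian_seq M \<xi>"
    and stat: "stationary_seq M \<xi>"
    and mean0: "(\<integral>\<omega>. \<xi> 1 \<omega> \<partial>M) = 0"
    and var1: "var M (\<xi> 1) = 1"
    and D: "0 < D" "D < 1"
    and L: "slowly_varying L"
    and cov: "(\<lambda>k::nat. covar M (\<xi> 1) (\<xi> (k + 1))) \<sim>[sequentially] (\<lambda>k. real k powr (- D) * L (real k))"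
    and G: "G \<in> borel_measurable borel"
    and marg: "\<And>x. x \<in> {0..1} \<Longrightarrow> measure M {\<omega> \<in> space M. G (\<xi> 1 \<omega>) \<le> x} = x"
    and r: "r = hermite_rank M G (\<xi> 1)"
    and Dr: "D * real r < 1"
    and lam: "lam < 1/3"
    and th: "theta > 0"
    and approx: "bigO_P M (\<lambda>n \<omega>. SUP t\<in>{0..1}. SUP x\<in>{0..1}.
          ereal (inverse (dnr M \<xi> r n) * (min x (1 - x)) powr (- lam) *
            \<bar>(\<Sum>j=1..nat \<lfloor>real n * t\<rfloor>. (if G (\<xi> j \<omega>) \<le> x then 1 else 0) - x)
             - Jfun M G (\<xi> 1) r x / fact r * (\<Sum>j=1..nat \<lfloor>real n * t\<rfloor>. hermite r (\<xi> j \<omega>))\<bar>))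
        (\<lambda>n. real n powr (- theta))"
    and c1: "(\<lambda>n. real n powr lam) \<in> o(\<lambda>n. dnr M \<xi> r n powr (1 - lam))"
    and c2: "(\<lambda>n. real n powr (2 * lam) * dnr M \<xi> r n) \<in> o(\<lambda>n. real n)"
    and c3: "(\<lambda>n. dnr M \<xi> r n powr lam) \<in> o(\<lambda>n. real n powr theta)"
  shows "smallo_P M (\<lambda>n \<omega>. SUP t\<in>{0..1}. SUP x\<in>{0..1}.
          ereal (inverse (dnr M \<xi> r n) * (min x (1 - x)) powr (- lam) *
            \<bar>(Ghat_left (\<lambda>j. G (\<xi> j \<omega>)) n (nat \<lfloor>real n * t\<rfloor>) x
               - real (nat \<lfloor>real n * t\<rfloor>) / real n * Ghat_left (\<lambda>j. G (\<xi> j \<omega>)) n n x)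
             - Jfun M G (\<xi> 1) r x / fact r *
               ((\<Sum>i=1..nat \<lfloor>real n * t\<rfloor>. hermite r (\<xi> i \<omega>))
                - real (nat \<lfloor>real n * t\<rfloor>) / real n * (\<Sum>i=1..n. hermite r (\<xi> i \<omega>)))\<bar>))"
proof -
  interpret prob_space M by fact
  interpret U: uniform_gaussian_subordination M \<xi> G
    using meas gauss stat mean0 var1 G marg by unfold_locales auto
  define d where "d = dnr M \<xi> r"
  define J where "J x = Jfun M G (\<xi> 1) r x / fact r" for x
  \<comment> \<open>\<open>hermite_rank\<close> is a \<open>LEAST\<close>, whose value is
    unspecified when no q qualifies, so positivity is obtained from \<open>c1\<close>: for r = 0 the
    right-hand side there is 0 powr (1 - lam) = 0, while n^lam is positive.\<close>
  have r1: "r \<ge> 1"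
  proof (rule ccontr)
    assume "\<not> r \<ge> 1"
    then have r0: "r = 0" by simp
    have "dnr M \<xi> r n = 0" for n unfolding r0 by (rule dnr_0[OF assms(1)])
    then have "eventually (\<lambda>n. real n powr lam \<le> 0) sequentially"
      using landau_o.smallD[OF c1, of 1] by simp
    from eventually_happens'[OF sequentially_bot eventually_conj[OF this eventually_ge_at_top[of 1]]]
    obtain n :: nat where "n \<ge> 1" "real n powr lam \<le> 0" by blast
    then show False by simp
  qed
  note maximal = U.hsum_maximal[OF L cov D r1 Dr, folded d_def]
  obtain C N0 where C: "C > 0" and N0: "\<And>n. n \<ge> N0 \<Longrightarrow> d n > 0 \<and> (\<exists>R. integrable M R \<and>
      (\<forall>\<omega>. \<forall>k\<le>n. (U.hsum r k \<omega>)\<^sup>2 \<le> R \<omega>) \<and> expectation R \<le> C * (d n)\<^sup>2)"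
    using maximal(1) by blast
  define A where "A n \<omega> = (SUP t\<in>{0..1}. SUP x\<in>{0..1}.
          ereal (inverse (dnr M \<xi> r n) * (min x (1 - x)) powr (- lam) *
            \<bar>(\<Sum>j=1..nat \<lfloor>real n * t\<rfloor>. (if G (\<xi> j \<omega>) \<le> x then 1 else 0) - x)
             - Jfun M G (\<xi> 1) r x / fact r * (\<Sum>j=1..nat \<lfloor>real n * t\<rfloor>. hermite r (\<xi> j \<omega>))\<bar>))" for n \<omega>
  define Y where "Y n \<omega> = (SUP t\<in>{0..1}. SUP x\<in>{0..1}.
          ereal (inverse (dnr M \<xi> r n) * (min x (1 - x)) powr (- lam) *
            \<bar>(Ghat_left (\<lambda>j. G (\<xi> j \<omega>)) n (nat \<lfloor>real n * t\<rfloor>) x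
               - real (nat \<lfloor>real n * t\<rfloor>) / real n * Ghat_left (\<lambda>j. G (\<xi> j \<omega>)) n n x)
             - Jfun M G (\<xi> 1) r x / fact r *
               ((\<Sum>i=1..nat \<lfloor>real n * t\<rfloor>. hermite r (\<xi> i \<omega>))
                - real (nat \<lfloor>real n * t\<rfloor>) / real n * (\<Sum>i=1..n. hermite r (\<xi> i \<omega>)))\<bar>))" for n \<omega>
  have approx': "bigO_P M A (\<lambda>n. real n powr (- theta))"
    using approx unfolding A_def .
  have rank_approx: "rank_approximation (\<lambda>j. G (\<xi> j \<omega>)) (\<lambda>k. U.hsum r k \<omega>) J n lam
      (K * real n powr (-theta) * d n) (K' * d n)"
    if n: "n \<ge> 1" "d n > 0" and K: "K \<ge> 0" and \<omega>: "\<forall>j\<in>{1..}. 0 < G (\<xi> j \<omega>) \<and> G (\<xi> j \<omega>) < 1"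
      and A: "A n \<omega> \<le> ereal (K * real n powr (-theta))" and S: "\<forall>k\<le>n. \<bar>U.hsum r k \<omega>\<bar> \<le> K' * d n"
    for n \<omega> K K'
  proof
    show "\<bar>ecount (\<lambda>j. G (\<xi> j \<omega>)) k x - real k * x - J x * U.hsum r k \<omega>\<bar>
        \<le> K * real n powr (-theta) * d n * min x (1 - x) powr lam" if k: "k \<le> n" and x: "0 < x" "x < 1" for k x
    proof -
      \<comment> \<open>This time makes the floor of n t exactly k, so the supremum dominates the
        error at every integer k <= n.\<close>
      let ?t = "real k / real n" and ?m = "min x (1 - x)"
      let ?e = "ecount (\<lambda>j. G (\<xi> j \<omega>)) k x - real k * x - J x * U.hsum r k \<omega>"
      have t: "?t \<in> {0..1}" "nat \<lfloor>real n * ?t\<rfloor> = k" using k n by (auto simp: field_simps)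
      have m: "?m > 0" using x by simp
      have "(\<Sum>j=1..k. (if G (\<xi> j \<omega>) \<le> x then 1 else 0) - x) = ecount (\<lambda>j. G (\<xi> j \<omega>)) k x - real k * x"
        by (simp add: ecount_def sum_subtractf)
      then have "ereal (inverse (d n) * ?m powr (-lam) * \<bar>?e\<bar>) \<le> A n \<omega>"
        unfolding A_def
        by (intro SUP_upper2[OF t(1)] SUP_upper2[of x]) (use x t in \<open>auto simp: d_def J_def U.hsum_def\<close>)
      also note A
      finally have "inverse (d n) * ?m powr (-lam) * \<bar>?e\<bar> \<le> K * real n powr (-theta)" by simp
      then have "(d n * ?m powr lam) * (inverse (d n) * ?m powr (-lam) * \<bar>?e\<bar>)
          \<le> (d n * ?m powr lam) * (K * real n powr (-theta))"
        using n by (intro mult_left_mono) auto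
      moreover have "(d n * ?m powr lam) * (inverse (d n) * ?m powr (-lam) * \<bar>?e\<bar>) = \<bar>?e\<bar>"
      proof -
        have "(a * p) * (inverse a * inverse p * e) = e" if "a > 0" "p > 0" for a p e :: real
          using that by (simp add: field_simps)
        moreover have "?m powr lam > 0" using m by (metis powr_gt_zero less_irrefl)
        ultimately show ?thesis using n(2) unfolding powr_minus by blast
      qed
      ultimately have "\<bar>?e\<bar> \<le> (d n * ?m powr lam) * (K * real n powr (-theta))" by linarith
      then show ?thesis by (simp only: mult_ac)
    qed
    show "\<bar>J x - J y\<bar> \<le> sqrt \<bar>x - y\<bar>" if "x \<in> {0..1}" "y \<in> {0..1}" for x y
      unfolding J_def by (rule U.Jfun_Hoelder[OF that])
    show "J 0 = 0" "J 1 = 0" using U.Jfun_0 U.Jfun_1[OF r1] by (simp_all add: J_def)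
  qed (use n K \<omega> S in auto)
  have bnd: "\<exists>b. (\<lambda>n. inverse (d n) * b n) \<longlonglongrightarrow> 0 \<and>
      (\<forall>n \<omega> k x. n \<ge> 1 \<longrightarrow> rank_approximation (\<lambda>j. G (\<xi> j \<omega>)) (\<lambda>k. U.hsum r k \<omega>) J n lam
        (K * real n powr (-theta) * d n) (K' * d n) \<longrightarrow> k \<le> n \<longrightarrow> 0 < x \<longrightarrow> x < 1 \<longrightarrow>
        min x (1 - x) powr (-lam) * \<bar>(Ghat_left (\<lambda>j. G (\<xi> j \<omega>)) n k x - real k / real n * Ghat_left (\<lambda>j. G (\<xi> j \<omega>)) n n x)
          - J x * (U.hsum r k \<omega> - real k / real n * U.hsum r n \<omega>)\<bar> \<le> b n)"
    if K: "K \<ge> 0" "K' \<ge> 0" for K K'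
  proof (cases "lam \<ge> 0")
    case True
    have lam2: "lam < 1 / 2" using lam by simp
    \<comment> \<open>The witness b stays schematic; the limit lemma fixes its shape, and the
      matching error bound then has exactly that right-hand side.\<close>
    show ?thesis
      by (rule exI, rule conjI,
          rule rank_bound_nonneg_tendsto[OF True lam2 th K maximal(3) c2[folded d_def] c3[folded d_def]],
          intro allI impI, rule rank_approximation.err_le_nonneg[OF _ True lam2])
  next
    case False
    then have lam0: "lam < 0" by simp
    show ?thesis
      by (rule exI, rule conjI, rule rank_bound_neg_tendsto[OF lam0 th K maximal(3) maximal(2)],
          intro allI impI, rule rank_approximation.err_le_neg[OF _ lam0])
  qed
  have "smallo_P M Y"
    unfolding smallo_P_def
  proof (intro allI impI)
    fix \<epsilon> :: real assume \<epsilon>: "\<epsilon> > 0"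
    let ?Bad = "\<lambda>n. {\<omega> \<in> space M. \<bar>Y n \<omega>\<bar> > ereal \<epsilon>}"
    show "(\<lambda>n. outer_prob M (?Bad n)) \<longlonglongrightarrow> 0"
    proof (rule order_tendstoI)
      fix a :: real assume "a < 0"
      then show "eventually (\<lambda>n. a < outer_prob M (?Bad n)) sequentially"
        by (intro always_eventually allI less_le_trans[OF _ outer_prob_nonneg]) auto
    next
      fix \<delta> :: real assume \<delta>: "0 < \<delta>"
      have "\<delta> / 2 > 0" using \<delta> by simp
      then obtain K0 N1 where N1: "\<And>n. n \<ge> N1 \<Longrightarrow>
          outer_prob M {\<omega> \<in> space M. \<bar>A n \<omega>\<bar> > ereal (K0 * real n powr (- theta))} < \<delta> / 2"
        using approx' unfolding bigO_P_def by blast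
      \<comment> \<open>\<open>bigO_P\<close> does not fix the sign of its constant, whereas
        \<open>rank_approximation\<close> needs a nonnegative error bound.\<close>
      define K where "K = max K0 0"
      \<comment> \<open>Markov's inequality gives C / K'^2 for the maximal sum; the added 1 makes
        this strictly less than \<delta>/2 and K' positive.\<close>
      define K' where "K' = sqrt (2 * C / \<delta>) + 1"
      have K: "K \<ge> 0" "K' > 0" "K0 \<le> K" using C \<delta> by (auto simp: K_def K'_def intro: add_nonneg_pos)
      have K'sq: "C / K'\<^sup>2 < \<delta> / 2"
      proof -
        have "2 * C / \<delta> = (sqrt (2 * C / \<delta>))\<^sup>2" using C \<delta> by simp
        also have "\<dots> < K'\<^sup>2" unfolding K'_def using C \<delta> by (intro power_strict_mono) auto
        finally show ?thesis using \<delta> K by (simp add: field_simps)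
      qed
      obtain b where b: "(\<lambda>n. inverse (d n) * b n) \<longlonglongrightarrow> 0" and
        bb: "\<And>n \<omega> k x. n \<ge> 1 \<Longrightarrow> rank_approximation (\<lambda>j. G (\<xi> j \<omega>)) (\<lambda>k. U.hsum r k \<omega>) J n lam
        (K * real n powr (-theta) * d n) (K' * d n) \<Longrightarrow> k \<le> n \<Longrightarrow> 0 < x \<Longrightarrow> x < 1 \<Longrightarrow>
        min x (1 - x) powr (-lam) * \<bar>(Ghat_left (\<lambda>j. G (\<xi> j \<omega>)) n k x - real k / real n * Ghat_left (\<lambda>j. G (\<xi> j \<omega>)) n n x)
          - J x * (U.hsum r k \<omega> - real k / real n * U.hsum r n \<omega>)\<bar> \<le> b n"
        using bnd[OF K(1) less_imp_le[OF K(2)]] by blast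
      have "eventually (\<lambda>n. inverse (d n) * b n < \<epsilon>) sequentially" using order_tendstoD(2)[OF b \<epsilon>] .
      moreover have "eventually (\<lambda>n. n \<ge> max (max N0 N1) 1) sequentially" by (rule eventually_ge_at_top)
      ultimately show "eventually (\<lambda>n. outer_prob M (?Bad n) < \<delta>) sequentially"
      proof eventually_elim
        case (elim n)
        have n: "n \<ge> 1" "n \<ge> N0" "n \<ge> N1" using elim(2) by auto
        have d: "d n > 0" using N0[OF n(2)] by blast
        obtain R where R: "integrable M R" "\<And>\<omega> k. k \<le> n \<Longrightarrow> (U.hsum r k \<omega>)\<^sup>2 \<le> R \<omega>"
          "expectation R \<le> C * (d n)\<^sup>2" using N0[OF n(2)] by blast
        obtain B1 where B1: "B1 \<in> events" "prob B1 < \<delta> / 2"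
          "{\<omega> \<in> space M. \<bar>A n \<omega>\<bar> > ereal (K0 * real n powr (- theta))} \<subseteq> B1"
          using outer_prob_lessE[OF N1[OF n(3)]] by blast
        \<comment> \<open>Outside this measurable set the majorant R controls all partial sums up to
          n simultaneously.\<close>
        define B2 where "B2 = {\<omega> \<in> space M. (K' * d n)\<^sup>2 \<le> R \<omega>}"
        have [measurable]: "R \<in> borel_measurable M" using R(1) by auto
        have B2: "B2 \<in> events" unfolding B2_def by measurable
        have "prob B2 \<le> expectation R / (K' * d n)\<^sup>2"
          unfolding B2_def
        proof (rule integral_Markov_inequality_measure[OF R(1), where A = "{}"])
          show "AE \<omega> in M. 0 \<le> R \<omega>" using R(2)[of 0] by (auto simp: U.hsum_def)
        qed (use K d in auto)
        also have "\<dots> \<le> C * (d n)\<^sup>2 / (K' * d n)\<^sup>2" using R(3) by (intro divide_right_mono) auto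
        also have "\<dots> = C / K'\<^sup>2" using d K by (simp add: power_mult_distrib)
        finally have pB2: "prob B2 < \<delta> / 2" using K'sq by linarith
        obtain B3 where B3: "B3 \<in> null_sets M"
          "{\<omega> \<in> space M. \<not> (\<forall>j\<in>{1..}. 0 < G (\<xi> j \<omega>) \<and> G (\<xi> j \<omega>) < 1)} \<subseteq> B3"
          using U.AE_in_unit_interval unfolding eventually_ae_filter by blast
        \<comment> \<open>\<open>B1\<close> covers failure of the assumed approximation,
          \<open>B2\<close> large Hermite sums, and \<open>B3\<close> observations outside (0,1).
          Their union is measurable, hence bounds the outer probability.\<close>
        have "?Bad n \<subseteq> B1 \<union> B2 \<union> B3"
        proof (rule subsetI, rule ccontr)
          fix \<omega> assume bad: "\<omega> \<in> ?Bad n" and "\<omega> \<notin> B1 \<union> B2 \<union> B3"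
          then have \<omega>: "\<omega> \<in> space M" "\<omega> \<notin> B1" "\<omega> \<notin> B2" "\<omega> \<notin> B3" by auto
          have "\<bar>A n \<omega>\<bar> \<le> ereal (K0 * real n powr (- theta))"
            using \<omega>(1,2) B1(3) by (metis (mono_tags, lifting) mem_Collect_eq not_le subsetD)
          then have "A n \<omega> \<le> ereal (K0 * real n powr (- theta))"
            by (cases "A n \<omega>") auto
          also have "\<dots> \<le> ereal (K * real n powr (- theta))" using K by (simp add: mult_right_mono)
          finally have An: "A n \<omega> \<le> ereal (K * real n powr (- theta))" .
          have S: "\<forall>k\<le>n. \<bar>U.hsum r k \<omega>\<bar> \<le> K' * d n"
          proof (intro allI impI)
            fix k assume "k \<le> n"
            then have "(U.hsum r k \<omega>)\<^sup>2 < (K' * d n)\<^sup>2" using R(2)[of k \<omega>] \<omega> by (auto simp: B2_def)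
            then have "\<bar>U.hsum r k \<omega>\<bar>\<^sup>2 < (K' * d n)\<^sup>2" by simp
            then have "\<bar>U.hsum r k \<omega>\<bar> < K' * d n" by (rule power2_less_imp_less) (use K d in auto)
            then show "\<bar>U.hsum r k \<omega>\<bar> \<le> K' * d n" by simp
          qed
          have ra: "rank_approximation (\<lambda>j. G (\<xi> j \<omega>)) (\<lambda>k. U.hsum r k \<omega>) J n lam
              (K * real n powr (-theta) * d n) (K' * d n)"
            by (rule rank_approx[OF n(1) d K(1) _ An S]) (use \<omega> B3(2) in blast)
          let ?y = "\<lambda>t x. inverse (dnr M \<xi> r n) * (min x (1 - x)) powr (- lam) *
            \<bar>(Ghat_left (\<lambda>j. G (\<xi> j \<omega>)) n (nat \<lfloor>real n * t\<rfloor>) x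
               - real (nat \<lfloor>real n * t\<rfloor>) / real n * Ghat_left (\<lambda>j. G (\<xi> j \<omega>)) n n x)
             - Jfun M G (\<xi> 1) r x / fact r *
               ((\<Sum>i=1..nat \<lfloor>real n * t\<rfloor>. hermite r (\<xi> i \<omega>))
                - real (nat \<lfloor>real n * t\<rfloor>) / real n * (\<Sum>i=1..n. hermite r (\<xi> i \<omega>)))\<bar>"
          have "?y t x \<le> \<epsilon>" if t: "t \<in> {0..1}" and x: "x \<in> {0..1}" for t x
          proof (cases "x = 0 \<or> x = 1")
            case True
            \<comment> \<open>At the endpoints the weight is 0 powr (-lam) = 0 for either sign of
              lam.\<close>
            then show ?thesis using \<epsilon> by auto
          next
            case False
            then have x': "0 < x" "x < 1" using x by auto
            have k: "nat \<lfloor>real n * t\<rfloor> \<le> n"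
            proof -
              have "real n * t \<le> real n" using t by (simp add: mult_left_le)
              then have "\<lfloor>real n * t\<rfloor> \<le> int n" by (simp add: floor_le_iff)
              then show ?thesis by simp
            qed
            from mult_left_mono[OF bb[OF n(1) ra k x'], of "inverse (d n)"] d
            have "?y t x \<le> inverse (d n) * b n" by (simp add: d_def J_def U.hsum_def mult.assoc)
            then show ?thesis using elim(1) by linarith
          qed
          then have "Y n \<omega> \<le> ereal \<epsilon>" unfolding Y_def by (intro SUP_least) simp
          \<comment> \<open>The term at t = 0, x = 0 is 0, so the absolute value in
            \<open>smallo_P\<close> is that of a nonnegative quantity.\<close>
          moreover have "0 \<le> Y n \<omega>"
            unfolding Y_def by (intro SUP_upper2[of 0] SUP_upper2[of 0]) auto
          ultimately show False using bad by (auto dest: leD)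
        qed
        then have "outer_prob M (?Bad n) \<le> prob (B1 \<union> B2 \<union> B3)"
          using B1 B2 B3 by (intro outer_prob_le) auto
        also have "\<dots> = prob (B1 \<union> B2)" using B1 B2 B3 by (intro measure_Un_null_set) auto
        also have "\<dots> \<le> prob B1 + prob B2" using B1 B2 by (intro measure_Un_le) auto
        also have "\<dots> < \<delta>" using B1 pB2 by simp
        finally show ?case .
      qed
    qed
  qed
  then show ?thesis unfolding Y_def .
qed

end
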